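(* Let $R>0$, $p>1$, let $a>0$ be a constant, and let $\mathcal{B}\in\{\mathcal{D},\mathcal{N},\mathcal{R}_\beta:\beta\in\mathbb{R}\}$ be a boundary operator at $x=0$. For $\lambda\in\mathbb{R}$ consider the singular boundary value problem $$-u''=\lambda u-a|u|^{p-1}u\ \text{ in }[0,R),\qquad \mathcal{B}u(0)=0,\qquad u(R)=+\infty. \tag{P}$$ Then: (a) For every $\lambda\in\mathbb{R}$, problem (P) has a unique positive solution, $L_\lambda\in\mathcal{C}^2([0,R);\mathbb{R})$. (b) The map $$\mathbb{R}\longrightarrow\mathcal{C}([0,R);\mathbb{R}),\qquad \lambda\mapsto L_\lambda,$$ is differentiable and point-wise increasing in $\lambda$. (c) One has that $\lim_{\lambda\uparrow\infty}L_\lambda=+\infty$ uniformly in compact subsets of $[0,R)$, unless $\mathcal{B}=\mathcal{D}$ at $x=0$, in which case $L_\lambda(0)=0$ for all $\lambda\in\mathbb{R}$. (d) One has that $\lim_{\lambda\downarrow-\infty}L_\lambda=0$ uniformly in compact subsets of $[0,R)$.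
   Context: Boundary operators at $x=0$: $\mathcal{D}u(0)=u(0)$ (Dirichlet), $\mathcal{N}u(0)=-u'(0)$ (Neumann), $\mathcal{R}_\beta u(0)=-u'(0)+\beta u(0)$ (Robin), where $\beta\in\mathbb{R}$ may have any sign; $\mathcal{R}_0=\mathcal{N}$. The condition $u(R)=+\infty$ means $\lim_{x\uparrow R}u(x)=+\infty$. A positive solution is a solution $u$ of the problem with $u(x)>0$ for all $x\in(0,R)$. $\mathcal{C}([0,R);\mathbb{R})$ denotes the space of continuous real-valued functions on $[0,R)$. *)

theory Defs
  imports "HOL-Analysis.Analysis"
begin

datatype boundary_operator = Dirichlet | Neumann | Robin real

text \<open>The operators only involve the values \<open>v = u(0)\<close> and \<open>d = u'(0)\<close>, the latter being
  the one-sided derivative at the left endpoint.\<close>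

fun boundary_value :: "boundary_operator \<Rightarrow> real \<Rightarrow> real \<Rightarrow> real" where
  "boundary_value Dirichlet v d = v"
| "boundary_value Neumann v d = - d"
| "boundary_value (Robin \<beta>) v d = - d + \<beta> * v"

lemma boundary_value_Robin_0: "boundary_value (Robin 0) = boundary_value Neumann"
  by (intro ext) simp

text \<open>Derivatives are taken within \<open>[0,R)\<close>, hence one-sided at \<open>0\<close>. Continuity of the second
  derivative is not part of the notion of solution.\<close>

definition positive_solution ::
  "real \<Rightarrow> real \<Rightarrow> real \<Rightarrow> boundary_operator \<Rightarrow> real \<Rightarrow> (real \<Rightarrow> real) \<Rightarrow> bool" where
  "positive_solution R p a B l u \<longleftrightarrow>
     (\<exists>u' u''.
        (\<forall>x\<in>{0..<R}. (u has_real_derivative u' x) (at x within {0..<R})) \<and>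
        (\<forall>x\<in>{0..<R}. (u' has_real_derivative u'' x) (at x within {0..<R})) \<and>
        (\<forall>x\<in>{0..<R}. - u'' x = l * u x - a * \<bar>u x\<bar> powr (p - 1) * u x) \<and>
        boundary_value B (u 0) (u' 0) = 0) \<and>
     filterlim u at_top (at_left R) \<and>
     (\<forall>x\<in>{0<..<R}. u x > 0)"

definition C2_on :: "real set \<Rightarrow> (real \<Rightarrow> real) \<Rightarrow> bool" where
  "C2_on S u \<longleftrightarrow>
     (\<exists>u' u''.
        (\<forall>x\<in>S. (u has_real_derivative u' x) (at x within S)) \<and>
        (\<forall>x\<in>S. (u' has_real_derivative u'' x) (at x within S)) \<and>
        continuous_on S u'')"

text \<open>Differentiability of a curve in the space of continuous functions on \<open>S\<close> with its usual
  topology of uniform convergence on compact subsets of \<open>S\<close>: the difference quotients converge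
  in that space.\<close>

definition differentiable_curve_C :: "real set \<Rightarrow> (real \<Rightarrow> real \<Rightarrow> real) \<Rightarrow> bool" where
  "differentiable_curve_C S F \<longleftrightarrow>
     (\<forall>l. continuous_on S (F l)) \<and>
     (\<forall>l. \<exists>D. continuous_on S D \<and>
        (\<forall>K. compact K \<and> K \<subseteq> S \<longrightarrow>
           uniform_limit K (\<lambda>h x. (F (l + h) x - F l x) / h) D (at 0)))"

end

theory Submission imports Defs begin

text \<open>
  If \<open>v\<close> is a positive supersolution and \<open>u\<close> a solution with the same boundary condition at \<open>0\<close>, the
  Wronskian \<open>u' v - u v'\<close> is nondecreasing wherever \<open>u \<ge> v\<close>; hence once \<open>u / v\<close> exceeds \<open>1\<close> it
  stays bounded away from \<open>1\<close> up to \<open>R\<close>. By conservation of energy the quotient of two solutions that blow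
  up at \<open>R\<close> tends to \<open>1\<close> there, even for different parameters, so that uniqueness and
  monotonicity follow from this comparison principle. Existence is obtained by shooting from \<open>0\<close> under an
  explicit supersolution that is infinite at \<open>R\<close>. For differentiability, the non-growing solution \<open>D\<close> of the
  linearised problem yields the super- and subsolutions \<open>L + h D \<plusminus> k h\<^sup>2 (L + D)\<close> for the parameter
  \<open>\<lambda> + h\<close>, so comparison bounds the error of the first-order expansion by \<open>k h\<^sup>2 (L + D)\<close>.
  The limits in \<open>\<lambda>\<close> are concavity and convexity arguments.
\<close>

subsection \<open>Second-order initial value problems\<close>

lemma ode_exists_compact:
  fixes F :: "real \<Rightarrow> 'a::banach \<Rightarrow> 'a"
  assumes b: "0 \<le> b" and K: "0 \<le> K"
    and cont: "continuous_on ({0..b} \<times> UNIV) (\<lambda>z. F (fst z) (snd z))"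
    and lip: "\<And>x y z. x \<in> {0..b} \<Longrightarrow> norm (F x y - F x z) \<le> K * norm (y - z)"
  shows "\<exists>y. y 0 = y0 \<and> (\<forall>x\<in>{0..b}. (y has_vector_derivative F x (y x)) (at x within {0..b}))"
proof -
  \<comment> \<open>Weighting by \<open>exp (- k * t)\<close> makes the Picard map a contraction
    with factor \<open>K / k < 1\<close> on all of \<open>{0..b}\<close>, however long the interval
    is.\<close>
  define k where "k = 2 * K + 1"
  have k: "k > 0" "K / k < 1" using K by (auto simp: k_def field_simps)
  \<comment> \<open>The complete space of bounded continuous functions lives on the whole line, so
    arguments are clamped to \<open>{0..b}\<close>.\<close>
  define c where "c = (\<lambda>x. max 0 (min b x))"
  have c: "c x \<in> {0..b}" "x \<in> {0..b} \<Longrightarrow> c x = x" for x using b by (auto simp: c_def)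
  have ccont: "continuous_on UNIV c" unfolding c_def by (intro continuous_intros)
  define H where "H = (\<lambda>(z::real \<Rightarrow>\<^sub>C 'a) t. F t (exp (k * t) *\<^sub>R z t))"
  have Hcont: "continuous_on {0..b} (H z)" for z
  proof -
    have "continuous_on {0..b} (\<lambda>t. F (fst (t, exp (k * t) *\<^sub>R z t)) (snd (t, exp (k * t) *\<^sub>R z t)))"
      by (rule continuous_on_compose2[OF cont]) (auto intro!: continuous_intros)
    then show ?thesis by (simp add: H_def)
  qed
  define J where "J = (\<lambda>z x. y0 + integral {0..x} (H z))"
  have J: "(J z has_vector_derivative H z x) (at x within {0..b})" if "x \<in> {0..b}" for z x
    unfolding J_def
    using has_vector_derivative_add[OF has_vector_derivative_const integral_has_vector_derivative[OF Hcont that]]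
    by simp
  have Jcont: "continuous_on {0..b} (J z)" for z
    using J by (rule continuous_on_vector_derivative)
  define G where "G = (\<lambda>z x. exp (- k * c x) *\<^sub>R J z (c x))"
  have Gcont: "continuous_on UNIV (G z)" for z
    unfolding G_def using c
    by (intro continuous_intros ccont continuous_on_compose2[OF Jcont ccont]) auto
  have Gb: "G z \<in> bcontfun" for z
  proof -
    have "compact (J z ` {0..b})" by (rule compact_continuous_image[OF Jcont]) auto
    then obtain M where M: "\<And>x. x \<in> {0..b} \<Longrightarrow> norm (J z x) \<le> M"
      by (meson compact_imp_bounded bounded_iff imageI)
    show ?thesis
    proof (rule bcontfun_normI[OF Gcont])
      fix x
      have "exp (- k * c x) \<le> 1" using c(1)[of x] k by auto
      then have "exp (- k * c x) * norm (J z (c x)) \<le> 1 * M"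
        using M[OF c(1)[of x]] by (intro mult_mono) auto
      then show "norm (G z x) \<le> M" by (simp add: G_def)
    qed
  qed
  define T where "T = (\<lambda>z. Bcontfun (G z))"
  have T: "apply_bcontfun (T z) = G z" for z unfolding T_def by (rule Bcontfun_inverse[OF Gb])
  have "dist (T z) (T w) \<le> K / k * dist z w" for z w
  proof (rule dist_bound)
    fix x0 define x where "x = c x0"
    have x: "x \<in> {0..b}" using c by (simp add: x_def)
    define d where "d = dist z w"
    have d: "norm (z t - w t) \<le> d" for t using dist_bounded[of z t w] by (simp add: d_def dist_norm)
    have d0: "d \<ge> 0" by (simp add: d_def)
    have sub: "{0..x} \<subseteq> {0..b}" using x by auto
    have int: "H z integrable_on {0..x}" for z
      by (rule integrable_continuous_real[OF continuous_on_subset[OF Hcont sub]])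
    have "((\<lambda>t. K * d / k * exp (k * t)) has_vector_derivative K * d * exp (k * t)) (at t within {0..x})" for t
      using k by (auto intro!: derivative_eq_intros simp: has_real_derivative_iff_has_vector_derivative[symmetric])
    then have FTC: "((\<lambda>t. K * d * exp (k * t)) has_integral
        K * d / k * exp (k * x) - K * d / k * exp (k * 0)) {0..x}"
      using x by (intro fundamental_theorem_of_calculus) auto
    have "norm (J z x - J w x) = norm (integral {0..x} (\<lambda>t. H z t - H w t))"
      by (simp add: J_def integral_diff[OF int int])
    also have "\<dots> \<le> integral {0..x} (\<lambda>t. K * d * exp (k * t))"
    proof (rule integral_norm_bound_integral)
      show "(\<lambda>t. H z t - H w t) integrable_on {0..x}" by (intro integrable_diff int)
      show "(\<lambda>t. K * d * exp (k * t)) integrable_on {0..x}" using FTC by blast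
      fix t assume "t \<in> {0..x}"
      then have "norm (H z t - H w t) \<le> K * norm (exp (k * t) *\<^sub>R z t - exp (k * t) *\<^sub>R w t)"
        unfolding H_def using sub by (intro lip) auto
      also have "\<dots> = K * (exp (k * t) * norm (z t - w t))"
        by (simp flip: scaleR_right_diff_distrib)
      also have "\<dots> \<le> K * (exp (k * t) * d)" using K d by (intro mult_left_mono) auto
      finally show "norm (H z t - H w t) \<le> K * d * exp (k * t)" by (simp add: ac_simps)
    qed
    also have "\<dots> = K * d / k * exp (k * x) - K * d / k" by (subst integral_unique[OF FTC]) simp
    also have "\<dots> \<le> K * d / k * exp (k * x)" using K d0 k by simp
    finally have "exp (- k * x) * norm (J z x - J w x) \<le> exp (- k * x) * (K * d / k * exp (k * x))"
      by (intro mult_left_mono) auto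
    also have "\<dots> = K * d / k" by (simp add: exp_minus field_simps)
    finally show "dist (T z x0) (T w x0) \<le> K / k * dist z w"
      by (simp add: T G_def dist_norm d_def x_def flip: scaleR_right_diff_distrib)
  qed
  then obtain z where z: "T z = z"
    using banach_fix_type[of "K / k" T] K k by auto
  define y where "y = (\<lambda>x. exp (k * x) *\<^sub>R z x)"
  have yJ: "y x = J z x" if "x \<in> {0..b}" for x
  proof -
    have "z x = G z x" using T[of z] z by simp
    then show ?thesis using that c by (simp add: y_def G_def exp_minus)
  qed
  show ?thesis
  proof (intro exI conjI ballI)
    show "y 0 = y0" using yJ[of 0] b by (simp add: J_def)
    fix x assume x: "x \<in> {0..b}"
    have "(y has_vector_derivative H z x) (at x within {0..b})"
      by (rule has_vector_derivative_transform[OF x yJ J[OF x]])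
    then show "(y has_vector_derivative F x (y x)) (at x within {0..b})"
      by (simp add: H_def y_def)
  qed
qed

section \<open>Second derivatives, Wronskians and a Gronwall estimate\<close>

definition twice_deriv :: "real set \<Rightarrow> (real \<Rightarrow> real) \<Rightarrow> (real \<Rightarrow> real) \<Rightarrow> (real \<Rightarrow> real) \<Rightarrow> bool" where
  "twice_deriv S u u1 u2 \<longleftrightarrow> (\<forall>x\<in>S. (u has_real_derivative u1 x) (at x within S)
     \<and> (u1 has_real_derivative u2 x) (at x within S))"

lemma twice_deriv_subset: "twice_deriv S u u1 u2 \<Longrightarrow> T \<subseteq> S \<Longrightarrow> twice_deriv T u u1 u2"
  unfolding twice_deriv_def by (meson DERIV_subset subsetD)

lemma twice_deriv_cong2: "twice_deriv S u u1 u2 \<Longrightarrow> (\<And>x. x \<in> S \<Longrightarrow> u2 x = w2 x) \<Longrightarrow> twice_deriv S u u1 w2"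
  unfolding twice_deriv_def by auto

lemma twice_deriv_continuous:
  assumes "twice_deriv S u u1 u2" shows "continuous_on S u" "continuous_on S u1"
  using assms unfolding twice_deriv_def by (meson DERIV_continuous_on)+

lemma twice_deriv_lincomb:
  assumes "twice_deriv S u u1 u2" "twice_deriv S v v1 v2"
  shows "twice_deriv S (\<lambda>x. c * u x + d * v x) (\<lambda>x. c * u1 x + d * v1 x) (\<lambda>x. c * u2 x + d * v2 x)"
  using assms unfolding twice_deriv_def by (auto intro!: derivative_eq_intros)

lemma twice_deriv_diff:
  assumes "twice_deriv S u u1 u2" "twice_deriv S v v1 v2"
  shows "twice_deriv S (\<lambda>x. u x - v x) (\<lambda>x. u1 x - v1 x) (\<lambda>x. u2 x - v2 x)"
  using twice_deriv_lincomb[OF assms, of 1 "-1"] by simp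

lemma wronskian_deriv:
  assumes "twice_deriv S u u1 u2" "twice_deriv S v v1 v2" "x \<in> S"
  shows "((\<lambda>x. u1 x * v x - u x * v1 x) has_real_derivative (u2 x * v x - u x * v2 x)) (at x within S)"
  using assms unfolding twice_deriv_def by (auto intro!: derivative_eq_intros simp: algebra_simps)

lemma within_interval_at:
  fixes x :: real
  assumes "{x0<..<x1} \<subseteq> S" "x \<in> {x0<..<x1}"
  shows "at x within S = at x"
  by (metis assms at_within_open_subset open_greaterThanLessThan)

lemma deriv_nonneg_imp_le:
  fixes f :: "real \<Rightarrow> real"
  assumes "x \<le> y" and "{x..y} \<subseteq> S"
    and "\<And>z. z \<in> S \<Longrightarrow> (f has_real_derivative f' z) (at z within S)"
    and "\<And>z. x < z \<Longrightarrow> z < y \<Longrightarrow> 0 \<le> f' z"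
  shows "f x \<le> f y"
proof (rule DERIV_nonneg_imp_increasing_open[OF assms(1)])
  show "continuous_on {x..y} f"
    using assms(2,3) by (meson DERIV_continuous_on continuous_on_subset)
  fix z assume z: "x < z" "z < y"
  then have "at z within S = at z" using assms(2) by (intro within_interval_at[of x y]) auto
  moreover have "z \<in> S" using assms(2) z by auto
  ultimately show "\<exists>d. DERIV f z :> d \<and> d \<ge> 0" using assms(3)[of z] assms(4)[OF z] by auto
qed

text \<open>The energy \<open>e^2 + e1^2\<close> has derivative \<open>2 e e1 + 2 e1 e2\<close>,
  which is at most \<open>(K + 1) * 2 \<bar>e1\<bar> \<bar>e\<bar>\<close> and hence at most
  \<open>K + 1\<close> times the energy itself.\<close>

lemma gronwall_second_order:
  fixes e :: "real \<Rightarrow> real"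
  assumes tw: "twice_deriv {x0..b} e e1 e2" and K: "\<And>x. x \<in> {x0..b} \<Longrightarrow> \<bar>e2 x\<bar> \<le> K * \<bar>e x\<bar>"
    and x: "x \<in> {x0..b}" and K0: "K \<ge> 0"
  shows "(e x)\<^sup>2 + (e1 x)\<^sup>2 \<le> ((e x0)\<^sup>2 + (e1 x0)\<^sup>2) * exp ((K + 1) * (x - x0))"
proof -
  define E where "E = (\<lambda>x. exp (- (K + 1) * (x - x0)))"
  have E: "(E has_real_derivative - (K + 1) * E z) (at z within {x0..b})" for z
    unfolding E_def by (auto intro!: derivative_eq_intros)
  let ?q = "\<lambda>x. - ((e x)\<^sup>2 + (e1 x)\<^sup>2) * E x"
  let ?q' = "\<lambda>x. ((K + 1) * ((e x)\<^sup>2 + (e1 x)\<^sup>2) - (2 * e x * e1 x + 2 * e1 x * e2 x)) * E x"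
  have "?q x0 \<le> ?q x"
  proof (rule deriv_nonneg_imp_le[where S = "{x0..b}" and f = ?q and f' = ?q'])
    show "(?q has_real_derivative ?q' z) (at z within {x0..b})" if "z \<in> {x0..b}" for z
    proof -
      have 1: "(e has_real_derivative e1 z) (at z within {x0..b})"
        and 2: "(e1 has_real_derivative e2 z) (at z within {x0..b})" using tw that by (auto simp: twice_deriv_def)
      show ?thesis unfolding power2_eq_square
        by (rule DERIV_cong[OF DERIV_mult[OF DERIV_minus[OF DERIV_add[OF DERIV_mult'[OF 1 1] DERIV_mult'[OF 2 2]]] E]]) algebra
    qed
    fix z assume z: "x0 < z" "z < x"
    have "e1 z * e2 z \<le> \<bar>e1 z\<bar> * (K * \<bar>e z\<bar>)"
      using K[of z] z x by (rule_tac order_trans[OF abs_ge_self]) (simp add: abs_mult mult_left_mono)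
    moreover have "e z * e1 z \<le> \<bar>e1 z\<bar> * \<bar>e z\<bar>" by (metis abs_ge_self abs_mult mult.commute)
    ultimately have "2 * e z * e1 z + 2 * e1 z * e2 z \<le> (K + 1) * (2 * \<bar>e1 z\<bar> * \<bar>e z\<bar>)"
      by (simp add: algebra_simps)
    also have "2 * \<bar>e1 z\<bar> * \<bar>e z\<bar> \<le> (e z)\<^sup>2 + (e1 z)\<^sup>2"
      using sum_squares_bound[of "\<bar>e1 z\<bar>" "\<bar>e z\<bar>"] by (simp add: add.commute)
    finally show "0 \<le> ?q' z" using K0 by (simp add: mult_left_mono E_def)
  qed (use x in auto)
  then have "((e x)\<^sup>2 + (e1 x)\<^sup>2) * E x \<le> (e x0)\<^sup>2 + (e1 x0)\<^sup>2"
    by (simp add: E_def[THEN fun_cong, of x0] algebra_simps)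
  then have "((e x)\<^sup>2 + (e1 x)\<^sup>2) * E x * exp ((K + 1) * (x - x0))
     \<le> ((e x0)\<^sup>2 + (e1 x0)\<^sup>2) * exp ((K + 1) * (x - x0))"
    by (intro mult_right_mono) auto
  moreover have "E x * exp ((K + 1) * (x - x0)) = 1"
    by (simp add: E_def algebra_simps flip: exp_add)
  ultimately show ?thesis by (simp add: mult.assoc)
qed

lemma second_order_unique:
  assumes "twice_deriv {x0..b} e e1 e2" "\<And>x. x \<in> {x0..b} \<Longrightarrow> \<bar>e2 x\<bar> \<le> K * \<bar>e x\<bar>"
    and "e x0 = 0" "e1 x0 = 0" "x \<in> {x0..b}"
  shows "e x = 0" "e1 x = 0"
proof -
  have K: "\<bar>e2 x\<bar> \<le> \<bar>K\<bar> * \<bar>e x\<bar>" if "x \<in> {x0..b}" for x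
    using assms(2)[OF that] by (meson abs_ge_self abs_ge_zero mult_right_mono order_trans)
  have "(e x)\<^sup>2 + (e1 x)\<^sup>2 \<le> 0" using gronwall_second_order[OF assms(1) K assms(5)] assms(3,4) by simp
  then show "e x = 0" "e1 x = 0"
    by (simp_all add: sum_power2_le_zero_iff)
qed


section \<open>Global solvability of second-order equations\<close>

lemma second_order_exists_compact:
  fixes f :: "real \<Rightarrow> real \<Rightarrow> real"
  assumes b: "0 \<le> b" and K: "0 \<le> K"
    and cont: "continuous_on ({0..b} \<times> UNIV) (\<lambda>z. f (fst z) (snd z))"
    and lip: "\<And>x y z. x \<in> {0..b} \<Longrightarrow> \<bar>f x y - f x z\<bar> \<le> K * \<bar>y - z\<bar>"
  shows "\<exists>u u1. u 0 = s \<and> u1 0 = s1 \<and> twice_deriv {0..b} u u1 (\<lambda>x. f x (u x))"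
proof -
  define F where "F = (\<lambda>x (y::real\<times>real). (snd y, f x (fst y)))"
  have "continuous_on ({0..b} \<times> UNIV) (\<lambda>z. F (fst z) (snd z))"
  proof -
    have "continuous_on ({0..b} \<times> UNIV) (\<lambda>z::real\<times>real\<times>real. f (fst (fst z, fst (snd z))) (snd (fst z, fst (snd z))))"
      by (rule continuous_on_compose2[OF cont]) (auto intro!: continuous_intros)
    then show ?thesis by (auto simp: F_def intro!: continuous_intros)
  qed
  moreover have "norm (F x y - F x z) \<le> (K + 1) * norm (y - z)" if "x \<in> {0..b}" for x y z
  proof -
    have "norm (F x y - F x z) \<le> \<bar>snd y - snd z\<bar> + \<bar>f x (fst y) - f x (fst z)\<bar>"
      using norm_Pair_le[of "snd y - snd z" "f x (fst y) - f x (fst z)"] by (simp add: F_def)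
    also have "\<dots> \<le> \<bar>snd y - snd z\<bar> + K * \<bar>fst y - fst z\<bar>" using lip[OF that] by simp
    also have "\<dots> \<le> norm (y - z) + K * norm (y - z)"
    proof -
      have "norm (fst (y - z)) \<le> norm (y - z)" "norm (snd (y - z)) \<le> norm (y - z)"
        using norm_fst_le[of "fst (y - z)" "snd (y - z)"] norm_snd_le[of "snd (y - z)" "fst (y - z)"]
        by (simp_all only: prod.collapse)
      then show ?thesis using K by (intro add_mono mult_left_mono) auto
    qed
    finally show ?thesis by (simp add: algebra_simps)
  qed
  ultimately have "\<exists>y. y 0 = (s, s1) \<and> (\<forall>x\<in>{0..b}. (y has_vector_derivative F x (y x)) (at x within {0..b}))"
    using K by (intro ode_exists_compact[OF b, of "K + 1"]) auto
  then obtain y where y: "y 0 = (s, s1)"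
      "\<And>x. x \<in> {0..b} \<Longrightarrow> (y has_vector_derivative F x (y x)) (at x within {0..b})"
    by auto
  show ?thesis
  proof (intro exI conjI)
    show "twice_deriv {0..b} (\<lambda>x. fst (y x)) (\<lambda>x. snd (y x)) (\<lambda>x. f x (fst (y x)))"
      unfolding twice_deriv_def has_real_derivative_iff_has_vector_derivative
    proof (intro ballI conjI)
      fix x assume "x \<in> {0..b}"
      from y(2)[OF this] show "((\<lambda>x. fst (y x)) has_vector_derivative snd (y x)) (at x within {0..b})"
        "((\<lambda>x. snd (y x)) has_vector_derivative f x (fst (y x))) (at x within {0..b})"
        by (auto simp: F_def has_vector_derivative_def dest: has_derivative_fst has_derivative_snd)
    qed
  qed (use y(1) in auto)
qed

text \<open>The Lipschitz constant may explode as \<open>b\<close> approaches \<open>R\<close>, as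
  it does when the truncation level is a barrier that is infinite at \<open>R\<close>. Solutions on
  compact intervals are therefore glued, uniqueness making them agree.\<close>

lemma second_order_exists:
  fixes f :: "real \<Rightarrow> real \<Rightarrow> real"
  assumes R: "0 < R"
    and cont: "continuous_on ({0..<R} \<times> UNIV) (\<lambda>z. f (fst z) (snd z))"
    and lip: "\<And>b. b \<in> {0..<R} \<Longrightarrow> \<exists>K\<ge>0. \<forall>x\<in>{0..b}. \<forall>y z. \<bar>f x y - f x z\<bar> \<le> K * \<bar>y - z\<bar>"
  shows "\<exists>u u1. u 0 = s \<and> u1 0 = s1 \<and> twice_deriv {0..<R} u u1 (\<lambda>x. f x (u x))"
proof -
  have "\<exists>u u1. u 0 = s \<and> u1 0 = s1 \<and> twice_deriv {0..b} u u1 (\<lambda>x. f x (u x))" if b: "b \<in> {0..<R}" for b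
  proof -
    from lip[OF b] obtain K where "K \<ge> 0" "\<forall>x\<in>{0..b}. \<forall>y z. \<bar>f x y - f x z\<bar> \<le> K * \<bar>y - z\<bar>" by auto
    moreover have "continuous_on ({0..b} \<times> UNIV) (\<lambda>z. f (fst z) (snd z))"
      by (rule continuous_on_subset[OF cont]) (use b in auto)
    ultimately show ?thesis using b
      by (intro second_order_exists_compact[of b K f s s1]) auto
  qed
  then obtain U U1 where U: "\<And>b. b \<in> {0..<R} \<Longrightarrow> U b 0 = s \<and> U1 b 0 = s1 \<and> twice_deriv {0..b} (U b) (U1 b) (\<lambda>x. f x (U b x))"
    by metis
  have eq: "U b x = U c x \<and> U1 b x = U1 c x" if "0 \<le> x" "x \<le> b" "b \<le> c" "c < R" for x b c
  proof -
    from lip[of b] that obtain K where K: "\<forall>x\<in>{0..b}. \<forall>y z. \<bar>f x y - f x z\<bar> \<le> K * \<bar>y - z\<bar>" by auto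
    have tw: "twice_deriv {0..b} (\<lambda>x. U b x - U c x) (\<lambda>x. U1 b x - U1 c x) (\<lambda>x. f x (U b x) - f x (U c x))"
      using U[of b] U[of c] that by (intro twice_deriv_diff) (auto intro: twice_deriv_subset)
    show ?thesis
      using second_order_unique[OF tw, of K x] K U[of b] U[of c] that by auto
  qed
  \<comment> \<open>Any point strictly between \<open>x\<close> and \<open>R\<close> would do; it
    leaves room to the right of \<open>x\<close>, so derivatives within \<open>{0..m x}\<close> and
    within \<open>{0..<R}\<close> coincide at \<open>x\<close>.\<close>
  define m where "m = (\<lambda>x. (x + R) / 2)"
  define u u1 where "u = (\<lambda>x. U (m x) x)" and "u1 = (\<lambda>x. U1 (m x) x)"
  have *: "u y = U b y" "u1 y = U1 b y" if "y \<in> {0..b}" "b < R" for y b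
  proof -
    have "m y < R" "y < m y" using that by (auto simp: m_def field_simps)
    then have "U (m y) y = U b y \<and> U1 (m y) y = U1 b y"
    proof (cases "b \<le> m y")
      case True
      then show ?thesis using eq[of y b "m y"] that \<open>m y < R\<close> by simp
    next
      case False
      then show ?thesis using eq[of y "m y" b] that \<open>y < m y\<close> by simp
    qed
    then show "u y = U b y" "u1 y = U1 b y" by (simp_all add: u_def u1_def)
  qed
  have "twice_deriv {0..<R} u u1 (\<lambda>x. f x (u x))"
    unfolding twice_deriv_def
  proof (intro ballI)
    fix x assume x: "x \<in> {0..<R}"
    have b: "x < m x" "m x < R" "0 \<le> m x" using x by (auto simp: m_def field_simps)
    have nh: "at x within {0..<R} = at x within {0..m x}"
    proof (rule at_within_nhd[of x "{..<m x}"])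
      show "{0..<R} \<inter> {..<m x} - {x} = {0..m x} \<inter> {..<m x} - {x}" using b by auto
    qed (use b in auto)
    have tw: "twice_deriv {0..m x} (U (m x)) (U1 (m x)) (\<lambda>y. f y (U (m x) y))" using U b by auto
    have x': "x \<in> {0..m x}" using x b by auto
    have "(u has_real_derivative U1 (m x) x) (at x within {0..m x})"
      by (rule has_field_derivative_transform_within[of "U (m x)" _ _ _ 1])
        (use tw x' *[OF _ b(2)] in \<open>auto simp: twice_deriv_def\<close>)
    moreover have "(u1 has_real_derivative f x (U (m x) x)) (at x within {0..m x})"
      by (rule has_field_derivative_transform_within[of "U1 (m x)" _ _ _ 1])
        (use tw x' *[OF _ b(2)] in \<open>auto simp: twice_deriv_def\<close>)
    ultimately show "(u has_real_derivative u1 x) (at x within {0..<R}) \<and>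
      (u1 has_real_derivative f x (u x)) (at x within {0..<R})"
      unfolding nh using *[OF x' b(2)] by simp
  qed
  moreover have "u 0 = s" "u1 0 = s1" using *[of 0 "m 0"] U[of "m 0"] R by (auto simp: m_def)
  ultimately show ?thesis by blast
qed

subsection \<open>Comparison by Wronskians\<close>

lemma at_within_Ico: "0 < x \<Longrightarrow> x < R \<Longrightarrow> at x within {0..<R} = at x" for x R :: real
  by (rule within_interval_at[of 0 R]) auto

section \<open>Crossing points and one-sided derivatives\<close>

lemma deriv_nonpos_imp_ge:
  fixes f :: "real \<Rightarrow> real"
  assumes "x \<le> y" and "{x..y} \<subseteq> S"
    and f: "\<And>z. z \<in> S \<Longrightarrow> (f has_real_derivative f' z) (at z within S)"
    and "\<And>z. x < z \<Longrightarrow> z < y \<Longrightarrow> f' z \<le> 0"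
  shows "f y \<le> f x"
  using deriv_nonneg_imp_le[OF assms(1,2) DERIV_minus[OF f]] assms(4) by force

lemma last_exit:
  fixes e :: "real \<Rightarrow> real"
  assumes "a \<le> b" and cont: "continuous_on {a..b} e" and "0 < e b"
  shows "\<exists>x\<in>{a..b}. (x = a \<or> e x = 0) \<and> (\<forall>y\<in>{x..b}. 0 \<le> e y)"
proof (cases "\<forall>y\<in>{a..b}. 0 \<le> e y")
  case True
  then show ?thesis using assms(1) by (intro bexI[of _ a]) auto
next
  case False
  define Z where "Z = {a..b} \<inter> e -` {..0}"
  have "closed Z" unfolding Z_def by (intro continuous_closed_preimage cont) auto
  then have "compact Z"
    by (metis Z_def bounded_Int bounded_closed_interval compact_eq_bounded_closed)
  moreover have "Z \<noteq> {}" using False by (force simp: Z_def)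
  ultimately obtain x where x: "x \<in> Z" "\<And>y. y \<in> Z \<Longrightarrow> y \<le> x" by (meson compact_attains_sup)
  then have xab: "a \<le> x" "x \<le> b" "e x \<le> 0" by (auto simp: Z_def)
  have "continuous_on {x..b} e" using cont xab by (rule_tac continuous_on_subset) auto
  then obtain z where z: "z \<ge> x" "z \<le> b" "e z = 0"
    using IVT'[of e x 0 b] xab assms(3) by auto
  then have "z = x" using x(2)[of z] xab by (auto simp: Z_def)
  have "0 \<le> e y" if "y \<in> {x..b}" for y
    using x(2)[of y] that xab z \<open>z = x\<close> by (cases "y = x") (force simp: Z_def)+
  then show ?thesis using xab z \<open>z = x\<close> by auto
qed

lemma first_hit:
  fixes e :: "real \<Rightarrow> real"
  assumes "a \<le> b" and cont: "continuous_on {a..b} e" and "0 < e a"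
  shows "\<exists>x\<in>{a..b}. (x = b \<or> e x = 0) \<and> (\<forall>y\<in>{a..x}. 0 \<le> e y)"
proof -
  have "continuous_on {-b..-a} (\<lambda>x. e (- x))"
    by (rule continuous_on_compose2[OF cont]) (auto intro!: continuous_intros)
  then have "\<exists>x\<in>{-b..-a}. (x = -b \<or> e (- x) = 0) \<and> (\<forall>y\<in>{x..-a}. 0 \<le> e (- y))"
    using assms by (intro last_exit) auto
  then obtain x where x: "x \<in> {-b..-a}" "x = -b \<or> e (- x) = 0"
    "\<And>y. y \<in> {x..-a} \<Longrightarrow> 0 \<le> e (- y)" by blast
  have "0 \<le> e y" if "y \<in> {a..-x}" for y using x(3)[of "-y"] that by auto
  then show ?thesis using x(1,2) by (intro bexI[of _ "-x"]) auto
qed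

lemma deriv_nonneg_if_min_right:
  fixes e :: "real \<Rightarrow> real"
  assumes "(e has_real_derivative d) (at x within S)" "x < y" "{x..<y} \<subseteq> S"
    and "\<And>z. x < z \<Longrightarrow> z < y \<Longrightarrow> e x \<le> e z"
  shows "0 \<le> d"
proof (rule ccontr)
  assume "\<not> 0 \<le> d"
  with has_real_derivative_neg_dec_right[OF assms(1)] obtain r where
    r: "r > 0" "\<And>h. h > 0 \<Longrightarrow> x + h \<in> S \<Longrightarrow> h < r \<Longrightarrow> e (x + h) < e x" by force
  define h where "h = min r (y - x) / 2"
  have "h > 0" "h < r" "h < y - x" using r(1) assms(2) by (auto simp: h_def)
  moreover from this have "x + h \<in> S" using assms(3) by auto
  ultimately show False using r(2)[of h] assms(4)[of "x + h"] by auto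
qed

lemma deriv_nonpos_if_min_left:
  fixes e :: "real \<Rightarrow> real"
  assumes "(e has_real_derivative d) (at x within S)" "y < x" "{y<..x} \<subseteq> S"
    and "\<And>z. y < z \<Longrightarrow> z < x \<Longrightarrow> e x \<le> e z"
  shows "d \<le> 0"
proof (rule ccontr)
  assume "\<not> d \<le> 0"
  with has_real_derivative_pos_inc_left[OF assms(1)] obtain r where
    r: "r > 0" "\<And>h. h > 0 \<Longrightarrow> x - h \<in> S \<Longrightarrow> h < r \<Longrightarrow> e (x - h) < e x" by force
  define h where "h = min r (x - y) / 2"
  have "h > 0" "h < r" "h < x - y" using r(1) assms(2) by (auto simp: h_def)
  moreover from this have "x - h \<in> S" using assms(3) by auto
  ultimately show False using r(2)[of h] assms(4)[of "x - h"] by auto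
qed

lemma quotient_deriv:
  assumes "twice_deriv S u u1 u2" "twice_deriv S v v1 v2" "x \<in> S" "v x \<noteq> 0"
  shows "((\<lambda>x. u x / v x) has_real_derivative (u1 x * v x - u x * v1 x) / (v x)\<^sup>2) (at x within S)"
  using assms unfolding twice_deriv_def power2_eq_square by (intro DERIV_divide) auto

text \<open>Suppose \<open>u / v\<close> exceeds \<open>1\<close> somewhere. The limit at
  \<open>R\<close> forces it to fall later on, so the Wronskian is negative at some point with
  \<open>u > v\<close>. Followed back to where the stretch \<open>u \<ge> v\<close> began, the
  Wronskian can only be smaller; yet there it is nonnegative, by \<open>W0\<close> at
  \<open>0\<close> and by the sign of the slope of \<open>u - v\<close> at a crossing.\<close>

lemma comparison:
  assumes R: "0 < R" and u: "twice_deriv {0..<R} u u1 u2" and v: "twice_deriv {0..<R} v v1 v2"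
    and vpos: "\<And>x. 0 < x \<Longrightarrow> x < R \<Longrightarrow> 0 < v x"
    and ineq: "\<And>x. 0 < x \<Longrightarrow> x < R \<Longrightarrow> v x \<le> u x \<Longrightarrow> u x * v2 x \<le> u2 x * v x"
    and W0: "u 0 * v1 0 \<le> u1 0 * v 0"
    and lim: "((\<lambda>x. u x / v x) \<longlongrightarrow> l) (at_left R)" "l \<le> 1"
    and x: "x \<in> {0..<R}"
  shows "u x \<le> v x"
proof -
  let ?W = "\<lambda>x. u1 x * v x - u x * v1 x"
  have cont: "continuous_on {0..<R} (\<lambda>x. u x - v x)"
    by (intro continuous_intros twice_deriv_continuous[OF u] twice_deriv_continuous[OF v])
  have pos: "u x1 \<le> v x1" if x1: "0 < x1" "x1 < R" for x1
  proof (rule ccontr)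
    assume "\<not> u x1 \<le> v x1"
    define q where "q = (\<lambda>x. u x / v x)"
    have q1: "q x1 > 1" using \<open>\<not> u x1 \<le> v x1\<close> vpos[OF x1] by (simp add: q_def)
    \<comment> \<open>A level strictly between the limit, which is at most \<open>1\<close>, and
      \<open>q x1\<close>: the quotient has to come down to it before \<open>x2\<close>.\<close>
    define t where "t = (1 + q x1) / 2"
    have t: "1 < t" "t < q x1" using q1 by (auto simp: t_def)
    have "\<forall>\<^sub>F x in at_left R. q x < t"
      using order_tendstoD(2)[OF lim(1), of t] lim(2) t by (simp add: q_def)
    then obtain b where b: "b < R" "\<And>x. b < x \<Longrightarrow> x < R \<Longrightarrow> q x < t"
      unfolding eventually_at_left_field by auto
    define x2 where "x2 = (max b x1 + R) / 2"
    have x2: "x1 < x2" "x2 < R" "q x2 < t" using b x1 by (auto simp: x2_def)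
    have dq: "(q has_real_derivative ?W x / (v x)\<^sup>2) (at x within {0..<R})" if "0 < x" "x < R" for x
      unfolding q_def using vpos[OF that] that by (intro quotient_deriv[OF u v]) auto
    then have cq: "continuous_on {0<..<R} q"
      by (intro DERIV_continuous_on[of _ q "\<lambda>x. ?W x / (v x)\<^sup>2"] DERIV_subset[OF dq]) auto
    have "continuous_on {x1..x2} (\<lambda>x. q x - t)"
      by (intro continuous_intros continuous_on_subset[OF cq]) (use x1 x2 in auto)
    from first_hit[OF _ this] x2 t obtain x3 where
      x3: "x3 \<in> {x1..x2}" "x3 = x2 \<or> q x3 = t" "\<And>y. y \<in> {x1..x3} \<Longrightarrow> t \<le> q y"
      by auto
    have "q x3 = t" using x3(2) x3(3)[of x3] x3(1) x2 by auto
    then have "x1 < x3" using x3(1) t by (cases "x1 = x3") auto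
    \<comment> \<open>By the mean value theorem the drop from \<open>q x1\<close> to
      \<open>t\<close> requires a negative Wronskian at some \<open>y\<close>, and
      \<open>t > 1\<close> ensures \<open>u > v\<close> there.\<close>
    then obtain y where y: "x1 < y" "y < x3" "q x3 - q x1 = (x3 - x1) * (?W y / (v y)\<^sup>2)"
    proof (rule MVT2[THEN exE])
      show "DERIV q z :> ?W z / (v z)\<^sup>2" if "x1 \<le> z" "z \<le> x3" for z
        using dq[of z] at_within_Ico[of z R] that x1 x2 x3 by auto
    qed (use that in auto)
    have y0: "0 < y" "y < R" using y x1 x2 x3 by auto
    have "(x3 - x1) * (?W y / (v y)\<^sup>2) < 0" using y(3) \<open>q x3 = t\<close> t by simp
    then have Wy: "?W y < 0" using \<open>x1 < x3\<close> vpos[OF y0]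
      by (simp add: mult_less_0_iff divide_less_0_iff)
    have "t \<le> q y" using x3(3)[of y] y by auto
    then have "v y < u y" using t vpos[OF y0] by (simp add: q_def pos_le_divide_eq)
       (smt (verit) mult_less_cancel_right1)
    moreover have "continuous_on {0..y} (\<lambda>x. u x - v x)"
      by (rule continuous_on_subset[OF cont]) (use y0 in auto)
    ultimately have "\<exists>x0\<in>{0..y}. (x0 = 0 \<or> u x0 - v x0 = 0) \<and> (\<forall>z\<in>{x0..y}. 0 \<le> u z - v z)"
      using y0 by (intro last_exit) auto
    then obtain x0 where x0: "x0 \<in> {0..y}" "x0 = 0 \<or> u x0 - v x0 = 0"
      "\<And>z. z \<in> {x0..y} \<Longrightarrow> 0 \<le> u z - v z"
      by blast
    have "?W x0 \<le> ?W y"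
    proof (rule deriv_nonneg_imp_le[where S = "{0..<R}" and f = ?W and f' = "\<lambda>z. u2 z * v z - u z * v2 z"])
      show "((\<lambda>x. u1 x * v x - u x * v1 x) has_real_derivative (u2 z * v z - u z * v2 z)) (at z within {0..<R})"
        if "z \<in> {0..<R}" for z by (rule wronskian_deriv[OF u v that])
      show "0 \<le> u2 z * v z - u z * v2 z" if "x0 < z" "z < y" for z
        using ineq[of z] x0(3)[of z] that x0(1) y0 by auto
    qed (use x0 y0 in auto)
    then have Wx0: "?W x0 < 0" using Wy by simp
    show False
    proof (cases "x0 = 0")
      case True
      then show False using Wx0 W0 by simp
    next
      case False
      then have eq: "u x0 = v x0" and x0': "0 < x0" "x0 < R" using x0 y0 by auto
      have "x0 \<noteq> y" using Wx0 \<open>v y < u y\<close> eq by auto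
      then have "x0 < y" using x0 by auto
      have "((\<lambda>x. u x - v x) has_real_derivative u1 x0 - v1 x0) (at x0 within {0..<R})"
        using u v x0' by (auto simp: twice_deriv_def intro!: derivative_intros)
      then have "0 \<le> u1 x0 - v1 x0"
        by (rule deriv_nonneg_if_min_right[where y = y]) (use x0 eq \<open>x0 < y\<close> y0 in force)+
      then have "0 \<le> v x0 * (u1 x0 - v1 x0)" using vpos[OF x0'] by simp
      then show False using Wx0 eq by (simp add: algebra_simps)
    qed
  qed
  \<comment> \<open>Under the Dirichlet condition the quotient is undefined at \<open>0\<close>, so
    this endpoint is reached by continuity.\<close>
  have "u 0 - v 0 \<le> 0"
  proof (rule continuous_le_on_closure[where S = "{0<..<R/2}" and f = "\<lambda>x. u x - v x"])
    have cl: "closure {0<..<R/2} = {0..R/2}" using R by (intro closure_greaterThanLessThan) auto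
    then show "0 \<in> closure {0<..<R/2}" using R by simp
    show "continuous_on (closure {0<..<R/2}) (\<lambda>x. u x - v x)"
      unfolding cl by (rule continuous_on_subset[OF cont]) (use R in auto)
  qed (use pos in auto)
  then show ?thesis using pos x by (cases "x = 0") auto
qed

lemma wronskian_nonneg:
  assumes u: "twice_deriv {0..<R} u u1 u2" and v: "twice_deriv {0..<R} v v1 v2"
    and "0 \<le> x" "x \<le> y" "y < R" and "u x * v1 x \<le> u1 x * v x"
    and "\<And>z. x < z \<Longrightarrow> z < y \<Longrightarrow> u z * v2 z \<le> u2 z * v z"
  shows "u y * v1 y \<le> u1 y * v y"
proof -
  have "u1 x * v x - u x * v1 x \<le> u1 y * v y - u y * v1 y"
    by (rule deriv_nonneg_imp_le[where S = "{0..<R}" and f = "\<lambda>z. u1 z * v z - u z * v1 z"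
          and f' = "\<lambda>z. u2 z * v z - u z * v2 z", OF \<open>x \<le> y\<close> _ wronskian_deriv[OF u v]])
      (use assms in auto)
  then show ?thesis using assms(6) by simp
qed

lemma quotient_mono:
  assumes u: "twice_deriv {0..<R} u u1 u2" and v: "twice_deriv {0..<R} v v1 v2"
    and "0 < x" "x \<le> y" "y < R" and pos: "\<And>z. 0 < z \<Longrightarrow> z < R \<Longrightarrow> 0 < v z"
    and W: "\<And>z. x < z \<Longrightarrow> z < y \<Longrightarrow> u z * v1 z \<le> u1 z * v z"
  shows "u x / v x \<le> u y / v y"
proof (rule deriv_nonneg_imp_le[where S = "{0<..<R}" and f = "\<lambda>z. u z / v z"
      and f' = "\<lambda>z. (u1 z * v z - u z * v1 z) / (v z)\<^sup>2"])
  show "((\<lambda>z. u z / v z) has_real_derivative (u1 z * v z - u z * v1 z) / (v z)\<^sup>2) (at z within {0<..<R})"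
    if "z \<in> {0<..<R}" for z
    by (rule DERIV_subset[OF quotient_deriv[OF u v]]) (use that pos[of z] in auto)
qed (use assms in auto)

subsection \<open>Two inequalities for real powers\<close>

lemma bernoulli_powr:
  fixes p d :: real
  assumes "1 \<le> p" "-1 < d"
  shows "1 + p * d \<le> (1 + d) powr p"
proof -
  have "(1 + d) powr p - 1 powr p \<ge> p * (1 + d - 1)"
  proof (rule convex_on_imp_above_tangent[OF powr_convex[OF assms(1)]])
    show "((\<lambda>x. x powr p) has_real_derivative p) (at 1 within {0<..})"
      by (auto intro!: derivative_eq_intros)
    show "(1::real) \<in> interior {0<..}" by (simp add: interior_open)
  qed (use assms in auto)
  then show ?thesis by simp
qed

text \<open>No second-order Taylor expansion is involved: convexity gives
  \<open>(1 + d)^p \<le> 1 + p d (1 + d)^(p-1)\<close>, and \<open>(1 + d)^(p-1)\<close> differs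
  from \<open>1\<close> by at most \<open>p \<bar>d\<bar>\<close> for small \<open>d\<close>,
  because its derivative at \<open>1\<close> is \<open>p - 1 < p\<close>. This yields
  \<open>C = p^2\<close>.\<close>

lemma powr_quadratic_upper_bound:
  fixes p :: real
  assumes "1 < p"
  obtains d0 C where "0 < d0" "d0 \<le> 1/2" "0 \<le> C"
    "\<And>d. \<bar>d\<bar> \<le> d0 \<Longrightarrow> (1 + d) powr p \<le> 1 + p * d + C * d\<^sup>2"
proof -
  have "((\<lambda>z. z powr (p - 1)) has_real_derivative (p - 1) * 1 powr (p - 1 - 1)) (at 1)"
    by (rule has_real_derivative_powr) simp
  then have "((\<lambda>h. ((1 + h) powr (p - 1) - 1 powr (p - 1)) / h) \<longlongrightarrow> p - 1) (at 0)"
    by (simp add: DERIV_def)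
  then have "((\<lambda>h. \<bar>((1 + h) powr (p - 1) - 1) / h\<bar>) \<longlongrightarrow> \<bar>p - 1\<bar>) (at 0)"
    by (intro tendsto_rabs) simp
  then have "\<forall>\<^sub>F h in at 0. \<bar>((1 + h) powr (p - 1) - 1) / h\<bar> < p"
    by (rule order_tendstoD) (use assms in simp)
  then obtain e where e: "0 < e" "\<And>h. h \<noteq> 0 \<Longrightarrow> \<bar>h\<bar> < e \<Longrightarrow> \<bar>((1 + h) powr (p - 1) - 1) / h\<bar> < p"
    by (auto simp: eventually_at dist_real_def)
  define d0 where "d0 = min (e / 2) (1/2)"
  have d0: "0 < d0" "d0 \<le> 1/2" "d0 < e" using e(1) by (auto simp: d0_def)
  have "(1 + d) powr p \<le> 1 + p * d + p\<^sup>2 * d\<^sup>2" if d: "\<bar>d\<bar> \<le> d0" for d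
  proof (cases "d = 0")
    case False
    have pos: "0 < 1 + d" using d d0 by auto
    have "\<bar>(1 + d) powr (p - 1) - 1\<bar> \<le> p * \<bar>d\<bar>"
      using e(2)[OF False] d d0 False by (simp add: abs_divide divide_less_eq less_imp_le)
    then have "\<bar>p * d\<bar> * \<bar>(1 + d) powr (p - 1) - 1\<bar> \<le> \<bar>p * d\<bar> * (p * \<bar>d\<bar>)"
      by (intro mult_left_mono) auto
    also have "\<bar>p * d\<bar> * (p * \<bar>d\<bar>) = (p * \<bar>d\<bar>)\<^sup>2" using assms by (simp add: abs_mult power2_eq_square)
    also have "\<dots> = p\<^sup>2 * d\<^sup>2" by (simp add: power_mult_distrib)
    finally have "p * d * ((1 + d) powr (p - 1) - 1) \<le> p\<^sup>2 * d\<^sup>2"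
      using abs_ge_self[of "p * d * ((1 + d) powr (p - 1) - 1)"] by (simp only: abs_mult)
    moreover have "(1 + d) powr p \<le> 1 + p * d * (1 + d) powr (p - 1)"
    proof -
      \<comment> \<open>Bernoulli's inequality at \<open>1 / (1 + d)\<close>, multiplied by
        \<open>(1 + d) powr p\<close>, is the tangent inequality at \<open>1 + d\<close> evaluated
        at \<open>1\<close>.\<close>
      define i where "i = 1 / (1 + d) - 1"
      have i: "i * (1 + d) = - d" "-1 < i" "1 + i = 1 / (1 + d)" using pos by (simp_all add: i_def field_simps)
      have "1 + p * i \<le> (1 + i) powr p" using assms i by (intro bernoulli_powr) auto
      then have "(1 + p * i) * (1 + d) powr p \<le> (1 / (1 + d)) powr p * (1 + d) powr p"
        unfolding i(3) by (intro mult_right_mono) auto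
      then have "(1 + p * i) * (1 + d) powr p \<le> 1" using pos by (simp add: powr_divide)
      moreover have "(1 + d) powr p = (1 + d) powr (p - 1) * (1 + d)"
        using pos powr_add[of "1 + d" "p - 1" 1] by simp
      then have "(1 + p * i) * (1 + d) powr p = (1 + d) powr p - p * d * (1 + d) powr (p - 1)"
        using i(1) by algebra
      ultimately show ?thesis by simp
    qed
    ultimately show ?thesis by (simp add: algebra_simps)
  qed simp
  then show ?thesis using that[of d0 "p\<^sup>2"] d0 by auto
qed

subsection \<open>The blow-up rate\<close>

locale large_problem =
  fixes R p a :: real
  assumes R: "0 < R" and p: "1 < p" and a: "0 < a"
begin

text \<open>The value of \<open>u''\<close> prescribed by the equation at
  \<open>u = z \<ge> 0\<close>. The factored form displays the increasing quotient
  \<open>rhs l z / z\<close> on which comparison rests.\<close>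

definition rhs :: "real \<Rightarrow> real \<Rightarrow> real" where
  "rhs l z = (a * z powr (p - 1) - l) * z"

text \<open>The boundary condition at \<open>0\<close> is kept apart because the asymptotics at
  \<open>R\<close> are independent of it.\<close>

definition large :: "real \<Rightarrow> (real \<Rightarrow> real) \<Rightarrow> (real \<Rightarrow> real) \<Rightarrow> bool" where
  "large l u u1 \<longleftrightarrow> twice_deriv {0..<R} u u1 (\<lambda>x. rhs l (u x)) \<and> (\<forall>x\<in>{0<..<R}. 0 < u x)
     \<and> filterlim u at_top (at_left R)"

lemma largeD:
  assumes "large l u u1"
  shows "twice_deriv {0..<R} u u1 (\<lambda>x. rhs l (u x))" "\<And>x. 0 < x \<Longrightarrow> x < R \<Longrightarrow> 0 < u x"
    "filterlim u at_top (at_left R)"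
  using assms by (auto simp: large_def)

lemma eventually_inside: "\<forall>\<^sub>F x in at_left R. 0 < x \<and> x < R"
  using R by (intro eventually_conj eventually_at_leftI[of 0]) auto

lemma large_deriv:
  assumes "large l u u1" "0 < x" "x < R"
  shows "(u has_real_derivative u1 x) (at x)" "(u1 has_real_derivative rhs l (u x)) (at x)"
proof -
  have "(u has_real_derivative u1 x) (at x within {0..<R}) \<and>
    (u1 has_real_derivative rhs l (u x)) (at x within {0..<R})"
    using largeD(1)[OF assms(1)] assms(2,3) by (simp add: twice_deriv_def)
  then show "(u has_real_derivative u1 x) (at x)" "(u1 has_real_derivative rhs l (u x)) (at x)"
    by (simp_all only: at_within_Ico[OF assms(2,3)])
qed

lemma superlinear: "\<exists>N>0. \<forall>z\<ge>N. c \<le> a * z powr (p - 1)"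
proof (intro exI conjI allI impI)
  define N where "N = max 1 ((\<bar>c\<bar> / a) powr (1 / (p - 1)))"
  show "0 < N" by (simp add: N_def)
  fix z assume z: "N \<le> z"
  have "\<bar>c\<bar> / a = ((\<bar>c\<bar> / a) powr (1 / (p - 1))) powr (p - 1)"
    using a p by (simp add: powr_powr)
  also have "\<dots> \<le> z powr (p - 1)" using z p by (intro powr_mono2) (auto simp: N_def)
  finally have "\<bar>c\<bar> \<le> a * z powr (p - 1)" using a by (simp add: field_simps)
  then show "c \<le> a * z powr (p - 1)" by linarith
qed

text \<open>Near \<open>R\<close> the values of \<open>u\<close> are so large that \<open>u\<close>
  is convex; were its slope never positive there, \<open>u\<close> would be bounded. The sign is
  what selects the positive root in the energy identity.\<close>

lemma large_eventually_deriv_pos: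
  assumes L: "large l u u1"
  shows "\<forall>\<^sub>F x in at_left R. 0 < u1 x"
proof -
  obtain N where N: "\<And>z. N \<le> z \<Longrightarrow> l \<le> a * z powr (p - 1)" using superlinear by blast
  have "\<forall>\<^sub>F x in at_left R. N \<le> u x" using largeD(3)[OF L] by (simp add: filterlim_at_top)
  then have "\<forall>\<^sub>F x in at_left R. a * u x powr (p - 1) \<ge> l" by eventually_elim (rule N)
  with eventually_inside have "\<forall>\<^sub>F x in at_left R. 0 < x \<and> x < R \<and> a * u x powr (p - 1) \<ge> l"
    by eventually_elim auto
  then obtain b where b: "b < R" "\<And>x. b < x \<Longrightarrow> x < R \<Longrightarrow> 0 < x \<and> a * u x powr (p - 1) \<ge> l"
    unfolding eventually_at_left_field by auto
  have mono: "u1 x \<le> u1 y" if "b < x" "x \<le> y" "y < R" for x y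
  proof (rule deriv_nonneg_imp_le[where S = "{0..<R}" and f = u1 and f' = "\<lambda>x. rhs l (u x)"])
    show "(u1 has_real_derivative rhs l (u z)) (at z within {0..<R})" if "z \<in> {0..<R}" for z
      using largeD(1)[OF L] that by (auto simp: twice_deriv_def)
    show "0 \<le> rhs l (u z)" if "x < z" "z < y" for z
      using b(2)[of z] largeD(2)[OF L, of z] that \<open>b < x\<close> \<open>y < R\<close> by (auto simp: rhs_def)
  qed (use b(2)[of x] that in auto)
  have "\<exists>x0. b < x0 \<and> x0 < R \<and> 0 < u1 x0"
  proof (rule ccontr)
    assume none: "\<not> ?thesis"
    define m where "m = (b + R) / 2"
    have m: "b < m" "m < R" using b by (auto simp: m_def)
    have "- u m \<le> - u x" if "m < x" "x < R" for x
    proof (rule deriv_nonneg_imp_le[where S = "{0..<R}" and f = "\<lambda>x. - u x" and f' = "\<lambda>x. - u1 x"])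
      show "((\<lambda>x. - u x) has_real_derivative - u1 z) (at z within {0..<R})" if "z \<in> {0..<R}" for z
        using largeD(1)[OF L] that by (auto simp: twice_deriv_def intro: derivative_intros)
      show "0 \<le> - u1 z" if "m < z" "z < x" for z 
      proof -
        have "b < z" "z < R" using m that \<open>x < R\<close> by auto
        then show ?thesis using none by force
      qed
    qed (use b(2)[of m] m that in auto)
    then have "\<forall>\<^sub>F x in at_left R. u x \<le> u m"
      using m by (auto simp: eventually_at_left_field)
    moreover have "\<forall>\<^sub>F x in at_left R. u x > u m"
      using largeD(3)[OF L] by (simp add: filterlim_at_top_dense)
    ultimately have "\<forall>\<^sub>F x in at_left R. False" by eventually_elim auto
    then show False by simp
  qed
  then obtain x0 where x0: "b < x0" "x0 < R" "0 < u1 x0" by auto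
  then have "0 < u1 x" if "x0 < x" "x < R" for x using mono[of x0 x] that by auto
  then show ?thesis using x0 by (auto simp: eventually_at_left_field)
qed

lemma large_energy:
  assumes L: "large l u u1"
  obtains E where "\<And>x. 0 < x \<Longrightarrow> x < R \<Longrightarrow>
    (u1 x)\<^sup>2 = 2 * a / (p + 1) * u x powr (p + 1) - l * (u x)\<^sup>2 + E"
proof -
  let ?F = "\<lambda>x. u1 x * u1 x - 2 * a / (p + 1) * u x powr (p + 1) + l * (u x * u x)"
  have "DERIV ?F x :> 0" if x: "0 < x" "x < R" for x
  proof -
    note d = large_deriv[OF L x]
    have "DERIV (\<lambda>x. u x powr (p + 1)) x :> (p + 1) * u x powr (p + 1 - 1) * u1 x"
      using DERIV_fun_powr[OF d(1) largeD(2)[OF L x], of "p + 1"] by simp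
    from DERIV_add[OF DERIV_diff[OF DERIV_mult'[OF d(2) d(2)] DERIV_cmult[OF this, of "2 * a / (p + 1)"]]
        DERIV_cmult[OF DERIV_mult'[OF d(1) d(1)], of l]]
    have "DERIV ?F x :> u1 x * rhs l (u x) + rhs l (u x) * u1 x
       - 2 * a / (p + 1) * ((p + 1) * u x powr (p + 1 - 1) * u1 x) + l * (u x * u1 x + u1 x * u x)" .
    moreover have "u x powr (p + 1 - 1) = u x powr (p - 1) * u x"
      using largeD(2)[OF L x] powr_add[of "u x" "p - 1" 1] by simp
    ultimately show ?thesis using p by (simp add: rhs_def field_simps)
  qed
  then have "?F x = ?F (R/2)" if "0 < x" "x < R" for x
    using that R by (intro DERIV_isconst3[of 0 R x "R/2" ?F]) auto
  then show ?thesis by (intro that[of "?F (R/2)"]) (auto simp: algebra_simps power2_eq_square)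
qed

text \<open>By the conserved energy, \<open>u' / u\<^bsup>(p+1)/2\<^esup>\<close> converges at the blow-up point to a constant
  that does not depend on the solution.\<close>

lemma large_blow_up_rate:
  assumes L: "large l u u1"
  shows "((\<lambda>x. u x powr (- ((p - 1) / 2)) / (R - x)) \<longlongrightarrow> (p - 1) / 2 * sqrt (2 * a / (p + 1))) (at_left R)"
proof -
  define c where "c = 2 * a / (p + 1)"
  have c: "c > 0" using a p by (simp add: c_def)
  obtain E where E: "\<And>x. 0 < x \<Longrightarrow> x < R \<Longrightarrow> (u1 x)\<^sup>2 = c * u x powr (p + 1) - l * (u x)\<^sup>2 + E"
    using large_energy[OF L] by (auto simp: c_def)
  note top = largeD(3)[OF L]
  \<comment> \<open>The energy identity divided by \<open>u^(p+1)\<close>; the terms carrying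
    \<open>l\<close> and \<open>E\<close> vanish at \<open>R\<close>.\<close>
  let ?s = "\<lambda>x. c - l * u x powr (1 - p) + E * u x powr (- (p + 1))"
  have "(?s \<longlongrightarrow> c - l * 0 + E * 0) (at_left R)"
    using p by (intro tendsto_intros tendsto_neg_powr[OF _ top]) auto
  then have s: "((\<lambda>x. sqrt (?s x)) \<longlongrightarrow> sqrt c) (at_left R)"
    by (intro tendsto_real_sqrt) simp
  have "\<forall>\<^sub>F x in at_left R. sqrt (?s x) = u1 x * u x powr (- ((p + 1) / 2))"
    using eventually_inside large_eventually_deriv_pos[OF L]
  proof eventually_elim
    case (elim x)
    have u: "u x > 0" using largeD(2)[OF L] elim by auto
    have "(u1 x * u x powr (- ((p + 1) / 2)))\<^sup>2 = (u1 x)\<^sup>2 * (u x powr (- ((p + 1) / 2)))\<^sup>2"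
      by (simp add: power_mult_distrib)
    also have "(u x powr (- ((p + 1) / 2)))\<^sup>2 = u x powr (- (p + 1))"
    proof -
      have "(u x powr (- ((p + 1) / 2)))\<^sup>2 = u x powr (- ((p + 1) / 2) + - ((p + 1) / 2))"
        by (simp only: power2_eq_square powr_add)
      also have "- ((p + 1) / 2) + - ((p + 1) / 2) = - (p + 1)" by simp
      finally show ?thesis .
    qed
    also have "(u1 x)\<^sup>2 * u x powr (- (p + 1)) =
        c * (u x powr (p + 1) * u x powr (- (p + 1))) - l * (u x powr 2 * u x powr (- (p + 1))) + E * u x powr (- (p + 1))"
      using elim u by (simp add: E algebra_simps)
    also have "u x powr 2 * u x powr (- (p + 1)) = u x powr (1 - p)"
      using powr_add[of "u x" 2 "- (p + 1)"] by simp
    also have "u x powr (p + 1) * u x powr (- (p + 1)) = 1"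
      using powr_add[of "u x" "p + 1" "- (p + 1)"] u by simp
    finally show ?case using elim u by (intro real_sqrt_unique) auto
  qed
  then have lim: "((\<lambda>x. u1 x * u x powr (- ((p + 1) / 2))) \<longlongrightarrow> sqrt c) (at_left R)"
    using Lim_transform_eventually[OF s] by simp
  define k where "k = (p - 1) / 2"
  have k: "k > 0" using p by (simp add: k_def)
  have "((\<lambda>x. u x powr (- k) / (R - x)) \<longlongrightarrow> k * sqrt c) (at_left R)"
  \<comment> \<open>Since \<open>- k - 1 = - (p + 1) / 2\<close>, the derivative of
    \<open>u powr (- k)\<close> is \<open>- k\<close> times the expression whose limit has just been
    found.\<close>
  proof (rule lhopital_left[where f' = "\<lambda>x. - k * u x powr (- k - 1) * u1 x" and g' = "\<lambda>x. -1"])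
    show "((\<lambda>x. u x powr (- k)) \<longlongrightarrow> 0) (at_left R)" using k by (intro tendsto_neg_powr top) auto
    have "((\<lambda>x. R - x) \<longlongrightarrow> R - R) (at_left R)" by (intro tendsto_intros)
    then show "((\<lambda>x. R - x) \<longlongrightarrow> 0) (at_left R)" by simp
    show "\<forall>\<^sub>F x in at_left R. R - x \<noteq> 0" using eventually_inside by eventually_elim auto
    show "\<forall>\<^sub>F x in at_left R. (-1::real) \<noteq> 0" by simp
    show "\<forall>\<^sub>F x in at_left R. DERIV (\<lambda>x. u x powr (- k)) x :> - k * u x powr (- k - 1) * u1 x"
      using eventually_inside
    proof eventually_elim
      case (elim x)
      then show ?case using DERIV_fun_powr[OF large_deriv(1)[OF L] largeD(2)[OF L], of x "-k"] by simp
    qed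
    show "\<forall>\<^sub>F x in at_left R. DERIV ((-) R) x :> - 1"
      by (auto intro!: always_eventually derivative_eq_intros)
    have "- k - 1 = - ((p + 1) / 2)" by (simp add: k_def field_simps)
    then show "((\<lambda>x. - k * u x powr (- k - 1) * u1 x / - 1) \<longlongrightarrow> k * sqrt c) (at_left R)"
      using tendsto_mult[OF tendsto_const[of k] lim] by (simp add: ac_simps)
  qed
  then show ?thesis by (simp add: k_def c_def)
qed

text \<open>The rate constant involves only \<open>p\<close> and \<open>a\<close>, so it cancels
  even when \<open>l\<close> and \<open>m\<close> differ; raising to the power
  \<open>- 1 / k\<close> turns the quotient of rates into the quotient of solutions.\<close>

lemma large_ratio:
  assumes "large l u u1" "large m v v1"
  shows "((\<lambda>x. u x / v x) \<longlongrightarrow> 1) (at_left R)"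
proof -
  define k where "k = (p - 1) / 2"
  define c where "c = (p - 1) / 2 * sqrt (2 * a / (p + 1))"
  have k: "k > 0" and c: "c \<noteq> 0" using p a by (auto simp: k_def c_def)
  have "((\<lambda>x. u x powr (- k) / (R - x) / (v x powr (- k) / (R - x))) \<longlongrightarrow> c / c) (at_left R)"
    using large_blow_up_rate assms c unfolding k_def c_def by (intro tendsto_divide) blast+
  then have "((\<lambda>x. (u x powr (- k) / (R - x) / (v x powr (- k) / (R - x))) powr (- (1 / k))) \<longlongrightarrow> 1 powr (- (1 / k))) (at_left R)"
    using c by (intro tendsto_powr) auto
  then have "((\<lambda>x. (u x powr (- k) / (R - x) / (v x powr (- k) / (R - x))) powr (- (1 / k))) \<longlongrightarrow> 1) (at_left R)"
    by simp
  moreover have "\<forall>\<^sub>F x in at_left R. (u x powr (- k) / (R - x) / (v x powr (- k) / (R - x))) powr (- (1 / k)) = u x / v x"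
    using eventually_inside
  proof eventually_elim
    case (elim x)
    then have "u x > 0" "v x > 0" "R - x \<noteq> 0" using largeD(2) assms by auto
    then show ?case using k by (simp add: powr_powr flip: powr_divide)
  qed
  ultimately show ?thesis by (rule Lim_transform_eventually)
qed

subsection \<open>The truncated nonlinearity\<close>

text \<open>Truncation from above makes the nonlinearity globally Lipschitz; truncation from below makes a solution
  affine from the moment it becomes nonpositive.\<close>

definition trunc :: "real \<Rightarrow> real \<Rightarrow> real \<Rightarrow> real" where
  "trunc l T z = (a * min (max z 0) T powr (p - 1) - l) * max z 0"

lemma trunc_eq_rhs: "z \<le> T \<Longrightarrow> 0 \<le> T \<Longrightarrow> trunc l T z = rhs l (max z 0)"
  by (simp add: trunc_def rhs_def min_def)

lemma trunc_nonpos: "z \<le> 0 \<Longrightarrow> trunc l T z = 0"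
  by (simp add: trunc_def)

text \<open>For \<open>p < 2\<close> the derivative of \<open>z powr (p - 1)\<close> is unbounded
  near \<open>0\<close>, so the increment of the power is never estimated alone: it is multiplied by
  \<open>w\<close>, and the product is at most an increment of \<open>z powr p\<close>, to which the
  mean value theorem applies.\<close>

lemma trunc_lipschitz_aux:
  assumes "0 \<le> w" "w \<le> z" "0 < T"
  shows "0 \<le> min z T powr (p - 1) * z - min w T powr (p - 1) * w"
    "min z T powr (p - 1) * z - min w T powr (p - 1) * w \<le> (1 + p) * T powr (p - 1) * (z - w)"
proof -
  let ?m = "min z T"
  have mono: "min w T powr (p - 1) \<le> ?m powr (p - 1)" using assms p by (intro powr_mono2) auto
  have mT: "?m powr (p - 1) \<le> T powr (p - 1)" using assms p by (intro powr_mono2) auto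
  have split: "?m powr (p - 1) * z - min w T powr (p - 1) * w =
      ?m powr (p - 1) * (z - w) + w * (?m powr (p - 1) - min w T powr (p - 1))"
    by (simp add: algebra_simps)
  show "0 \<le> ?m powr (p - 1) * z - min w T powr (p - 1) * w"
    unfolding split using assms mono by (intro add_nonneg_nonneg mult_nonneg_nonneg) auto
  have "w * (?m powr (p - 1) - min w T powr (p - 1)) \<le> p * T powr (p - 1) * (z - w)"
  proof (cases "w = 0 \<or> T \<le> w \<or> w = z")
    case True
    then have "w = 0 \<or> min z T = min w T"
      using assms by (cases "T \<le> w") (auto simp: min_absorb2)
    then show ?thesis using assms p by auto
  next
    case False
    then have w: "0 < w" "w < ?m" "min w T = w" using assms by auto
    have "\<exists>t>w. t < ?m \<and> ?m powr p - w powr p = (?m - w) * (p * t powr (p - 1))"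
      by (rule MVT2[OF w(2)]) (use w p in \<open>auto intro!: derivative_eq_intros\<close>)
    then obtain t where t: "w < t" "t < ?m" "?m powr p - w powr p = (?m - w) * (p * t powr (p - 1))" by blast
    have pw: "z powr p = z powr (p - 1) * z" if "0 < z" for z
      using that powr_add[of z "p - 1" 1] by simp
    have "w * (?m powr (p - 1) - min w T powr (p - 1)) \<le> ?m * ?m powr (p - 1) - w * w powr (p - 1)"
      using w mult_right_mono[of w ?m "?m powr (p - 1)"] by (simp add: algebra_simps)
    also have "\<dots> = ?m powr p - w powr p" using pw[of w] pw[of ?m] w by simp
    also have "\<dots> \<le> (z - w) * (p * T powr (p - 1))"
      unfolding t(3) using t w p assms by (intro mult_mono powr_mono2) auto
    finally show ?thesis by (simp add: ac_simps)
  qed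
  moreover have "?m powr (p - 1) * (z - w) \<le> T powr (p - 1) * (z - w)"
    using mT assms by (intro mult_right_mono) auto
  ultimately show "?m powr (p - 1) * z - min w T powr (p - 1) * w \<le> (1 + p) * T powr (p - 1) * (z - w)"
    unfolding split by (simp add: algebra_simps)
qed

text \<open>The constant is expressed through a bound \<open>M\<close> of the level, so that it is
  uniform when the level varies with \<open>x\<close> over a compact interval.\<close>

lemma trunc_lipschitz:
  assumes "0 < T" "T \<le> M"
  shows "\<bar>trunc l T y - trunc l T z\<bar> \<le> (a * (1 + p) * M powr (p - 1) + \<bar>l\<bar>) * \<bar>y - z\<bar>"
proof -
  let ?g = "\<lambda>z. min z T powr (p - 1) * z"
  have g: "\<bar>?g v - ?g w\<bar> \<le> (1 + p) * M powr (p - 1) * \<bar>v - w\<bar>" if "0 \<le> v" "0 \<le> w" for v w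
  proof -
    have TM: "(1 + p) * T powr (p - 1) * d \<le> (1 + p) * M powr (p - 1) * d" if "0 \<le> d" for d
      using assms p that by (intro mult_right_mono mult_left_mono powr_mono2) auto
    show ?thesis
    proof (cases "w \<le> v")
      case True
      then show ?thesis using trunc_lipschitz_aux[OF that(2) True assms(1)] TM[of "v - w"] by simp
    next
      case False
      then show ?thesis using trunc_lipschitz_aux[OF that(1) _ assms(1), of w] TM[of "w - v"] by simp
    qed
  qed
  let ?y = "max y 0" and ?z = "max z 0"
  have "\<bar>trunc l T y - trunc l T z\<bar> = \<bar>a * (?g ?y - ?g ?z) + - l * (?y - ?z)\<bar>"
    by (simp add: trunc_def algebra_simps)
  also have "\<dots> \<le> a * \<bar>?g ?y - ?g ?z\<bar> + \<bar>l\<bar> * \<bar>?y - ?z\<bar>"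
    using a by (intro order_trans[OF abs_triangle_ineq]) (simp add: abs_mult)
  also have "\<dots> \<le> a * ((1 + p) * M powr (p - 1) * \<bar>?y - ?z\<bar>) + \<bar>l\<bar> * \<bar>?y - ?z\<bar>"
    using a g[of ?y ?z] by (intro add_mono mult_left_mono) auto
  also have "\<dots> = (a * (1 + p) * M powr (p - 1) + \<bar>l\<bar>) * \<bar>?y - ?z\<bar>"
    by (simp add: algebra_simps)
  also have "\<dots> \<le> (a * (1 + p) * M powr (p - 1) + \<bar>l\<bar>) * \<bar>y - z\<bar>"
    using a p by (intro mult_left_mono) auto
  finally show ?thesis .
qed

lemma trunc_lipschitz_compact:
  fixes c b :: real
  assumes "continuous_on {c..b} T" "\<And>x. x \<in> {c..b} \<Longrightarrow> 0 < T x"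
  shows "\<exists>K\<ge>0. \<forall>x\<in>{c..b}. \<forall>y z. \<bar>trunc l (T x) y - trunc l (T x) z\<bar> \<le> K * \<bar>y - z\<bar>"
proof -
  have "bounded (T ` {c..b})" using assms by (intro compact_imp_bounded compact_continuous_image) auto
  then obtain M where M: "\<forall>x\<in>{c..b}. \<bar>T x\<bar> \<le> M" by (auto simp: bounded_iff)
  have "\<forall>x\<in>{c..b}. \<forall>y z. \<bar>trunc l (T x) y - trunc l (T x) z\<bar> \<le> (a * (1 + p) * M powr (p - 1) + \<bar>l\<bar>) * \<bar>y - z\<bar>"
    using assms M by (intro ballI allI trunc_lipschitz) force+
  then show ?thesis using a p by (intro exI[of _ "a * (1 + p) * M powr (p - 1) + \<bar>l\<bar>"]) auto
qed

lemma trunc_continuous: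
  assumes "continuous_on S T" "\<And>x. x \<in> S \<Longrightarrow> 0 < T x"
  shows "continuous_on (S \<times> UNIV) (\<lambda>z. trunc l (T (fst z)) (snd z))"
proof -
  have "continuous_on (S \<times> (UNIV :: real set)) (\<lambda>z. T (fst z))"
    by (rule continuous_on_compose2[OF assms(1)]) (auto intro: continuous_intros)
  then show ?thesis unfolding trunc_def using assms(2) p
    by (intro continuous_intros continuous_on_powr') (auto simp: less_imp_le)
qed

text \<open>Superlinear growth beats every slope \<open>k\<close>. A positive slope yields
  exponential growth of shooting solutions in terms of the initial parameter; slope \<open>0\<close>
  yields convexity up to a quadratic correction.\<close>

lemma rhs_lower_bound: "\<exists>c\<ge>0. \<forall>z. k * z - c \<le> rhs l (max z 0)" if "0 \<le> k"
proof -
  obtain N where N: "N > 0" "\<And>z. N \<le> z \<Longrightarrow> \<bar>l\<bar> + k \<le> a * z powr (p - 1)" using superlinear by blast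
  have "k * z - (\<bar>l\<bar> + k) * N \<le> rhs l (max z 0)" for z
  proof (cases "z \<le> 0")
    case True
    have "k * z \<le> 0" "0 \<le> (\<bar>l\<bar> + k) * N" using True that N(1) by (auto simp: mult_nonneg_nonpos)
    then show ?thesis using True by (simp add: rhs_def)
  next
    case False
    have "- (\<bar>l\<bar> + k) * N \<le> (a * z powr (p - 1) - l - k) * z"
    proof (cases "N \<le> z")
      case True
      have "0 \<le> (a * z powr (p - 1) - l - k) * z" using N(2)[OF True] False by (intro mult_nonneg_nonneg) auto
      moreover have "0 \<le> (\<bar>l\<bar> + k) * N" using that N(1) by auto
      ultimately show ?thesis by (simp add: algebra_simps)
    next
      case z: False
      have "- (\<bar>l\<bar> + k) * N \<le> - (\<bar>l\<bar> + k) * z" using z that by (intro mult_left_mono_neg) auto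
      also have "\<dots> \<le> (a * z powr (p - 1) - l - k) * z"
      proof (rule mult_right_mono)
        have "0 \<le> a * z powr (p - 1)" using a by simp
        then show "- (\<bar>l\<bar> + k) \<le> a * z powr (p - 1) - l - k" by linarith
      qed (use False in simp)
      finally show ?thesis .
    qed
    then show ?thesis using False by (simp add: rhs_def algebra_simps)
  qed
  then show ?thesis using that N(1) by (intro exI[of _ "(\<bar>l\<bar> + k) * N"]) auto
qed

end

subsection \<open>Boundary data and the barrier\<close>

fun boundary_data :: "boundary_operator \<Rightarrow> real \<times> real" where
  "boundary_data Dirichlet = (0, 1)"
| "boundary_data Neumann = (1, 0)"
| "boundary_data (Robin \<beta>) = (1, \<beta>)"

text \<open>Written as a vanishing determinant, the condition makes the Wronskian of any two
  functions satisfying it zero at \<open>0\<close>.\<close>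

lemma boundary_value_eq_0_iff:
  "boundary_value B v d = 0 \<longleftrightarrow> v * snd (boundary_data B) = d * fst (boundary_data B)"
  by (cases B) auto

lemma fst_boundary_data: "fst (boundary_data B) = (if B = Dirichlet then 0 else 1)"
  by (cases B) auto

text \<open>Every boundary condition amounts to \<open>(u(0), u'(0)) = s (y0, y1)\<close> for a scalar \<open>s\<close>, with
  \<open>(y0, y1) = (0, 1)\<close> for Dirichlet and \<open>(1, \<beta>)\<close> for Robin conditions.\<close>

locale boundary_problem = large_problem +
  fixes y0 y1 :: real
  assumes data: "y0 = 0 \<and> y1 = 1 \<or> y0 = 1"
begin

text \<open>The barrier is \<open>A ((R - x) (x + \<epsilon>))\<^bsup>-2/(p-1)\<^esup>\<close>; the pole at \<open>-\<epsilon>\<close> makes its slope at \<open>0\<close> negative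
  enough for any Robin condition.\<close>

lemma barrier_exists:
  shows "\<exists>v v1 v2. twice_deriv {0..<R} v v1 v2 \<and> (\<forall>x\<in>{0..<R}. 0 < v x \<and> v2 x \<le> rhs l (v x))
    \<and> y0 * v1 0 \<le> y1 * v 0 \<and> filterlim v at_top (at_left R)"
proof -
  \<comment> \<open>With this exponent \<open>v2\<close> and \<open>v^p\<close> have the same order
    \<open>q powr (- \<alpha> - 2)\<close>.\<close>
  define \<alpha> where "\<alpha> = 2 / (p - 1)"
  have "p - 1 \<noteq> 0" using p by simp
  then have \<alpha>: "\<alpha> > 0" "\<alpha> * (p - 1) = 2" using p nonzero_mult_div_cancel_right[of "p - 1" 2]
    by (auto simp only: \<alpha>_def times_divide_eq_left zero_less_divide_iff)
  \<comment> \<open>The boundary inequality for \<open>y0 = 1\<close> reads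
    \<open>\<alpha> (\<epsilon> - R) \<le> y1 R \<epsilon>\<close>; this value gives equality in the
    worst case \<open>y1 = - \<bar>y1\<bar>\<close>.\<close>
  define \<epsilon> where "\<epsilon> = \<alpha> * R / (\<alpha> + \<bar>y1\<bar> * R)"
  have den: "\<alpha> + \<bar>y1\<bar> * R > 0" using \<alpha> R by (simp add: add_pos_nonneg)
  have \<epsilon>: "\<epsilon> > 0" using \<alpha> R den by (simp add: \<epsilon>_def)
  have \<epsilon>': "\<epsilon> * (\<alpha> + \<bar>y1\<bar> * R) = \<alpha> * R" using den by (simp add: \<epsilon>_def)
  define q where "q = (\<lambda>x. (R - x) * (x + \<epsilon>))"
  define q' where "q' = (\<lambda>x. R - \<epsilon> - 2 * x)"
  have q: "q x > 0" if "x \<in> {0..<R}" for x using that \<epsilon> by (auto simp: q_def)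
  have qle: "q x \<le> R * (R + \<epsilon>)" if "x \<in> {0..<R}" for x
    unfolding q_def using that \<epsilon> by (intro mult_mono) auto
  have q'le: "(q' x)\<^sup>2 \<le> (R + \<epsilon>)\<^sup>2" if "x \<in> {0..<R}" for x
    unfolding q'_def using that \<epsilon> by (intro power2_le_iff_abs_le[THEN iffD2]) auto
  have dq: "(q has_real_derivative q' x) (at x within S)" for x S
    unfolding q_def q'_def by (auto intro!: derivative_eq_intros)
  have dq': "(q' has_real_derivative -2) (at x within S)" for x S
    unfolding q'_def by (auto intro!: derivative_eq_intros)
  \<comment> \<open>After division by \<open>A * q powr (- \<alpha> - 2)\<close> the supersolution
    inequality only asks \<open>a * A powr (p - 1)\<close> to dominate bounded terms;
    \<open>C\<close> collects their bounds.\<close>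
  define C where "C = \<alpha> * (\<alpha> + 1) * (R + \<epsilon>)\<^sup>2 + 2 * \<alpha> * (R * (R + \<epsilon>)) + \<bar>l\<bar> * (R * (R + \<epsilon>))\<^sup>2"
  obtain A where A: "A > 0" "C \<le> a * A powr (p - 1)" using superlinear[of C] by blast
  define v where "v = (\<lambda>x. A * q x powr (- \<alpha>))"
  define v1 where "v1 = (\<lambda>x. A * (- \<alpha> * q x powr (- \<alpha> - 1) * q' x))"
  define v2 where "v2 = (\<lambda>x. A * (- \<alpha> * ((- \<alpha> - 1) * q x powr (- \<alpha> - 1 - 1) * q' x * q' x + q x powr (- \<alpha> - 1) * (- 2))))"
  have dpw: "((\<lambda>x. q x powr r) has_real_derivative r * q x powr (r - 1) * q' x) (at x within S)"
    if "x \<in> {0..<R}" for x r S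
    by (rule DERIV_chain2[OF has_real_derivative_powr[OF q[OF that]] dq])
  have tw: "twice_deriv {0..<R} v v1 v2"
    unfolding twice_deriv_def
  proof (intro ballI conjI)
    fix x assume x: "x \<in> {0..<R}"
    show "(v has_real_derivative v1 x) (at x within {0..<R})"
      unfolding v_def v1_def by (rule DERIV_cmult[OF dpw[OF x]])
    show "(v1 has_real_derivative v2 x) (at x within {0..<R})"
      unfolding v1_def v2_def mult.assoc[of "- \<alpha>"]
      by (rule DERIV_cmult DERIV_cong[OF DERIV_mult'[OF dpw[OF x] dq']])+ (simp add: algebra_simps)
  qed
  have Q: "q x powr (- \<alpha> - 1) = q x powr (- \<alpha> - 2) * q x" "q x powr (- \<alpha>) = q x powr (- \<alpha> - 2) * (q x)\<^sup>2"
    if "x \<in> {0..<R}" for x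
  proof -
    have e: "- \<alpha> - 2 + 1 = - \<alpha> - 1" "- \<alpha> - 2 + 2 = - \<alpha>" by simp_all
    show "q x powr (- \<alpha> - 1) = q x powr (- \<alpha> - 2) * q x" "q x powr (- \<alpha>) = q x powr (- \<alpha> - 2) * (q x)\<^sup>2"
      using powr_add[of "q x" "- \<alpha> - 2" 1] powr_add[of "q x" "- \<alpha> - 2" 2] q[OF that] unfolding e by simp_all
  qed
  have sup: "v2 x \<le> rhs l (v x)" if x: "x \<in> {0..<R}" for x
  proof -
    let ?Q = "q x powr (- \<alpha> - 2)"
    have "(A * q x powr (- \<alpha>)) powr (p - 1) * (q x)\<^sup>2 = A powr (p - 1) * (q x powr (- \<alpha> * (p - 1)) * q x powr 2)"
      using A q[OF x] by (simp add: powr_mult powr_powr)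
    also have "q x powr (- \<alpha> * (p - 1)) * q x powr 2 = q x powr (- \<alpha> * (p - 1) + 2)"
      by (simp only: powr_add)
    also have "- \<alpha> * (p - 1) + 2 = 0" using \<alpha>(2) by simp
    finally have pw: "(v x) powr (p - 1) * (q x)\<^sup>2 = A powr (p - 1)" using q[OF x] by (simp add: v_def)
    have "rhs l (v x) = (a * (v x powr (p - 1) * (q x)\<^sup>2) - l * (q x)\<^sup>2) * (A * ?Q)"
      by (simp add: rhs_def v_def Q(2)[OF x] algebra_simps)
    then have r: "rhs l (v x) = (a * A powr (p - 1) - l * (q x)\<^sup>2) * (A * ?Q)" by (simp only: pw)
    have "v2 x = (\<alpha> * (\<alpha> + 1) * (q' x)\<^sup>2 + 2 * \<alpha> * q x) * (A * ?Q)"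
      by (simp add: v2_def Q(1)[OF x] algebra_simps power2_eq_square)
    also have "\<dots> \<le> (a * A powr (p - 1) - l * (q x)\<^sup>2) * (A * ?Q)"
    proof (rule mult_right_mono)
      have "l * (q x)\<^sup>2 \<le> \<bar>l\<bar> * (R * (R + \<epsilon>))\<^sup>2"
        using q[OF x] qle[OF x] by (intro mult_mono power_mono) auto
      moreover have "\<alpha> * (\<alpha> + 1) * (q' x)\<^sup>2 \<le> \<alpha> * (\<alpha> + 1) * (R + \<epsilon>)\<^sup>2"
        using q'le[OF x] \<alpha> by (intro mult_left_mono) auto
      moreover have "2 * \<alpha> * q x \<le> 2 * \<alpha> * (R * (R + \<epsilon>))"
        using qle[OF x] \<alpha> by (intro mult_left_mono) auto
      ultimately show "\<alpha> * (\<alpha> + 1) * (q' x)\<^sup>2 + 2 * \<alpha> * q x \<le> a * A powr (p - 1) - l * (q x)\<^sup>2"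
        using A(2) by (simp add: C_def)
    qed (use A in auto)
    finally show ?thesis using r by simp
  qed
  have v: "0 < v x" if "x \<in> {0..<R}" for x using q[OF that] A by (simp add: v_def)
  have bc: "y0 * v1 0 \<le> y1 * v 0"
  proof (cases "y0 = 1")
    case True
    have "- (\<alpha> * q' 0) \<le> y1 * q 0"
    proof -
      have "- (\<bar>y1\<bar> * (R * \<epsilon>)) \<le> y1 * (R * \<epsilon>)" using R \<epsilon> by (simp add: abs_if)
      then show ?thesis using \<epsilon>' by (simp add: q_def q'_def algebra_simps)
    qed
    then have "- (\<alpha> * q' 0) * (A * q 0 powr (- \<alpha> - 1)) \<le> y1 * q 0 * (A * q 0 powr (- \<alpha> - 1))"
      using A by (intro mult_right_mono) auto
    moreover have "q 0 powr (- \<alpha>) = q 0 powr (- \<alpha> - 1) * q 0"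
      using powr_add[of "q 0" "- \<alpha> - 1" 1] q[of 0] R by simp
    ultimately show ?thesis using True by (simp add: v_def v1_def algebra_simps)
  next
    case False
    then show ?thesis using data v[of 0] R by auto
  qed
  have "filterlim v at_top (at_left R)"
  proof -
    have "(q \<longlongrightarrow> (R - R) * (R + \<epsilon>)) (at_left R)" unfolding q_def by (intro tendsto_intros)
    then have "((\<lambda>x. q x powr \<alpha>) \<longlongrightarrow> 0) (at_left R)"
      using \<alpha> eventually_inside q by (intro tendsto_zero_powrI[of _ _ _ \<alpha>] eventually_mono[OF eventually_inside]) (auto simp: less_imp_le)
    moreover have "\<forall>\<^sub>F x in at_left R. 0 < q x powr \<alpha>"
      using eventually_inside
    proof eventually_elim
      case (elim x)
      then have "0 < q x" using q[of x] by auto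
      then show ?case by simp
    qed
    ultimately have "LIM x at_left R. inverse (q x powr \<alpha>) :> at_top"
      by (rule filterlim_inverse_at_top)
    from filterlim_tendsto_pos_mult_at_top[OF tendsto_const A(1) this]
    show ?thesis by (simp add: v_def powr_minus)
  qed
  with tw sup v bc show ?thesis by blast
qed

subsection \<open>Existence by shooting\<close>

text \<open>The level \<open>T\<close> is a function because two kinds are needed: the barrier,
  infinite at \<open>R\<close>, and constants, for which solutions continue past \<open>R\<close>.
  The scalar \<open>s\<close> is the shooting parameter.\<close>

definition truncated_solution :: "real \<Rightarrow> (real \<Rightarrow> real) \<Rightarrow> real set \<Rightarrow> real \<Rightarrow> (real \<Rightarrow> real) \<Rightarrow> (real \<Rightarrow> real) \<Rightarrow> bool" where
  "truncated_solution l T S s u u1 \<longleftrightarrow> twice_deriv S u u1 (\<lambda>x. trunc l (T x) (u x)) \<and> u 0 = s * y0 \<and> u1 0 = s * y1"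

lemma truncated_solution_exists:
  assumes "0 < b" "continuous_on {0..<b} T" "\<And>x. x \<in> {0..<b} \<Longrightarrow> 0 < T x"
  shows "\<exists>u u1. truncated_solution l T {0..<b} s u u1"
proof -
  have "\<exists>u u1. u 0 = s * y0 \<and> u1 0 = s * y1 \<and> twice_deriv {0..<b} u u1 (\<lambda>x. trunc l (T x) (u x))"
  proof (rule second_order_exists[OF assms(1)])
    show "continuous_on ({0..<b} \<times> UNIV) (\<lambda>z. trunc l (T (fst z)) (snd z))"
      by (rule trunc_continuous) (use assms in auto)
    fix c assume "c \<in> {0..<b}"
    then show "\<exists>K\<ge>0. \<forall>x\<in>{0..c}. \<forall>y z. \<bar>trunc l (T x) y - trunc l (T x) z\<bar> \<le> K * \<bar>y - z\<bar>"
      by (intro trunc_lipschitz_compact continuous_on_subset[OF assms(2)] assms(3)) auto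
  qed
  then show ?thesis by (auto simp: truncated_solution_def)
qed

text \<open>Two shooting solutions differ initially by \<open>(s - t)\<close> times
  \<open>(y0, y1)\<close>, so the Gronwall estimate is linear in \<open>\<bar>s - t\<bar>\<close>,
  with a constant independent of the solutions.\<close>

lemma truncated_solution_dependence:
  assumes "continuous_on {0..b} T" "\<And>x. x \<in> {0..b} \<Longrightarrow> 0 < T x"
  shows "\<exists>C\<ge>0. \<forall>s t u u1 v v1. truncated_solution l T {0..b} s u u1 \<longrightarrow> truncated_solution l T {0..b} t v v1 \<longrightarrow>
    (\<forall>x\<in>{0..b}. \<bar>u x - v x\<bar> \<le> C * \<bar>s - t\<bar>)"
proof -
  obtain K where K: "K \<ge> 0"
    "\<And>x y z. x \<in> {0..b} \<Longrightarrow> \<bar>trunc l (T x) y - trunc l (T x) z\<bar> \<le> K * \<bar>y - z\<bar>"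
    using trunc_lipschitz_compact[OF assms, of l] by blast
  define C where "C = sqrt ((y0\<^sup>2 + y1\<^sup>2) * exp ((K + 1) * b))"
  have "\<bar>u x - v x\<bar> \<le> C * \<bar>s - t\<bar>"
    if u: "truncated_solution l T {0..b} s u u1" and v: "truncated_solution l T {0..b} t v v1" and x: "x \<in> {0..b}" for s t u u1 v v1 x
  proof -
    have tw: "twice_deriv {0..b} (\<lambda>x. u x - v x) (\<lambda>x. u1 x - v1 x) (\<lambda>x. trunc l (T x) (u x) - trunc l (T x) (v x))"
      using u v by (intro twice_deriv_diff) (auto simp: truncated_solution_def)
    have "(u x - v x)\<^sup>2 \<le> (u x - v x)\<^sup>2 + (u1 x - v1 x)\<^sup>2" by simp
    also have "\<dots> \<le> ((u 0 - v 0)\<^sup>2 + (u1 0 - v1 0)\<^sup>2) * exp ((K + 1) * (x - 0))"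
      by (rule gronwall_second_order[OF tw K(2) x K(1)])
    also have "\<dots> = (s - t)\<^sup>2 * ((y0\<^sup>2 + y1\<^sup>2) * exp ((K + 1) * x))"
      using u v by (simp add: truncated_solution_def algebra_simps power2_eq_square)
    also have "\<dots> \<le> (s - t)\<^sup>2 * ((y0\<^sup>2 + y1\<^sup>2) * exp ((K + 1) * b))"
      using x K(1) by (intro mult_left_mono) auto
    finally have "\<bar>u x - v x\<bar> \<le> sqrt ((s - t)\<^sup>2 * ((y0\<^sup>2 + y1\<^sup>2) * exp ((K + 1) * b)))"
      by (metis real_sqrt_abs real_sqrt_le_mono)
    then show ?thesis by (simp add: C_def real_sqrt_mult ac_simps)
  qed
  then show ?thesis by (intro exI[of _ C]) (auto simp: C_def)
qed

lemma truncated_solution_unique: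
  assumes "continuous_on {0..<b} T" "\<And>x. x \<in> {0..<b} \<Longrightarrow> 0 < T x"
    and "truncated_solution l T {0..<b} s u u1" "truncated_solution l T {0..<b} s v v1" "x \<in> {0..<b}"
  shows "u x = v x"
proof -
  have "continuous_on {0..x} T" using assms by (rule_tac continuous_on_subset) auto
  moreover have "truncated_solution l T {0..x} s u u1" "truncated_solution l T {0..x} s v v1"
    using assms(3-5) by (auto simp: truncated_solution_def intro: twice_deriv_subset)
  ultimately show ?thesis using truncated_solution_dependence[of x T l] assms(2,5) by fastforce
qed

text \<open>With \<open>rhs \<ge> K^2 u - c\<close>, the function \<open>z = u1 + K u - s\<close>
  satisfies \<open>z' - K z \<ge> K s - c \<ge> 0\<close>, and \<open>K = \<bar>y1\<bar> + 1\<close>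
  makes \<open>z 0 \<ge> 0\<close> for every boundary condition. Hence the derivative of
  \<open>u * exp (K x)\<close> is at least \<open>s\<close>. This is what bounds the admissible
  shooting parameters.\<close>

lemma initial_slope_growth:
  "\<exists>K c. \<forall>s u u1 x. c \<le> s \<longrightarrow> 0 \<le> s \<longrightarrow> twice_deriv {0..<R} u u1 (\<lambda>x. rhs l (max (u x) 0)) \<longrightarrow>
     u 0 = s * y0 \<longrightarrow> u1 0 = s * y1 \<longrightarrow> x \<in> {0..<R} \<longrightarrow> s * x \<le> u x * exp (K * x)"
proof -
  define K where "K = \<bar>y1\<bar> + 1"
  have K: "K \<ge> 1" by (simp add: K_def)
  obtain c where c: "c \<ge> 0" "\<And>z. K\<^sup>2 * z - c \<le> rhs l (max z 0)" using rhs_lower_bound[of "K\<^sup>2" l] by auto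
  have "s * x \<le> u x * exp (K * x)" if s: "c \<le> s" "0 \<le> s" and tw: "twice_deriv {0..<R} u u1 (\<lambda>x. rhs l (max (u x) 0))"
    and u0: "u 0 = s * y0" "u1 0 = s * y1" and x: "x \<in> {0..<R}" for s u u1 x
  proof -
    have du: "(u has_real_derivative u1 t) (at t within {0..<R})"
      "(u1 has_real_derivative rhs l (max (u t) 0)) (at t within {0..<R})" if "t \<in> {0..<R}" for t
      using tw that by (auto simp: twice_deriv_def)
    have de: "((\<lambda>t. exp (k * t)) has_real_derivative k * exp (k * t)) (at t within {0..<R})" for k t
      by (auto intro!: derivative_eq_intros)
    have "0 \<le> s * ((y1 + K * y0) - 1)" using data s by (intro mult_nonneg_nonneg) (auto simp: K_def)
    then have z0: "u1 0 + K * u 0 - s \<ge> 0" using u0 by (simp add: algebra_simps)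
    let ?z = "\<lambda>t. u1 t + K * u t - s"
    have z: "0 \<le> ?z y" if y: "y \<in> {0..<R}" for y
    proof -
      have "?z 0 * exp (- K * 0) \<le> ?z y * exp (- K * y)"
      proof (rule deriv_nonneg_imp_le[where S = "{0..<R}" and f = "\<lambda>t. ?z t * exp (- K * t)"
            and f' = "\<lambda>t. (rhs l (max (u t) 0) + K * u1 t - 0) * exp (- K * t) + - K * exp (- K * t) * ?z t"])
        show "((\<lambda>t. ?z t * exp (- K * t)) has_real_derivative
          (rhs l (max (u t) 0) + K * u1 t - 0) * exp (- K * t) + - K * exp (- K * t) * ?z t) (at t within {0..<R})"
          if "t \<in> {0..<R}" for t
          by (intro DERIV_mult[OF DERIV_diff[OF DERIV_add[OF du(2) DERIV_cmult[OF du(1)]] DERIV_const] de] that)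
        fix t
        have "c \<le> K * s" using mult_mono[of 1 K c s] K s c(1) by simp
        then have "0 \<le> rhs l (max (u t) 0) - (K\<^sup>2 * u t - c) + (K * s - c)" using c(2)[of "u t"] by simp
        then have "0 \<le> (rhs l (max (u t) 0) - (K\<^sup>2 * u t - c) + (K * s - c)) * exp (- K * t)"
          by (intro mult_nonneg_nonneg) auto
        also have "\<dots> = (rhs l (max (u t) 0) + K * u1 t - 0) * exp (- K * t) + - K * exp (- K * t) * ?z t"
          by algebra
        finally show "0 \<le> (rhs l (max (u t) 0) + K * u1 t - 0) * exp (- K * t) + - K * exp (- K * t) * ?z t" .
      qed (use y in auto)
      then have "0 \<le> ?z y * exp (- K * y)" using z0 by simp
      then show ?thesis by (simp add: zero_le_mult_iff)
    qed
    have "u 0 * exp (K * 0) - s * 0 \<le> u x * exp (K * x) - s * x"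
    proof (rule deriv_nonneg_imp_le[where S = "{0..<R}" and f = "\<lambda>t. u t * exp (K * t) - s * t"
          and f' = "\<lambda>t. u1 t * exp (K * t) + K * exp (K * t) * u t - s * 1"])
      show "((\<lambda>t. u t * exp (K * t) - s * t) has_real_derivative
        u1 t * exp (K * t) + K * exp (K * t) * u t - s * 1) (at t within {0..<R})" if "t \<in> {0..<R}" for t
        by (intro DERIV_diff[OF DERIV_mult[OF du(1) de] DERIV_cmult[OF DERIV_ident]] that)
      fix t assume t: "0 < t" "t < x"
      have "s * 1 \<le> s * exp (K * t)" using s K t by (intro mult_left_mono) auto
      also have "\<dots> \<le> (u1 t + K * u t) * exp (K * t)" using z[of t] t x by (intro mult_right_mono) auto
      finally show "0 \<le> u1 t * exp (K * t) + K * exp (K * t) * u t - s * 1" by (simp add: algebra_simps)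
    qed (use x in auto)
    moreover have "0 \<le> u 0" using u0 s data by auto
    ultimately show ?thesis by simp
  qed
  then show ?thesis by blast
qed

text \<open>Boundedness of \<open>u\<close> makes \<open>u / v\<close> tend to \<open>0\<close> at
  \<open>R\<close>, which is all that comparison asks for at that end.\<close>

lemma below_barrier:
  assumes v: "twice_deriv {0..<R} v v1 v2" "\<And>x. x \<in> {0..<R} \<Longrightarrow> 0 < v x"
    "\<And>x. x \<in> {0..<R} \<Longrightarrow> v2 x \<le> rhs l (v x)" "y0 * v1 0 \<le> y1 * v 0" "filterlim v at_top (at_left R)"
    and u: "twice_deriv {0..<R} u u1 u2" "\<And>x. x \<in> {0..<R} \<Longrightarrow> u2 x = rhs l (max (u x) 0)"
    "u 0 = s * y0" "u1 0 = s * y1" "0 \<le> s"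
    and bd: "\<And>x. x \<in> {0..<R} \<Longrightarrow> \<bar>u x\<bar> \<le> N" and x: "x \<in> {0..<R}"
  shows "u x \<le> v x"
proof (rule comparison[OF R u(1) v(1)])
  show "0 < v x" if "0 < x" "x < R" for x using v(2) that by auto
  show "u x * v2 x \<le> u2 x * v x" if "0 < x" "x < R" "v x \<le> u x" for x
  proof -
    have vp: "0 < v x" using v(2) that by auto
    have "v x powr (p - 1) \<le> u x powr (p - 1)" using that vp p by (intro powr_mono2) auto
    then have "(a * v x powr (p - 1) - l) * (v x * u x) \<le> (a * u x powr (p - 1) - l) * (v x * u x)"
      using a vp that by (intro mult_right_mono) auto
    then have "u x * rhs l (v x) \<le> rhs l (u x) * v x" by (simp add: rhs_def ac_simps)
    moreover have "u x * v2 x \<le> u x * rhs l (v x)" using v(3)[of x] that vp by (intro mult_left_mono) auto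
    moreover have "u2 x = rhs l (u x)" using u(2)[of x] that vp by simp
    ultimately show ?thesis by simp
  qed
  show "u 0 * v1 0 \<le> u1 0 * v 0"
    using mult_left_mono[OF v(4) u(5)] u(3,4) by (simp add: algebra_simps)
  show "((\<lambda>x. u x / v x) \<longlongrightarrow> 0) (at_left R)"
  proof (rule Lim_null_comparison)
    show "((\<lambda>x. N / v x) \<longlongrightarrow> 0) (at_left R)"
      by (intro tendsto_divide_0[OF tendsto_const] filterlim_at_top_imp_at_infinity v(5))
    show "\<forall>\<^sub>F x in at_left R. norm (u x / v x) \<le> N / v x"
      using eventually_inside
    proof eventually_elim
      case (elim x)
      then show ?case using bd[of x] v(2)[of x] by (auto simp: abs_divide intro: divide_right_mono)
    qed
  qed
qed (use x in auto)

text \<open>From a nonpositive minimum on, the tangent line stays nonpositive, where the truncated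
  equation reads \<open>u'' = 0\<close>; uniqueness identifies \<open>u\<close> with that line. An
  unbounded shooting solution is therefore positive.\<close>

lemma bounded_above_if_nonpos:
  assumes u: "truncated_solution l T {0..<R} s u u1" "0 \<le> s"
    and T: "continuous_on {0..<R} T" "\<And>x. x \<in> {0..<R} \<Longrightarrow> 0 < T x"
    and z: "0 < z" "z < R" "u z \<le> 0"
  shows "\<exists>N. \<forall>x\<in>{0..<R}. u x \<le> N"
proof -
  have tw: "twice_deriv {0..<R} u u1 (\<lambda>x. trunc l (T x) (u x))" using u by (simp add: truncated_solution_def)
  have cont: "continuous_on {0..z} u"
    by (rule continuous_on_subset[OF twice_deriv_continuous(1)[OF tw]]) (use z in auto)
  then obtain m where m: "m \<in> {0..z}" "\<And>x. x \<in> {0..z} \<Longrightarrow> u m \<le> u x"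
    using continuous_attains_inf[of "{0..z}" u] z by auto
  obtain y where y: "0 < y" "y \<le> z" "u y \<le> 0" "\<And>x. x \<in> {0..z} \<Longrightarrow> u y \<le> u x"
  proof (cases "m = 0")
    case True
    have "0 \<le> u 0" using u data by (auto simp: truncated_solution_def)
    then show ?thesis using that[of z] z m True by (metis atLeastAtMost_iff order.trans less_imp_le order_refl)
  next
    case False
    then show ?thesis using that[of m] m z by (metis atLeastAtMost_iff order.trans less_le order_refl)
  qed
  have yR: "y < R" using y z by auto
  have "u1 y \<le> 0"
  proof (rule deriv_nonpos_if_min_left)
    show "(u has_real_derivative u1 y) (at y within {0..<R})" using tw y z by (auto simp: twice_deriv_def)
  qed (use y yR in auto)
  have "u x \<le> 0" if x: "y \<le> x" "x < R" for x
  proof -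
    define w where "w = (\<lambda>x. u y + u1 y * (x - y))"
    have w: "w t \<le> 0" if "y \<le> t" for t
      unfolding w_def using that y(3) \<open>u1 y \<le> 0\<close> by (simp add: add_nonpos_nonpos mult_nonpos_nonneg)
    have tw': "twice_deriv {y..x} (\<lambda>t. u t - w t) (\<lambda>t. u1 t - u1 y) (\<lambda>t. trunc l (T t) (u t) - 0)"
    proof (rule twice_deriv_diff)
      show "twice_deriv {y..x} u u1 (\<lambda>t. trunc l (T t) (u t))"
        by (rule twice_deriv_subset[OF tw]) (use x y in auto)
      show "twice_deriv {y..x} w (\<lambda>t. u1 y) (\<lambda>t. 0)"
        unfolding twice_deriv_def w_def by (auto intro!: derivative_eq_intros)
    qed
    have "continuous_on {y..x} T" by (rule continuous_on_subset[OF T(1)]) (use x y in auto)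
    then have "\<exists>K\<ge>0. \<forall>x\<in>{y..x}. \<forall>v z. \<bar>trunc l (T x) v - trunc l (T x) z\<bar> \<le> K * \<bar>v - z\<bar>"
      by (rule trunc_lipschitz_compact) (use x y T(2) in auto)
    then obtain K where K: "\<forall>x\<in>{y..x}. \<forall>v z. \<bar>trunc l (T x) v - trunc l (T x) z\<bar> \<le> K * \<bar>v - z\<bar>"
      by blast
    have "\<bar>trunc l (T t) (u t) - 0\<bar> \<le> K * \<bar>u t - w t\<bar>" if "t \<in> {y..x}" for t
      using K[rule_format, of t "u t" "w t"] trunc_nonpos[OF w, of t l "T t"] that by auto
    from second_order_unique(1)[OF tw' this, of x] x
    have "u x = w x" by (simp add: w_def)
    then show ?thesis using w x by simp
  qed
  moreover obtain N where N: "\<And>x. x \<in> {0..z} \<Longrightarrow> u x \<le> N"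
    using continuous_attains_sup[of "{0..z}" u] cont z by force
  ultimately have "u x \<le> max N 0" if "x \<in> {0..<R}" for x
    using that y by (cases "x \<le> z") (auto simp: le_max_iff_disj)
  then show ?thesis by blast
qed

text \<open>The scalar \<open>s\<close> is \<open>u 0\<close> when \<open>y0 = 1\<close> and
  \<open>u1 0\<close> under the Dirichlet condition; its positivity keeps quotients of solutions
  under control near \<open>0\<close>.\<close>

definition large_solution :: "real \<Rightarrow> (real \<Rightarrow> real) \<Rightarrow> (real \<Rightarrow> real) \<Rightarrow> real \<Rightarrow> bool" where
  "large_solution l u u1 s \<longleftrightarrow> large l u u1 \<and> 0 < s \<and> u 0 = s * y0 \<and> u1 0 = s * y1"

text \<open>The initial parameter is taken maximal among those whose solution stays below the barrier;
  if that solution were bounded it could be increased further.\<close>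

lemma large_solution_exists: "\<exists>u u1 s. large_solution l u u1 s"
proof -
  obtain v v1 v2 where v: "twice_deriv {0..<R} v v1 v2" "\<And>x. x \<in> {0..<R} \<Longrightarrow> 0 < v x"
    "\<And>x. x \<in> {0..<R} \<Longrightarrow> v2 x \<le> rhs l (v x)" "y0 * v1 0 \<le> y1 * v 0" "filterlim v at_top (at_left R)"
    using barrier_exists[of l] by blast
  note vc = twice_deriv_continuous(1)[OF v(1)]
  have vcb: "continuous_on {0..b} v" if "b < R" for b
    by (rule continuous_on_subset[OF vc]) (use that in auto)
  \<comment> \<open>Truncating at the barrier gives solutions on all of \<open>{0..<R}\<close> for
    every \<open>s\<close>; they solve the original equation as long as they lie between
    \<open>0\<close> and \<open>v\<close>.\<close>
  obtain U U1 where U: "\<And>s. truncated_solution l v {0..<R} s (U s) (U1 s)"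
    using truncated_solution_exists[OF R vc v(2), of l] by metis
  have Ub: "truncated_solution l v {0..b} s (U s) (U1 s)" if "b < R" for b s
    using U[of s] that by (auto simp: truncated_solution_def intro: twice_deriv_subset)
  have U0: "0 \<le> U s 0" if "0 \<le> s" for s using U[of s] that data by (auto simp: truncated_solution_def)
  have Urhs: "twice_deriv {0..<R} (U s) (U1 s) (\<lambda>x. rhs l (max (U s x) 0))"
    if "\<And>x. x \<in> {0..<R} \<Longrightarrow> U s x \<le> v x" for s
  proof (rule twice_deriv_cong2)
    show "twice_deriv {0..<R} (U s) (U1 s) (\<lambda>x. trunc l (v x) (U s x))" using U[of s] by (simp add: truncated_solution_def)
    show "trunc l (v x) (U s x) = rhs l (max (U s x) 0)" if "x \<in> {0..<R}" for x
      using v(2) \<open>\<And>x. x \<in> {0..<R} \<Longrightarrow> U s x \<le> v x\<close> that by (intro trunc_eq_rhs) (auto simp: less_imp_le)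
  qed
  define S where "S = {s. 0 \<le> s \<and> (\<forall>x\<in>{0..<R}. U s x \<le> v x)}"
  have zero: "U 0 x = 0" if "x \<in> {0..<R}" for x
  proof (rule truncated_solution_unique[OF vc v(2) U])
    show "truncated_solution l v {0..<R} 0 (\<lambda>x. 0) (\<lambda>x. 0)" by (auto simp: truncated_solution_def twice_deriv_def trunc_def)
  qed (use that in auto)
  then have S0: "0 \<in> S" using v(2) by (simp add: S_def less_imp_le)
  obtain K c where Kc: "\<And>s u u1 x. c \<le> s \<Longrightarrow> 0 \<le> s \<Longrightarrow> twice_deriv {0..<R} u u1 (\<lambda>x. rhs l (max (u x) 0)) \<Longrightarrow>
     u 0 = s * y0 \<Longrightarrow> u1 0 = s * y1 \<Longrightarrow> x \<in> {0..<R} \<Longrightarrow> s * x \<le> u x * exp (K * x)"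
    using initial_slope_growth[of l] by blast
  \<comment> \<open>A large parameter would push the solution above the barrier already at
    \<open>R/2\<close>.\<close>
  have "s \<le> max c (v (R/2) * exp (K * (R/2)) / (R/2))" if "s \<in> S" for s
  proof (cases "c \<le> s")
    case True
    have "s * (R/2) \<le> U s (R/2) * exp (K * (R/2))"
      by (rule Kc[of s "U s" "U1 s", OF True _ Urhs]) (use U[of s] that R in \<open>auto simp: S_def truncated_solution_def\<close>)
    also have "\<dots> \<le> v (R/2) * exp (K * (R/2))" using that R by (auto simp: S_def)
    finally show ?thesis using R by (simp add: pos_le_divide_eq le_max_iff_disj)
  qed auto
  then have bdd: "bdd_above S" by (rule bdd_aboveI)
  define s where "s = Sup S"
  have s0: "0 \<le> s" using cSup_upper[OF S0 bdd] by (simp add: s_def)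
  \<comment> \<open>The supremum is attained: a violation at one point \<open>x\<close> would
    persist for parameters within \<open>d\<close> below \<open>s\<close>, by continuous dependence
    on \<open>{0..x}\<close>.\<close>
  have Us: "U s x \<le> v x" if x: "x \<in> {0..<R}" for x
  proof (rule ccontr)
    assume n: "\<not> U s x \<le> v x"
    obtain C where C: "C \<ge> 0" "\<And>t. \<bar>U s x - U t x\<bar> \<le> C * \<bar>s - t\<bar>"
      using truncated_solution_dependence[OF vcb v(2), of x l] Ub[of x] x by fastforce
    define d where "d = (U s x - v x) / (C + 1)"
    have d: "d > 0" "d * (C + 1) = U s x - v x" using n C(1) by (auto simp: d_def)
    obtain t where t: "t \<in> S" "s - d < t" using less_cSup_iff[of S "s - d"] bdd S0 d by (auto simp: s_def)
    have "t \<le> s" using cSup_upper[OF t(1) bdd] by (simp add: s_def)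
    have "U s x - U t x \<le> C * d"
      using C(2)[of t] mult_left_mono[OF _ C(1), of "\<bar>s - t\<bar>" d] t \<open>t \<le> s\<close> by auto
    moreover have "U t x \<le> v x" using t x by (auto simp: S_def)
    ultimately show False using d by (simp add: algebra_simps)
  qed
  have unbounded: "\<exists>x\<in>{0..<R}. N < U s x" for N
  proof (rule ccontr)
    assume "\<not> ?thesis"
    then have N: "U s x \<le> N" if "x \<in> {0..<R}" for x using that by (meson not_less)
    \<comment> \<open>Dependence on the parameter is not uniform up to \<open>R\<close> for the
      level \<open>v\<close>. A bounded solution also solves the problem with a constant level,
      which is regular on the compact interval \<open>{0..R}\<close>; the extra \<open>1\<close>
      leaves room to increase \<open>s\<close>.\<close>
    define M where "M = max N 0 + 1"
    have M: "M > 0" "N + 1 \<le> M" by (auto simp: M_def)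
    have "\<exists>u u1. truncated_solution l (\<lambda>x. M) {0..<R + 1} t u u1" for t
      using R M by (intro truncated_solution_exists) auto
    then obtain V V1 where V: "\<And>t. truncated_solution l (\<lambda>x. M) {0..<R + 1} t (V t) (V1 t)" by metis
    have Vb: "truncated_solution l (\<lambda>x. M) T t (V t) (V1 t)" if "T \<subseteq> {0..R}" for T t
    proof -
      have "T \<subseteq> {0..<R + 1}" using that by fastforce
      then show ?thesis using V[of t] by (auto simp: truncated_solution_def intro: twice_deriv_subset)
    qed
    have eq: "V s x = U s x" if "x \<in> {0..<R}" for x
    proof (rule truncated_solution_unique[of R "\<lambda>x. M" l s "V s" "V1 s" "U s" "U1 s"])
      show "truncated_solution l (\<lambda>x. M) {0..<R} s (V s) (V1 s)" by (rule Vb) auto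
      show "truncated_solution l (\<lambda>x. M) {0..<R} s (U s) (U1 s)"
        unfolding truncated_solution_def
      proof (intro conjI twice_deriv_cong2[OF Urhs[OF Us]])
        show "rhs l (max (U s x) 0) = trunc l M (U s x)" if "x \<in> {0..<R}" for x
          using N[OF that] M by (simp add: trunc_eq_rhs)
      qed (use U[of s] in \<open>auto simp: truncated_solution_def\<close>)
    qed (use that M in auto)
    obtain C where C: "C \<ge> 0" "\<And>t x. x \<in> {0..R} \<Longrightarrow> \<bar>V t x - V s x\<bar> \<le> C * \<bar>t - s\<bar>"
      using truncated_solution_dependence[of R "\<lambda>x. M" l] Vb[OF order_refl] M by fastforce
    define t where "t = s + 1 / (C + 1)"
    have t: "s < t" "C * \<bar>t - s\<bar> \<le> 1" using C(1) by (auto simp: t_def field_simps)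
    have VM: "V t x \<le> M" if "x \<in> {0..<R}" for x
      using C(2)[of x t] N[OF that] eq[OF that] that t M by auto
    have tw: "twice_deriv {0..<R} (V t) (V1 t) (\<lambda>x. rhs l (max (V t x) 0))"
    proof (rule twice_deriv_cong2)
      show "twice_deriv {0..<R} (V t) (V1 t) (\<lambda>x. trunc l M (V t x))" 
      proof -
        have "truncated_solution l (\<lambda>x. M) {0..<R} t (V t) (V1 t)" by (rule Vb) auto
        then show ?thesis by (simp add: truncated_solution_def)
      qed
      show "trunc l M (V t x) = rhs l (max (V t x) 0)" if "x \<in> {0..<R}" for x
        using VM[OF that] M by (simp add: trunc_eq_rhs)
    qed
    have "continuous_on {0..R} (V t)"
      using Vb[OF order_refl, of t] by (auto simp: truncated_solution_def intro: twice_deriv_continuous)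
    then have "bounded (V t ` {0..R})" by (intro compact_imp_bounded compact_continuous_image) auto
    then obtain B where B: "\<forall>x\<in>{0..R}. \<bar>V t x\<bar> \<le> B" by (auto simp: bounded_iff)
    \<comment> \<open>Being bounded up to \<open>R\<close>, the solution for the larger parameter
      cannot cross the barrier, which contradicts maximality of \<open>s\<close>.\<close>
    have Vv: "V t x \<le> v x" if "x \<in> {0..<R}" for x
    proof (rule below_barrier[OF v tw refl])
      show "V t 0 = t * y0" "V1 t 0 = t * y1" using V by (auto simp: truncated_solution_def)
    qed (use s0 t B that in auto)
    have "U t x = V t x" if "x \<in> {0..<R}" for x
    proof (rule truncated_solution_unique[OF vc v(2) U])
      show "truncated_solution l v {0..<R} t (V t) (V1 t)"
        unfolding truncated_solution_def
      proof (intro conjI twice_deriv_cong2[OF tw])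
        show "rhs l (max (V t x) 0) = trunc l (v x) (V t x)" if "x \<in> {0..<R}" for x
          using Vv[OF that] v(2)[OF that] by (simp add: trunc_eq_rhs)
      qed (use V[of t] in \<open>auto simp: truncated_solution_def\<close>)
    qed (use that in auto)
    then have "t \<in> S" using Vv s0 t by (auto simp: S_def)
    then show False using cSup_upper[OF _ bdd, of t] t by (simp add: s_def)
  qed
  have pos: "0 < U s x" if x: "0 < x" "x < R" for x
  proof (rule ccontr)
    assume "\<not> 0 < U s x"
    then obtain N where "\<forall>x\<in>{0..<R}. U s x \<le> N"
      using bounded_above_if_nonpos[OF U s0 vc v(2) x] by auto
    then show False using unbounded[of N] by force
  qed
  have nonneg: "0 \<le> U s x" if "x \<in> {0..<R}" for x
    using that pos[of x] U0[OF s0] by (cases "x = 0") auto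
  have tw: "twice_deriv {0..<R} (U s) (U1 s) (\<lambda>x. rhs l (U s x))"
    by (rule twice_deriv_cong2[OF Urhs[OF Us]]) (use nonneg in \<open>auto simp: max_absorb1\<close>)
  have "filterlim (U s) at_top (at_left R)"
  proof -
    obtain k where k: "k \<ge> 0" "\<And>z. - k \<le> rhs l (max z 0)" using rhs_lower_bound[of 0 l] by auto
    \<comment> \<open>Unboundedness alone does not exclude oscillation. The quadratic correction
      makes the function convex, hence eventually monotone, and changes it only by a bounded
      amount.\<close>
    let ?w = "\<lambda>x. U s x + k / 2 * x\<^sup>2" and ?w1 = "\<lambda>x. U1 s x + k * x"
    have dw: "(?w has_real_derivative ?w1 x) (at x within {0..<R})"
      "(?w1 has_real_derivative rhs l (U s x) + k) (at x within {0..<R})" if "x \<in> {0..<R}" for x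
      using tw that unfolding twice_deriv_def by (auto intro!: derivative_eq_intros)
    have w1: "?w1 x \<le> ?w1 y" if "0 \<le> x" "x \<le> y" "y < R" for x y
    proof (rule deriv_nonneg_imp_le[where S = "{0..<R}" and f = ?w1 and f' = "\<lambda>x. rhs l (U s x) + k"])
      show "0 \<le> rhs l (U s z) + k" if "x < z" "z < y" for z
        using k(2)[of "U s z"] nonneg[of z] that \<open>0 \<le> x\<close> \<open>y < R\<close> by (simp add: max_absorb1)
    qed (use that dw in auto)
    have kx: "0 \<le> k / 2 * x\<^sup>2" "k / 2 * x\<^sup>2 \<le> k / 2 * R\<^sup>2" if "x \<in> {0..<R}" for x
      using k(1) that by (auto intro!: mult_left_mono power_mono)
    have "\<exists>x0\<in>{0..<R}. 0 \<le> ?w1 x0"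
    proof (rule ccontr)
      assume "\<not> ?thesis"
      then have neg: "?w1 x \<le> 0" if "x \<in> {0..<R}" for x
        using that by (meson less_imp_le not_le)
      have "?w x \<le> ?w 0" if "x \<in> {0..<R}" for x
      proof (rule deriv_nonpos_imp_ge[where S = "{0..<R}" and f = ?w and f' = ?w1])
        show "?w1 z \<le> 0" if "0 < z" "z < x" for z using neg[of z] that \<open>x \<in> {0..<R}\<close> by auto
      qed (use that dw in auto)
      then have "U s x \<le> U s 0" if "x \<in> {0..<R}" for x using that kx[OF that] by fastforce
      then show False using unbounded[of "U s 0"] by force
    qed
    then obtain x0 where x0: "x0 \<in> {0..<R}" "0 \<le> ?w1 x0" by blast
    have mono: "?w x \<le> ?w y" if "x0 \<le> x" "x \<le> y" "y < R" for x y
    proof (rule deriv_nonneg_imp_le[where S = "{0..<R}" and f = ?w and f' = ?w1])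
      show "0 \<le> ?w1 z" if "x < z" "z < y" for z
        using w1[of x0 z] x0 that \<open>x0 \<le> x\<close> \<open>y < R\<close> by auto
    qed (use that x0 dw in auto)
    have "continuous_on {0..x0} (U s)"
      by (rule continuous_on_subset[OF twice_deriv_continuous(1)[OF tw]]) (use x0 in auto)
    then obtain M where M: "\<And>x. x \<in> {0..x0} \<Longrightarrow> U s x \<le> M"
      using continuous_attains_sup[of "{0..x0}" "U s"] x0 by force
    show ?thesis
      unfolding filterlim_at_top
    proof
      fix N
      obtain x where x: "x \<in> {0..<R}" "max M (N + k / 2 * R\<^sup>2) < U s x" using unbounded by blast
      then have "x0 < x" using M[of x] by force
      have "N \<le> U s y" if "x < y" "y < R" for y
        using mono[of x y] \<open>x0 < x\<close> that x kx[of x] kx[of y] by auto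
      then show "\<forall>\<^sub>F x in at_left R. N \<le> U s x" using x by (auto simp: eventually_at_left_field)
    qed
  qed
  moreover have "s \<noteq> 0" using unbounded[of 0] zero by force
  ultimately have "large_solution l (U s) (U1 s) s"
    using tw pos s0 U[of s] by (auto simp: large_solution_def large_def truncated_solution_def)
  then show ?thesis by blast
qed

subsection \<open>Uniqueness and monotonicity\<close>

lemma large_solutionD:
  assumes "large_solution l u u1 s"
  shows "large l u u1" "0 < s" "u 0 = s * y0" "u1 0 = s * y1"
    "twice_deriv {0..<R} u u1 (\<lambda>x. rhs l (u x))" "\<And>x. 0 < x \<Longrightarrow> x < R \<Longrightarrow> 0 < u x"
    "filterlim u at_top (at_left R)" "\<And>x. x \<in> {0..<R} \<Longrightarrow> 0 \<le> u x"
proof -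
  show L: "large l u u1" "0 < s" "u 0 = s * y0" "u1 0 = s * y1" using assms by (auto simp: large_solution_def)
  show pos: "\<And>x. 0 < x \<Longrightarrow> x < R \<Longrightarrow> 0 < u x" and "twice_deriv {0..<R} u u1 (\<lambda>x. rhs l (u x))"
    "filterlim u at_top (at_left R)" using largeD[OF L(1)] by blast+
  show "0 \<le> u x" if "x \<in> {0..<R}" for x
    using that pos[of x] L(2,3) data by (cases "x = 0") auto
qed

lemma rhs_continuous:
  assumes "continuous_on S u" "\<And>x. x \<in> S \<Longrightarrow> 0 \<le> u x"
  shows "continuous_on S (\<lambda>x. rhs l (u x))"
  unfolding rhs_def using assms p by (intro continuous_intros continuous_on_powr') auto

text \<open>Multiplying the monotonicity of \<open>rhs l z / z\<close> by \<open>u * v\<close>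
  converts a supersolution inequality into the sign condition on the Wronskian's derivative.\<close>

lemma supersolution_ineq:
  assumes "0 < v" "v \<le> u" "w \<le> rhs l v"
  shows "u * w \<le> rhs l u * v"
proof -
  have "v powr (p - 1) \<le> u powr (p - 1)" using assms p by (intro powr_mono2) auto
  then have "(a * v powr (p - 1) - l) * (v * u) \<le> (a * u powr (p - 1) - l) * (v * u)"
    using a assms by (intro mult_right_mono) auto
  then have "u * rhs l v \<le> rhs l u * v" by (simp add: rhs_def ac_simps)
  moreover have "u * w \<le> u * rhs l v" using assms by (intro mult_left_mono) auto
  ultimately show ?thesis by simp
qed

lemma subsolution_ineq:
  assumes "0 < v" "v \<le> u" "rhs l u \<le> w"
  shows "u * rhs l v \<le> w * v"
proof -
  have "u * rhs l v \<le> rhs l u * v" using supersolution_ineq[OF assms(1,2) order_refl] .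
  also have "\<dots> \<le> w * v" using assms by (intro mult_right_mono) auto
  finally show ?thesis .
qed

lemma rhs_mono_param: "0 \<le> z \<Longrightarrow> l \<le> m \<Longrightarrow> rhs m z \<le> rhs l z"
  unfolding rhs_def by (intro mult_right_mono) auto

lemma large_solution_mono:
  assumes u: "large_solution l u u1 s" and v: "large_solution m v v1 t" and "l \<le> m" and x: "x \<in> {0..<R}"
  shows "u x \<le> v x"
proof (rule comparison[OF R large_solutionD(5)[OF u] large_solutionD(5)[OF v]])
  show "u x * rhs m (v x) \<le> rhs l (u x) * v x" if "0 < x" "x < R" "v x \<le> u x" for x
    using large_solutionD(6)[OF v that(1,2)] that(3) \<open>l \<le> m\<close> by (intro supersolution_ineq rhs_mono_param) auto
  show "u 0 * v1 0 \<le> u1 0 * v 0" using large_solutionD(3,4)[OF u] large_solutionD(3,4)[OF v] by simp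
  show "((\<lambda>x. u x / v x) \<longlongrightarrow> 1) (at_left R)" by (rule large_ratio[OF large_solutionD(1)[OF u] large_solutionD(1)[OF v]])
qed (use large_solutionD(6)[OF v] x in auto)

lemma large_solution_unique:
  assumes "large_solution l u u1 s" "large_solution l v v1 t" "x \<in> {0..<R}"
  shows "u x = v x"
  using large_solution_mono[OF assms(1,2) order_refl assms(3)] large_solution_mono[OF assms(2,1) order_refl assms(3)] by simp

text \<open>Where the ordered solutions touch, \<open>v - u\<close> and its derivative vanish while
  the second derivative is \<open>- (m - l) * u < 0\<close>, which would push \<open>v\<close> below
  \<open>u\<close> just to the right.\<close>

lemma large_solution_strict_mono:
  assumes u: "large_solution l u u1 s" and v: "large_solution m v v1 t" and "l < m"
    and x: "x \<in> {0..<R}" "x = 0 \<longrightarrow> y0 = 1"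
  shows "u x < v x"
proof (rule ccontr)
  assume "\<not> u x < v x"
  have le: "u z \<le> v z" if "z \<in> {0..<R}" for z using large_solution_mono[OF u v _ that] \<open>l < m\<close> by simp
  then have eq: "u x = v x" using x(1) \<open>\<not> u x < v x\<close> by force
  have tw: "twice_deriv {0..<R} (\<lambda>x. v x - u x) (\<lambda>x. v1 x - u1 x) (\<lambda>x. rhs m (v x) - rhs l (u x))"
    by (rule twice_deriv_diff[OF large_solutionD(5)[OF v] large_solutionD(5)[OF u]])
  have d: "((\<lambda>x. v x - u x) has_real_derivative v1 z - u1 z) (at z within {0..<R})"
    "((\<lambda>x. v1 x - u1 x) has_real_derivative rhs m (v z) - rhs l (u z)) (at z within {0..<R})"
    if "z \<in> {0..<R}" for z using tw that by (auto simp: twice_deriv_def)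
  have pos: "0 < u x"
    using x data large_solutionD(2,3)[OF u] large_solutionD(6)[OF u, of x] by (cases "x = 0") auto
  have e1: "v1 x - u1 x = 0"
  proof (cases "x = 0")
    case True
    \<comment> \<open>At \<open>0\<close> a minimum gives only a one-sided inequality; here equal
      values force equal scalars and hence equal slopes.\<close>
    then have "s = t" using eq x large_solutionD(3)[OF u] large_solutionD(3)[OF v] by simp
    then show ?thesis using True large_solutionD(4)[OF u] large_solutionD(4)[OF v] by simp
  next
    case False
    have "0 \<le> v1 x - u1 x"
      by (rule deriv_nonneg_if_min_right[OF d(1)[OF x(1)], of R]) (use eq le x in auto)
    moreover have "v1 x - u1 x \<le> 0"
      by (rule deriv_nonpos_if_min_left[OF d(1)[OF x(1)], of 0]) (use eq le x False in auto)
    ultimately show ?thesis by simp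
  qed
  have "rhs m (v x) - rhs l (u x) = - ((m - l) * u x)" by (simp add: eq rhs_def algebra_simps)
  then have "rhs m (v x) - rhs l (u x) < 0" using pos \<open>l < m\<close> by simp
  from has_real_derivative_neg_dec_right[OF d(2)[OF x(1)] this] obtain r where
    r: "0 < r" "\<And>h. 0 < h \<Longrightarrow> x + h \<in> {0..<R} \<Longrightarrow> h < r \<Longrightarrow> v1 (x + h) - u1 (x + h) < 0" using e1 by auto
  define y where "y = x + min r (R - x) / 2"
  have y: "x < y" "y < R" "y - x < r" using r(1) x(1) by (auto simp: y_def min_def field_simps)
  have neg: "v1 z - u1 z < 0" if "x < z" "z \<le> y" for z
    using r(2)[of "z - x"] that y x by auto
  have "v y - u y \<le> v x - u x"
  proof (rule deriv_nonpos_imp_ge[where S = "{0..<R}" and f = "\<lambda>x. v x - u x" and f' = "\<lambda>x. v1 x - u1 x"])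
    show "v1 z - u1 z \<le> 0" if "x < z" "z < y" for z using neg[of z] that by auto
  qed (use y x d in auto)
  then have "v y = u y" using eq le[of y] y x by auto
  then have "0 \<le> v1 y - u1 y"
    by (intro deriv_nonneg_if_min_right[OF d(1), of y R]) (use le x y in auto)
  then show False using neg[of y] y by auto
qed

section \<open>Translation between \<open>positive_solution\<close> and
  \<open>large_solution\<close>\<close>

lemma large_solutionI:
  assumes L: "large l u u1" and bc: "u 0 * y1 = u1 0 * y0"
  shows "\<exists>s. large_solution l u u1 s"
proof -
  define s where "s = (if y0 = 0 then u1 0 else u 0)"
  have s: "u 0 = s * y0" "u1 0 = s * y1" using bc data by (auto simp: s_def)
  note tw = largeD(1)[OF L] and pos = largeD(2)[OF L]
  have cont: "continuous_on {0..R/2} u"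
    by (rule continuous_on_subset[OF twice_deriv_continuous(1)[OF tw]]) (use R in auto)
  have u0: "0 \<le> u 0"
  proof -
    have "closure {0<..<R/2} = {0..R/2}" using R by (intro closure_greaterThanLessThan) auto
    then show ?thesis
      using continuous_ge_on_closure[of "{0<..<R/2}" u 0 0] cont R pos by (auto simp: less_imp_le)
  qed
  have "0 \<le> s"
  proof (cases "y0 = 0")
    case True
    then have "u 0 = 0" using s by simp
    have "0 \<le> u1 0"
    proof (rule deriv_nonneg_if_min_right)
      show "(u has_real_derivative u1 0) (at 0 within {0..<R})" using tw R by (auto simp: twice_deriv_def)
    qed (use R pos \<open>u 0 = 0\<close> in \<open>auto simp: less_imp_le\<close>)
    then show ?thesis using True by (simp add: s_def)
  qed (use u0 in \<open>simp add: s_def\<close>)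
  moreover have "s \<noteq> 0"
  proof
    assume "s = 0"
    obtain M where M: "\<And>x. x \<in> {0..R/2} \<Longrightarrow> u x \<le> M"
      using continuous_attains_sup[of "{0..R/2}" u] cont R by force
    \<comment> \<open>If \<open>s = 0\<close>, uniqueness for the initial value problem gives
      \<open>u = 0\<close> on \<open>{0..R/2}\<close>; the Lipschitz bound on the range of
      \<open>u\<close> is taken from the truncation at \<open>M\<close>.\<close>
    have M0: "0 < M" using M[of "R/2"] pos[of "R/2"] R by auto
    define K where "K = a * (1 + p) * M powr (p - 1) + \<bar>l\<bar>"
    have bd: "\<bar>rhs l (u x)\<bar> \<le> K * \<bar>u x\<bar>" if x: "x \<in> {0..R/2}" for x
    proof -
      have "0 \<le> u x" using u0 pos[of x] x R by (cases "x = 0") auto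
      then have "rhs l (u x) = trunc l M (u x)" using trunc_eq_rhs[OF M[OF x]] M0 by (simp add: max_absorb1)
      then show ?thesis using trunc_lipschitz[OF M0 order_refl, of l "u x" 0]
        by (simp add: K_def trunc_nonpos)
    qed
    have "twice_deriv {0..R/2} u u1 (\<lambda>x. rhs l (u x))" by (rule twice_deriv_subset[OF tw]) (use R in auto)
    then have "u (R/2) = 0"
      by (rule second_order_unique(1)[OF _ bd]) (use s \<open>s = 0\<close> R in auto)
    then show False using pos[of "R/2"] R by auto
  qed
  ultimately have "large_solution l u u1 s" using L s by (simp add: large_solution_def)
  then show ?thesis by blast
qed

lemma positive_solution_iff:
  assumes "(y0, y1) = boundary_data B"
  shows "positive_solution R p a B l u \<longleftrightarrow> (\<exists>u1 s. large_solution l u u1 s)"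
proof
  have bc: "boundary_value B v d = 0 \<longleftrightarrow> v * y1 = d * y0" for v d
    using boundary_value_eq_0_iff[of B v d] assms by (metis fst_conv snd_conv)
  {
    assume "\<exists>u1 s. large_solution l u u1 s"
    then obtain u1 s where u: "large_solution l u u1 s" by blast
    have eq: "- rhs l (u x) = l * u x - a * \<bar>u x\<bar> powr (p - 1) * u x" if "x \<in> {0..<R}" for x
      using large_solutionD(8)[OF u that] by (simp add: rhs_def algebra_simps)
    have "boundary_value B (u 0) (u1 0) = 0" using large_solutionD(3,4)[OF u] by (simp add: bc)
    then show "positive_solution R p a B l u"
      unfolding positive_solution_def using large_solutionD(5-7)[OF u] eq
      by (intro conjI exI[of _ u1] exI[of _ "\<lambda>x. rhs l (u x)"]) (auto simp: twice_deriv_def)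
  next
    assume "positive_solution R p a B l u"
    then obtain u1 u2 where tw: "twice_deriv {0..<R} u u1 u2"
      and eq: "\<And>x. x \<in> {0..<R} \<Longrightarrow> - u2 x = l * u x - a * \<bar>u x\<bar> powr (p - 1) * u x"
      and bv: "boundary_value B (u 0) (u1 0) = 0" and top: "filterlim u at_top (at_left R)"
      and pos: "\<forall>x\<in>{0<..<R}. 0 < u x"
      unfolding positive_solution_def twice_deriv_def by blast
    have cont: "continuous_on {0..R/2} u"
      by (rule continuous_on_subset[OF twice_deriv_continuous(1)[OF tw]]) (use R in auto)
    have "closure {0<..<R/2} = {0..R/2}" using R by (intro closure_greaterThanLessThan) auto
    then have u0: "0 \<le> u 0"
      using continuous_ge_on_closure[of "{0<..<R/2}" u 0 0] cont R pos by (auto simp: less_imp_le)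
    have u2: "u2 x = rhs l (u x)" if "x \<in> {0..<R}" for x
    proof -
      have "0 \<le> u x" using that u0 pos by (cases "x = 0") (auto simp: less_imp_le)
      then show ?thesis using eq[OF that] by (simp add: rhs_def algebra_simps)
    qed
    have "twice_deriv {0..<R} u u1 (\<lambda>x. rhs l (u x))" by (rule twice_deriv_cong2[OF tw u2])
    then have "large l u u1" unfolding large_def using top pos by blast
    then show "\<exists>u1 s. large_solution l u u1 s" using large_solutionI[of l u u1] bv by (auto simp: bc)
  }
qed

subsection \<open>Differentiability in the parameter\<close>

lemma positive_near_zero:
  assumes u: "twice_deriv {0..<R} u u1 u2" "u 0 = y0" "u1 0 = y1"
  shows "\<exists>d>0. \<forall>x. 0 < x \<longrightarrow> x < d \<longrightarrow> x < R \<longrightarrow> 0 < u x"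
proof (cases "y0 = 1")
  case True
  have "(u \<longlongrightarrow> u 0) (at 0 within {0..<R})"
    using twice_deriv_continuous(1)[OF u(1)] R by (auto simp: continuous_on_def)
  then have "\<forall>\<^sub>F x in at 0 within {0..<R}. 0 < u x"
    by (rule order_tendstoD) (use True u in simp)
  then show ?thesis by (auto simp: eventually_at dist_real_def)
next
  case False
  then have y: "y0 = 0" "y1 = 1" using data by auto
  have "(u has_real_derivative y1) (at 0 within {0..<R})" using u R by (auto simp: twice_deriv_def)
  from has_real_derivative_pos_inc_right[OF this] y u
  show ?thesis by auto
qed

text \<open>The quotient \<open>M / L\<close> has positive limits at both ends, \<open>t / s\<close>
  at \<open>0\<close> and \<open>1\<close> at \<open>R\<close>, and a positive minimum on the
  compact interval in between.\<close>

lemma large_solution_ratio_lower: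
  assumes L: "large_solution l L L1 s" and M: "large_solution m M M1 t"
  shows "\<exists>\<eta>>0. \<forall>x\<in>{0<..<R}. \<eta> * L x \<le> M x"
proof -
  define q where "q = (\<lambda>x. M x / L x)"
  have st: "0 < s" "0 < t" using large_solutionD(2) L M by auto
  have q0: "(q \<longlongrightarrow> t / s) (at 0 within {0..<R})"
  proof (cases "y0 = 1")
    case True
    have "(M \<longlongrightarrow> M 0) (at 0 within {0..<R})" "(L \<longlongrightarrow> L 0) (at 0 within {0..<R})"
      using twice_deriv_continuous(1) large_solutionD(5) L M R unfolding continuous_on_def by fastforce+
    then have "((\<lambda>x. M x / L x) \<longlongrightarrow> M 0 / L 0) (at 0 within {0..<R})"
      by (intro tendsto_divide) (use True st large_solutionD(3)[OF L] in auto)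
    then show ?thesis using True large_solutionD(3)[OF L] large_solutionD(3)[OF M] by (simp add: q_def)
  next
    case False
    then have y: "y0 = 0" "y1 = 1" using data by auto
    have d: "((\<lambda>x. u x / x) \<longlongrightarrow> r) (at 0 within {0..<R})" if "large_solution k u u1 r" for k u u1 r
    proof -
      have "(u has_real_derivative r) (at 0 within {0..<R})"
        using large_solutionD(4,5)[OF that] y R by (auto simp: twice_deriv_def)
      then show ?thesis using large_solutionD(3)[OF that] y by (simp add: has_field_derivative_iff)
    qed
    \<comment> \<open>Both functions vanish at \<open>0\<close>, so the limit of the quotient is
      that of their slopes.\<close>
    have "((\<lambda>x. M x / x / (L x / x)) \<longlongrightarrow> t / s) (at 0 within {0..<R})"
      using d[OF M] d[OF L] st by (intro tendsto_divide) auto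
    moreover have "\<forall>\<^sub>F x in at 0 within {0..<R}. M x / x / (L x / x) = q x"
      by (auto simp: eventually_at q_def intro!: exI[of _ 1])
    ultimately show ?thesis by (rule Lim_transform_eventually)
  qed
  have "\<forall>\<^sub>F x in at 0 within {0..<R}. t / (2 * s) < q x"
    by (rule order_tendstoD(1)[OF q0]) (use st in \<open>auto simp: field_simps\<close>)
  then obtain d where d: "0 < d" "\<And>x. 0 < x \<Longrightarrow> x < R \<Longrightarrow> x < d \<Longrightarrow> t / (2 * s) < q x"
    by (auto simp: eventually_at dist_real_def)
  have "(q \<longlongrightarrow> 1) (at_left R)"
    unfolding q_def by (rule large_ratio[OF large_solutionD(1)[OF M] large_solutionD(1)[OF L]])
  then have "\<forall>\<^sub>F x in at_left R. 1 / 2 < q x" by (rule order_tendstoD) simp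
  then obtain b where b: "b < R" "\<And>x. b < x \<Longrightarrow> x < R \<Longrightarrow> 1 / 2 < q x"
    unfolding eventually_at_left_field by auto
  define c where "c = min d R / 2"
  define e where "e = (max b c + R) / 2"
  have ce: "0 < c" "c < R" "c < d" "c \<le> e" "e < R" "b < e" using d b R by (auto simp: c_def e_def)
  have qpos: "0 < q x" if "0 < x" "x < R" for x
    using large_solutionD(6)[OF L that] large_solutionD(6)[OF M that] by (simp add: q_def)
  have "continuous_on {c..e} q"
    unfolding q_def
  proof (intro continuous_intros)
    show "continuous_on {c..e} M" "continuous_on {c..e} L"
      by (rule continuous_on_subset[OF twice_deriv_continuous(1)[OF large_solutionD(5)]], rule M L, use ce in auto)+
    show "\<forall>x\<in>{c..e}. L x \<noteq> 0"
    proof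
      fix x assume "x \<in> {c..e}"
      then have "0 < L x" using ce by (intro large_solutionD(6)[OF L]) auto
      then show "L x \<noteq> 0" by simp
    qed
  qed
  then obtain z where z: "z \<in> {c..e}" "\<And>x. x \<in> {c..e} \<Longrightarrow> q z \<le> q x"
    using continuous_attains_inf[of "{c..e}" q] ce by auto
  define \<eta> where "\<eta> = Min {t / (2 * s), 1 / 2, q z}"
  have \<eta>: "0 < \<eta>" "\<eta> \<le> t / (2 * s)" "\<eta> \<le> 1 / 2" "\<eta> \<le> q z"
    using st qpos[of z] z ce by (auto simp: \<eta>_def)
  have "\<eta> * L x \<le> M x" if x: "x \<in> {0<..<R}" for x
  proof -
    have "\<eta> \<le> q x"
      using d(2)[of x] b(2)[of x] z(2)[of x] x \<eta> ce by (cases "x < c"; cases "x \<le> e") auto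
    then show ?thesis using large_solutionD(6)[OF L, of x] x by (simp add: q_def field_simps)
  qed
  then show ?thesis using \<eta>(1) by blast
qed

text \<open>The derivative of \<open>rhs l\<close> in \<open>z\<close>. Differentiating the equation
  in \<open>l\<close> gives \<open>D'' = lin_coeff l L * D - L\<close>.\<close>

definition lin_coeff :: "real \<Rightarrow> real \<Rightarrow> real" where
  "lin_coeff l z = p * a * z powr (p - 1) - l"

lemma linear_problem_exists:
  assumes L: "large_solution l L L1 s" and g: "continuous_on {0..<R} g"
  shows "\<exists>u u1. u 0 = \<alpha> \<and> u1 0 = \<beta> \<and> twice_deriv {0..<R} u u1 (\<lambda>x. lin_coeff l (L x) * u x - g x)"
proof (rule second_order_exists[OF R])
  have c: "continuous_on {0..<R} (\<lambda>x. lin_coeff l (L x))"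
    unfolding lin_coeff_def using large_solutionD(8)[OF L] twice_deriv_continuous(1)[OF large_solutionD(5)[OF L]] p
    by (intro continuous_intros continuous_on_powr') auto
  have "continuous_on ({0..<R} \<times> (UNIV :: real set)) (\<lambda>z. lin_coeff l (L (fst z)))"
    "continuous_on ({0..<R} \<times> (UNIV :: real set)) (\<lambda>z. g (fst z))"
    by (rule continuous_on_compose2[OF c] continuous_on_compose2[OF g], auto intro: continuous_intros)+
  then show "continuous_on ({0..<R} \<times> UNIV) (\<lambda>z. lin_coeff l (L (fst z)) * snd z - g (fst z))"
    by (intro continuous_intros)
  fix b assume b: "b \<in> {0..<R}"
  have "continuous_on {0..b} (\<lambda>x. lin_coeff l (L x))" by (rule continuous_on_subset[OF c]) (use b in auto)
  then have "bounded ((\<lambda>x. lin_coeff l (L x)) ` {0..b})"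
    by (intro compact_imp_bounded compact_continuous_image) auto
  then obtain K where K: "\<forall>x\<in>{0..b}. \<bar>lin_coeff l (L x)\<bar> \<le> K" by (auto simp: bounded_iff)
  have "\<bar>lin_coeff l (L x) * y - g x - (lin_coeff l (L x) * z - g x)\<bar> \<le> K * \<bar>y - z\<bar>" if "x \<in> {0..b}" for x y z
  proof -
    have "\<bar>lin_coeff l (L x) * y - g x - (lin_coeff l (L x) * z - g x)\<bar> = \<bar>lin_coeff l (L x)\<bar> * \<bar>y - z\<bar>"
      by (simp add: abs_mult flip: right_diff_distrib)
    then show ?thesis using K that by (simp add: mult_right_mono)
  qed
  moreover have "0 \<le> K" using K b by fastforce
  ultimately show "\<exists>K\<ge>0. \<forall>x\<in>{0..b}. \<forall>y z. \<bar>lin_coeff l (L x) * y - g x - (lin_coeff l (L x) * z - g x)\<bar> \<le> K * \<bar>y - z\<bar>"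
    by blast
qed

text \<open>This makes \<open>(L - M) / \<eta>\<close> a supersolution of the linearised equation:
  the tangent inequality for \<open>z powr p\<close> at \<open>L\<close> bounds the nonlinear part,
  and \<open>M \<ge> \<eta> L\<close> supplies the source term \<open>- L\<close> after division by
  \<open>\<eta>\<close>.\<close>

lemma derivative_bound:
  assumes L: "large_solution l L L1 s" and M: "large_solution (l - 1) M M1 t"
    and \<eta>: "0 < \<eta>" and x: "0 < x" "x < R" and le: "M x \<le> L x" "\<eta> * L x \<le> M x"
  shows "1 / \<eta> * (rhs l (L x) - rhs (l - 1) (M x)) \<le> lin_coeff l (L x) * (1 / \<eta> * (L x - M x)) - L x"
proof -
  have pos: "0 < L x" "0 < M x" using large_solutionD(6) L M x by blast+
  have pw: "z powr p = z powr (p - 1) * z" if "0 < z" for z using powr_add[of z "p - 1" 1] that by simp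
  have "1 + p * (M x / L x - 1) \<le> (1 + (M x / L x - 1)) powr p"
    using pos p by (intro bernoulli_powr) auto
  then have "(1 + p * (M x / L x - 1)) * L x powr p \<le> (M x / L x) powr p * L x powr p"
    by (intro mult_right_mono) auto
  also have "\<dots> = M x powr p" using pos by (simp add: powr_divide)
  also have "(1 + p * (M x / L x - 1)) * L x powr p = L x powr p + p * L x powr (p - 1) * (M x - L x)"
    unfolding pw[OF pos(1)] using pos by (simp add: field_simps)
  finally have "L x powr p - M x powr p \<le> p * L x powr (p - 1) * (L x - M x)" by (simp add: algebra_simps)
  then have "a * (L x powr p - M x powr p) \<le> a * (p * L x powr (p - 1) * (L x - M x))"
    using a by (intro mult_left_mono) auto
  then have "rhs l (L x) - rhs (l - 1) (M x) \<le> lin_coeff l (L x) * (L x - M x) - M x"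
    by (simp add: rhs_def lin_coeff_def pw[OF pos(1)] pw[OF pos(2)] algebra_simps)
  also have "\<dots> \<le> lin_coeff l (L x) * (L x - M x) - \<eta> * L x" using le by simp
  finally have "1 / \<eta> * (rhs l (L x) - rhs (l - 1) (M x)) \<le> 1 / \<eta> * (lin_coeff l (L x) * (L x - M x) - \<eta> * L x)"
    using \<eta> by (intro mult_left_mono) auto
  also have "\<dots> = lin_coeff l (L x) * (1 / \<eta> * (L x - M x)) - L x" using \<eta> by (simp add: field_simps)
  finally show ?thesis .
qed

text \<open>The solution \<open>L\<close> serves as reference: \<open>lin_coeff l z\<close> exceeds
  \<open>rhs l z / z\<close> by \<open>(p - 1) a z^(p-1)\<close>, so \<open>u / L\<close> cannot
  decrease while \<open>u \<ge> 0\<close>, and it starts out positive.\<close>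

lemma lin_homogeneous_pos:
  assumes L: "large_solution l L L1 s" and u: "u 0 = y0" "u1 0 = y1" "twice_deriv {0..<R} u u1 (\<lambda>x. lin_coeff l (L x) * u x)"
    and z: "0 < z" "z < R"
  shows "0 < u z"
proof (rule ccontr)
  assume "\<not> 0 < u z"
  obtain d where d: "0 < d" "\<And>x. 0 < x \<Longrightarrow> x < d \<Longrightarrow> x < R \<Longrightarrow> 0 < u x"
    using positive_near_zero[OF u(3,1,2)] by blast
  define y where "y = min d z / 2"
  have y: "0 < y" "y < d" "y < z" using d z by (auto simp: y_def)
  have "continuous_on {y..z} u"
    by (rule continuous_on_subset[OF twice_deriv_continuous(1)[OF u(3)]]) (use y z in auto)
  then have "\<exists>x\<in>{y..z}. (x = z \<or> u x = 0) \<and> (\<forall>w\<in>{y..x}. 0 \<le> u w)"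
    using d(2)[of y] y z by (intro first_hit) auto
  then obtain x where x: "x \<in> {y..z}" "x = z \<or> u x = 0" "\<forall>w\<in>{y..x}. 0 \<le> u w" by blast
  then have "u x = 0" using \<open>\<not> 0 < u z\<close> by force
  have nonneg: "0 \<le> u w" if "0 < w" "w \<le> x" for w
    using x that d(2)[of w] y z by (cases "w < y") (auto simp: less_imp_le)
  have W: "u w * L1 w \<le> u1 w * L w" if w: "0 \<le> w" "w \<le> x" for w
  proof (rule wronskian_nonneg[OF u(3) large_solutionD(5)[OF L], of 0])
    show "u 0 * L1 0 \<le> u1 0 * L 0" using u large_solutionD(3,4)[OF L] by simp
    fix v assume v: "0 < v" "v < w"
    have "0 < L v" using large_solutionD(6)[OF L] v w x z by auto
    then have "0 \<le> (p - 1) * (a * L v powr (p - 1)) * (u v * L v)"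
      using nonneg[of v] v w a p by (intro mult_nonneg_nonneg) auto
    then show "u v * rhs l (L v) \<le> lin_coeff l (L v) * u v * L v"
      by (simp add: rhs_def lin_coeff_def algebra_simps)
  qed (use w x z in auto)
  have "u y / L y \<le> u x / L x"
    by (rule quotient_mono[OF u(3) large_solutionD(5)[OF L]]) (use W x y z large_solutionD(6)[OF L] in auto)
  moreover have "0 < u y / L y" using d(2)[of y] y z large_solutionD(6)[OF L, of y] by simp
  ultimately show False using \<open>u x = 0\<close> by simp
qed

text \<open>The derivative of the solution with respect to the parameter is singled out among the solutions of the
  linearised problem by not growing at the blow-up point. A supersolution is provided by the
  difference with the solution for the parameter \<open>l - 1\<close>.\<close>

lemma linearised_solution_exists:
  assumes L: "large_solution l L L1 s"
  shows "\<exists>D D1 A r. twice_deriv {0..<R} D D1 (\<lambda>x. lin_coeff l (L x) * D x - L x) \<and> D 0 = A * y0 \<and> D1 0 = A * y1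
    \<and> 0 \<le> r \<and> (\<forall>x\<in>{0<..<R}. 0 \<le> D x \<and> D x \<le> r * L x) \<and> ((\<lambda>x. D x / L x) \<longlongrightarrow> 0) (at_left R)"
proof -
  obtain M M1 t where M: "large_solution (l - 1) M M1 t" using large_solution_exists by blast
  obtain \<eta> where \<eta>: "0 < \<eta>" "\<And>x. x \<in> {0<..<R} \<Longrightarrow> \<eta> * L x \<le> M x"
    using large_solution_ratio_lower[OF L M] by blast
  have MleL: "M x \<le> L x" if "x \<in> {0..<R}" for x using large_solution_mono[OF M L _ that] by simp
  let ?c = "\<lambda>x. lin_coeff l (L x)"
  define E where "E = (\<lambda>x. 1 / \<eta> * (L x - M x))"
  define E1 where "E1 = (\<lambda>x. 1 / \<eta> * (L1 x - M1 x))"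
  have twE: "twice_deriv {0..<R} E E1 (\<lambda>x. 1 / \<eta> * (rhs l (L x) - rhs (l - 1) (M x)))"
    using twice_deriv_lincomb[OF large_solutionD(5)[OF L] large_solutionD(5)[OF M], of "1 / \<eta>" "- (1 / \<eta>)"]
    by (simp add: E_def E1_def right_diff_distrib)
  have E0: "0 \<le> E x" if "x \<in> {0..<R}" for x using MleL[OF that] \<eta> by (simp add: E_def)
  \<comment> \<open>The solutions of the linearised equation that satisfy the boundary condition are
    \<open>P + A \<phi>\<close>; only the number \<open>A\<close> remains to be found.\<close>
  obtain \<phi> \<phi>1 where \<phi>: "\<phi> 0 = y0" "\<phi>1 0 = y1" "twice_deriv {0..<R} \<phi> \<phi>1 (\<lambda>x. ?c x * \<phi> x)"
    using linear_problem_exists[OF L, of "\<lambda>x. 0" y0 y1] by auto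
  obtain P P1 where P: "P 0 = 0" "P1 0 = 0" "twice_deriv {0..<R} P P1 (\<lambda>x. ?c x * P x - L x)"
    using linear_problem_exists[OF L twice_deriv_continuous(1)[OF large_solutionD(5)[OF L]], of 0 0] by auto
  have \<phi>pos: "0 < \<phi> x" if "0 < x" "x < R" for x by (rule lin_homogeneous_pos[OF L \<phi> that])
  \<comment> \<open>The requirement \<open>0 \<le> P + A \<phi> \<le> E\<close> reads
    \<open>- P / \<phi> \<le> A \<le> (E - P) / \<phi>\<close>. The left side is nondecreasing and,
    by \<open>Qmono\<close> below, the right side nonincreasing, so every left value lies below
    every right value.\<close>
  have Pmono: "- P x / \<phi> x \<le> - P y / \<phi> y" if xy: "0 < x" "x \<le> y" "y < R" for x y
  proof -
    have tw: "twice_deriv {0..<R} (\<lambda>x. - P x) (\<lambda>x. - P1 x) (\<lambda>x. - (?c x * P x - L x))"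
      using twice_deriv_lincomb[OF P(3) P(3), of "-1" 0] by simp
    show ?thesis
    proof (rule quotient_mono[OF tw \<phi>(3) xy \<phi>pos])
      show "- P z * \<phi>1 z \<le> - P1 z * \<phi> z" if "x < z" "z < y" for z
      proof (rule wronskian_nonneg[OF tw \<phi>(3), of 0])
        show "- P w * (?c w * \<phi> w) \<le> - (?c w * P w - L w) * \<phi> w" if "0 < w" "w < z" for w
          using mult_nonneg_nonneg[of "L w" "\<phi> w"] \<phi>pos[of w] large_solutionD(6)[OF L, of w] that \<open>z < y\<close> xy
          by (simp add: algebra_simps less_imp_le)
      qed (use P that xy in auto)
    qed auto
  qed
  have Qmono: "(P y - E y) / \<phi> y \<ge> (P x - E x) / \<phi> x" if xy: "0 < x" "x \<le> y" "y < R" for x y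
  proof -
    note tw = twice_deriv_diff[OF P(3) twE]
    show ?thesis
    proof (rule quotient_mono[OF tw \<phi>(3) xy \<phi>pos])
      show "(P z - E z) * \<phi>1 z \<le> (P1 z - E1 z) * \<phi> z" if "x < z" "z < y" for z
      proof (rule wronskian_nonneg[OF tw \<phi>(3), of 0])
        show "(P 0 - E 0) * \<phi>1 0 \<le> (P1 0 - E1 0) * \<phi> 0"
          using P \<phi> large_solutionD(3,4)[OF L] large_solutionD(3,4)[OF M] by (simp add: E_def E1_def algebra_simps)
        show "(P w - E w) * (?c w * \<phi> w) \<le> (?c w * P w - L w - 1 / \<eta> * (rhs l (L w) - rhs (l - 1) (M w))) * \<phi> w"
          if w: "0 < w" "w < z" for w
        proof -
          have "?c w * (P w - E w) \<le> ?c w * P w - L w - 1 / \<eta> * (rhs l (L w) - rhs (l - 1) (M w))"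
            using derivative_bound[OF L M \<eta>(1), of w] MleL[of w] \<eta>(2)[of w] w \<open>z < y\<close> xy
            by (simp add: E_def right_diff_distrib)
          then have "?c w * (P w - E w) * \<phi> w \<le> (?c w * P w - L w - 1 / \<eta> * (rhs l (L w) - rhs (l - 1) (M w))) * \<phi> w"
            using \<phi>pos[of w] w \<open>z < y\<close> xy by (intro mult_right_mono) auto
          then show ?thesis by (simp only: ac_simps)
        qed
      qed (use that xy in auto)
    qed auto
  qed
  have PQ: "- P y / \<phi> y \<le> (E x - P x) / \<phi> x" if "0 < x" "x < R" "0 < y" "y < R" for x y
  proof -
    have E: "- P w / \<phi> w \<le> (E w - P w) / \<phi> w" if "0 < w" "w < R" for w
      using E0[of w] \<phi>pos[of w] that by (intro divide_right_mono) auto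
    show ?thesis
    proof (cases "y \<le> x")
      case True
      then show ?thesis using Pmono[of y x] E[of x] that by linarith
    next
      case False
      have "(E y - P y) / \<phi> y \<le> (E x - P x) / \<phi> x"
        using Qmono[of x y] False that by (simp add: diff_divide_distrib)
      then show ?thesis using E[of y] that by linarith
    qed
  qed
  define A where "A = Sup ((\<lambda>y. - P y / \<phi> y) ` {0<..<R})"
  have ne: "{0<..<R} \<noteq> {}" using R by simp
  have Ale: "A \<le> (E x - P x) / \<phi> x" if "0 < x" "x < R" for x
    unfolding A_def by (rule cSUP_least[OF ne]) (use PQ that in auto)
  have "bdd_above ((\<lambda>y. - P y / \<phi> y) ` {0<..<R})"
    using PQ[of "R/2"] R by (intro bdd_aboveI2[of _ _ "(E (R/2) - P (R/2)) / \<phi> (R/2)"]) auto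
  then have leA: "- P x / \<phi> x \<le> A" if "0 < x" "x < R" for x
    unfolding A_def using that by (intro cSUP_upper) auto
  define D where "D = (\<lambda>x. 1 * P x + A * \<phi> x)"
  define D1 where "D1 = (\<lambda>x. 1 * P1 x + A * \<phi>1 x)"
  have twD: "twice_deriv {0..<R} D D1 (\<lambda>x. ?c x * D x - L x)"
    unfolding D_def D1_def using twice_deriv_lincomb[OF P(3) \<phi>(3), of 1 A]
    by (rule twice_deriv_cong2) (simp add: algebra_simps)
  have D: "0 \<le> D x" "D x \<le> E x" if "0 < x" "x < R" for x
    using leA[OF that] Ale[OF that] \<phi>pos[OF that] by (auto simp: D_def field_simps)
  have EL: "E x \<le> 1 / \<eta> * L x" if "0 < x" "x < R" for x
    unfolding E_def using large_solutionD(6)[OF M that] \<eta> by (intro mult_left_mono) auto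
  \<comment> \<open>The bound \<open>D \<le> E\<close> decides this:
    \<open>E / L = (1 - M / L) / \<eta>\<close>, and \<open>M / L\<close> tends to \<open>1\<close>
    although the parameters differ.\<close>
  have "((\<lambda>x. D x / L x) \<longlongrightarrow> 0) (at_left R)"
  proof (rule Lim_null_comparison)
    have "((\<lambda>x. 1 / \<eta> * (1 - M x / L x)) \<longlongrightarrow> 1 / \<eta> * (1 - 1)) (at_left R)"
      by (intro tendsto_intros large_ratio[OF large_solutionD(1)[OF M] large_solutionD(1)[OF L]])
    then show "((\<lambda>x. 1 / \<eta> * (1 - M x / L x)) \<longlongrightarrow> 0) (at_left R)" by simp
    show "\<forall>\<^sub>F x in at_left R. norm (D x / L x) \<le> 1 / \<eta> * (1 - M x / L x)"
      using eventually_inside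
    proof eventually_elim
      case (elim x)
      then have "0 < L x" "0 \<le> D x" "D x \<le> E x" using D large_solutionD(6)[OF L] by auto
      then have "norm (D x / L x) \<le> E x / L x" by (simp add: divide_right_mono)
      also have "\<dots> = 1 / \<eta> * (1 - M x / L x)" using \<open>0 < L x\<close> by (simp add: E_def field_simps)
      finally show ?case .
    qed
  qed
  moreover have "D x \<le> 1 / \<eta> * L x" if "0 < x" "x < R" for x using D(2)[OF that] EL[OF that] by simp
  moreover have "D 0 = A * y0" "D1 0 = A * y1" using P \<phi> by (auto simp: D_def D1_def)
  ultimately show ?thesis using twD D(1) \<eta>(1)
    by (intro exI[of _ D] exI[of _ D1] exI[of _ A] exI[of _ "1 / \<eta>"]) auto
qed

text \<open>With \<open>z = L\<close> and \<open>z * r = D\<close>, the first two summands are the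
  second derivative of \<open>(1 + \<kappa>) L + \<eta> D\<close>. The last one is the defect, whose
  sign decides between super- and subsolution.\<close>

lemma perturbed_rhs:
  assumes "0 < z" "0 < m" "m = 1 + \<kappa> + \<eta> * r"
  shows "rhs (l + h) (z * m) = (1 + \<kappa>) * rhs l z + \<eta> * (lin_coeff l z * (z * r) - z)
    + z * (a * z powr (p - 1) * (m powr p - 1 - \<kappa> - p * \<eta> * r) + (\<eta> - h * m))"
proof -
  have "m powr p = m powr (p - 1) * m" using powr_add[of m "p - 1" 1] assms(2) by simp
  moreover have "(z * m) powr (p - 1) = z powr (p - 1) * m powr (p - 1)"
    using assms by (simp add: powr_mult)
  moreover have "l * m = l * (1 + \<kappa> + \<eta> * r)" using assms(3) by simp
  ultimately show ?thesis unfolding rhs_def lin_coeff_def by algebra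
qed

text \<open>With the derivative \<open>D\<close> at hand, \<open>L + h D \<plusminus> k h\<^sup>2 (L + D)\<close> are a super- and a subsolution for the
  parameter \<open>l + h\<close>: the term \<open>k h\<^sup>2 L\<close> absorbs the second-order remainder of the power and
  \<open>k h\<^sup>2 D\<close> the one of the linear part.\<close>

lemma large_solution_expansion:
  assumes L: "large_solution l L L1 s"
  shows "\<exists>D k h0. continuous_on {0..<R} D \<and> 0 \<le> k \<and> 0 < h0 \<and>
    (\<forall>h u u1 t. \<bar>h\<bar> \<le> h0 \<longrightarrow> large_solution (l + h) u u1 t \<longrightarrow>
      (\<forall>x\<in>{0..<R}. \<bar>u x - L x - h * D x\<bar> \<le> k * h\<^sup>2 * (L x + D x)))"
proof -
  obtain D D1 A \<rho> where D: "twice_deriv {0..<R} D D1 (\<lambda>x. lin_coeff l (L x) * D x - L x)" "D 0 = A * y0" "D1 0 = A * y1"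
    "0 \<le> \<rho>" "\<And>x. x \<in> {0<..<R} \<Longrightarrow> 0 \<le> D x \<and> D x \<le> \<rho> * L x" "((\<lambda>x. D x / L x) \<longlongrightarrow> 0) (at_left R)"
    using linearised_solution_exists[OF L] by blast
  obtain d0 C where dC: "0 < d0" "d0 \<le> 1/2" "0 \<le> C"
    "\<And>d. \<bar>d\<bar> \<le> d0 \<Longrightarrow> (1 + d) powr p \<le> 1 + p * d + C * d\<^sup>2"
    using powr_quadratic_upper_bound[OF p] by blast
  \<comment> \<open>The summand \<open>1 + \<rho>\<close> lets \<open>k h^2\<close> absorb the term
    \<open>h * d\<close> of the linear part; the other summand lets \<open>(p - 1) k h^2\<close>
    absorb the remainder \<open>C d^2\<close> of the power.\<close>
  define k where "k = 1 + \<rho> + C * (1 + \<rho>)\<^sup>2 / (p - 1)"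
  have k: "1 + \<rho> \<le> k" "C * (1 + \<rho>)\<^sup>2 \<le> (p - 1) * k"
  proof -
    have "(p - 1) * k = (p - 1) * (1 + \<rho>) + C * (1 + \<rho>)\<^sup>2" using p by (simp add: k_def distrib_left)
    then show "C * (1 + \<rho>)\<^sup>2 \<le> (p - 1) * k" using p D(4) by simp
    show "1 + \<rho> \<le> k" using p dC(3) by (simp add: k_def)
  qed
  \<comment> \<open>The first bound keeps the \<open>k h^2\<close> corrections below first order,
    giving \<open>\<bar>d\<bar> \<le> \<bar>h\<bar> (1 + \<rho>)\<close> for the relative deviation
    \<open>d\<close>; the second puts \<open>d\<close> into the range of the quadratic
    bound.\<close>
  define h0 where "h0 = min (1 / (k * (1 + \<rho>))) (d0 / (1 + \<rho>))"
  have kr: "0 < k * (1 + \<rho>)" "0 < 1 + \<rho>" using k D(4) by auto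
  have h0: "0 < h0" using kr dC(1) by (simp add: h0_def)
  have "\<bar>u x - L x - h * D x\<bar> \<le> k * h\<^sup>2 * (L x + D x)"
    if h: "\<bar>h\<bar> \<le> h0" and u: "large_solution (l + h) u u1 t" and x: "x \<in> {0..<R}" for h u u1 t x
  proof -
    have hk: "\<bar>h\<bar> * (k * (1 + \<rho>)) \<le> 1" "\<bar>h\<bar> * (1 + \<rho>) \<le> d0"
      using h kr by (simp_all add: h0_def pos_le_divide_eq)
    have delta: "\<bar>\<kappa> + (h + \<kappa>) * r\<bar> \<le> \<bar>h\<bar> * (1 + \<rho>)" if "\<bar>\<kappa>\<bar> = k * h\<^sup>2" "0 \<le> r" "r \<le> \<rho>" for \<kappa> r
    proof -
      have "\<bar>\<kappa> + (h + \<kappa>) * r\<bar> \<le> \<bar>\<kappa>\<bar> + \<bar>h + \<kappa>\<bar> * r"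
        using that by (intro order_trans[OF abs_triangle_ineq]) (simp add: abs_mult)
      also have "\<dots> \<le> \<bar>\<kappa>\<bar> + (\<bar>h\<bar> + \<bar>\<kappa>\<bar>) * \<rho>"
        using that by (intro add_left_mono mult_mono) auto
      also have "\<dots> = \<bar>h\<bar> * \<rho> + \<bar>h\<bar> * (\<bar>h\<bar> * (k * (1 + \<rho>)))"
        using that(1) by (simp add: algebra_simps power2_eq_square)
      also have "\<dots> \<le> \<bar>h\<bar> * \<rho> + \<bar>h\<bar> * 1" using hk(1) by (intro add_left_mono mult_left_mono) auto
      finally show ?thesis by (simp add: algebra_simps)
    qed
    let ?psi = "\<lambda>\<kappa> x. (1 + \<kappa>) * L x + (h + \<kappa>) * D x"
    let ?psi1 = "\<lambda>\<kappa> x. (1 + \<kappa>) * L1 x + (h + \<kappa>) * D1 x"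
    let ?psi2 = "\<lambda>\<kappa> x. (1 + \<kappa>) * rhs l (L x) + (h + \<kappa>) * (lin_coeff l (L x) * D x - L x)"
    have tw: "twice_deriv {0..<R} (?psi \<kappa>) (?psi1 \<kappa>) (?psi2 \<kappa>)" for \<kappa>
      by (rule twice_deriv_lincomb[OF large_solutionD(5)[OF L] D(1)])
    have W0: "?psi \<kappa> 0 * u1 0 = ?psi1 \<kappa> 0 * u 0" for \<kappa>
      using D(2,3) large_solutionD(3,4)[OF L] large_solutionD(3,4)[OF u] by (simp add: algebra_simps)
    have psi: "\<exists>r. 0 \<le> r \<and> r \<le> \<rho> \<and> D y = L y * r \<and> ?psi \<kappa> y = L y * (1 + \<kappa> + (h + \<kappa>) * r) \<and> 0 < L y
        \<and> \<bar>\<kappa> + (h + \<kappa>) * r\<bar> \<le> \<bar>h\<bar> * (1 + \<rho>) \<and> 0 < 1 + \<kappa> + (h + \<kappa>) * r"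
      if "\<bar>\<kappa>\<bar> = k * h\<^sup>2" "0 < y" "y < R" for \<kappa> y
    proof -
      have Lp: "0 < L y" using large_solutionD(6)[OF L that(2,3)] .
      have r: "0 \<le> D y / L y" "D y / L y \<le> \<rho>" using D(5)[of y] that Lp by (auto simp: field_simps)
      have "\<bar>\<kappa> + (h + \<kappa>) * (D y / L y)\<bar> \<le> \<bar>h\<bar> * (1 + \<rho>)" by (rule delta[OF that(1) r])
      moreover from this have "0 < 1 + \<kappa> + (h + \<kappa>) * (D y / L y)" using hk(2) dC(2) by linarith
      ultimately show ?thesis using r Lp by (intro exI[of _ "D y / L y"]) (auto simp: field_simps)
    qed
    have hd: "\<bar>h * d\<bar> \<le> k * h\<^sup>2" if "\<bar>d\<bar> \<le> \<bar>h\<bar> * (1 + \<rho>)" for d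
    proof -
      have "\<bar>h * d\<bar> \<le> \<bar>h\<bar> * (\<bar>h\<bar> * (1 + \<rho>))"
        unfolding abs_mult using that by (intro mult_left_mono) auto
      also have "\<dots> = h\<^sup>2 * (1 + \<rho>)" by (simp add: power2_eq_square flip: abs_mult mult.assoc)
      also have "\<dots> \<le> h\<^sup>2 * k" using k by (intro mult_left_mono) auto
      finally show ?thesis by (simp add: mult.commute)
    qed
    have lim: "((\<lambda>x. u x / L x) \<longlongrightarrow> 1) (at_left R)"
      by (rule large_ratio[OF large_solutionD(1)[OF u] large_solutionD(1)[OF L]])
    have limpsi: "((\<lambda>x. 1 + \<kappa> + (h + \<kappa>) * (D x / L x)) \<longlongrightarrow> 1 + \<kappa>) (at_left R)" for \<kappa>
      using tendsto_add[OF tendsto_const[of "1 + \<kappa>"] tendsto_mult[OF tendsto_const[of "h + \<kappa>"] D(6)]] by simp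
    have psiL: "\<forall>\<^sub>F y in at_left R. 0 < L y \<and> 0 < u y \<and> 1 + \<kappa> + (h + \<kappa>) * (D y / L y) = ?psi \<kappa> y / L y" for \<kappa>
      using eventually_inside
    proof eventually_elim
      case (elim y)
      then show ?case using large_solutionD(6)[OF L, of y] large_solutionD(6)[OF u, of y] by (simp add: field_simps)
    qed
    have upper: "u x \<le> ?psi (k * h\<^sup>2) x"
    proof -
      define \<kappa> where "\<kappa> = k * h\<^sup>2"
      have \<kappa>: "0 \<le> \<kappa>" "\<bar>\<kappa>\<bar> = k * h\<^sup>2" using k D(4) by (auto simp: \<kappa>_def)
      have "u x \<le> ?psi \<kappa> x"
      proof (rule comparison[OF R large_solutionD(5)[OF u] tw])
        fix y assume y: "0 < y" "y < R"
        obtain r where r: "0 \<le> r" "r \<le> \<rho>" "D y = L y * r" "?psi \<kappa> y = L y * (1 + \<kappa> + (h + \<kappa>) * r)" "0 < L y"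
          "\<bar>\<kappa> + (h + \<kappa>) * r\<bar> \<le> \<bar>h\<bar> * (1 + \<rho>)" "0 < 1 + \<kappa> + (h + \<kappa>) * r"
          using psi[OF \<kappa>(2) y] by blast
        define d where "d = \<kappa> + (h + \<kappa>) * r"
        show pos: "0 < ?psi \<kappa> y" unfolding r(4) using r by simp
        have "1 + p * d \<le> (1 + d) powr p" using p r(7) by (intro bernoulli_powr) (auto simp: d_def)
        \<comment> \<open>After Bernoulli's inequality exactly \<open>p \<kappa> - \<kappa>\<close>
          is left over from the power term.\<close>
        moreover have "0 \<le> (p - 1) * \<kappa>" using \<kappa>(1) p by simp
        ultimately have 1: "0 \<le> (1 + d) powr p - 1 - \<kappa> - p * (h + \<kappa>) * r"
          by (simp add: d_def algebra_simps)
        have "h * d \<le> \<kappa>" using hd[of d] r(6) by (simp add: d_def \<kappa>_def)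
        then have 2: "0 \<le> h + \<kappa> - h * (1 + d)" by (simp add: algebra_simps)
        have "0 \<le> L y * (a * L y powr (p - 1) * ((1 + d) powr p - 1 - \<kappa> - p * (h + \<kappa>) * r) + (h + \<kappa> - h * (1 + d)))"
          using 1 2 r(5) a by (intro mult_nonneg_nonneg add_nonneg_nonneg) auto
        moreover have "rhs (l + h) (L y * (1 + d)) = ?psi2 \<kappa> y + L y * (a * L y powr (p - 1) * ((1 + d) powr p - 1 - \<kappa> - p * (h + \<kappa>) * r) + (h + \<kappa> - h * (1 + d)))"
          unfolding r(3) using r by (intro perturbed_rhs) (auto simp: d_def)
        moreover have "?psi \<kappa> y = L y * (1 + d)" using r(4) by (simp only: d_def add.assoc)
        ultimately have "?psi2 \<kappa> y \<le> rhs (l + h) (?psi \<kappa> y)" by (simp only: le_add_same_cancel1)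
        then show "u y * ?psi2 \<kappa> y \<le> rhs (l + h) (u y) * ?psi \<kappa> y" if "?psi \<kappa> y \<le> u y"
          by (rule supersolution_ineq[OF pos that])
      next
        show "u 0 * ?psi1 \<kappa> 0 \<le> u1 0 * ?psi \<kappa> 0" using W0[of \<kappa>] by (simp add: ac_simps)
        \<comment> \<open>Because \<open>D / L\<close> vanishes at \<open>R\<close>, the correction
          \<open>\<kappa> L\<close> alone decides on which side of \<open>1\<close> the limit
          lies.\<close>
        have "((\<lambda>y. u y / L y / (1 + \<kappa> + (h + \<kappa>) * (D y / L y))) \<longlongrightarrow> 1 / (1 + \<kappa>)) (at_left R)"
          using \<kappa>(1) by (intro tendsto_divide lim limpsi) auto
        moreover have "\<forall>\<^sub>F y in at_left R. u y / L y / (1 + \<kappa> + (h + \<kappa>) * (D y / L y)) = u y / ?psi \<kappa> y"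
          using psiL[of \<kappa>] by eventually_elim simp
        ultimately show "((\<lambda>y. u y / ?psi \<kappa> y) \<longlongrightarrow> 1 / (1 + \<kappa>)) (at_left R)" by (rule Lim_transform_eventually)
        show "1 / (1 + \<kappa>) \<le> 1" using \<kappa>(1) by simp
      qed (use x in auto)
      then show ?thesis by (simp add: \<kappa>_def)
    qed
    have lower: "?psi (- (k * h\<^sup>2)) x \<le> u x"
    proof -
      define \<kappa> where "\<kappa> = - (k * h\<^sup>2)"
      have \<kappa>: "\<kappa> \<le> 0" "\<bar>\<kappa>\<bar> = k * h\<^sup>2" using k D(4) by (auto simp: \<kappa>_def)
      have "?psi \<kappa> x \<le> u x"
      \<comment> \<open>The roles are exchanged: the true solution is now the positive comparison
        function above the subsolution.\<close>
      proof (rule comparison[OF R tw large_solutionD(5)[OF u]])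
        fix y assume y: "0 < y" "y < R"
        show pos: "0 < u y" by (rule large_solutionD(6)[OF u y])
        obtain r where r: "0 \<le> r" "r \<le> \<rho>" "D y = L y * r" "?psi \<kappa> y = L y * (1 + \<kappa> + (h + \<kappa>) * r)" "0 < L y"
          "\<bar>\<kappa> + (h + \<kappa>) * r\<bar> \<le> \<bar>h\<bar> * (1 + \<rho>)" "0 < 1 + \<kappa> + (h + \<kappa>) * r"
          using psi[OF \<kappa>(2) y] by blast
        define d where "d = \<kappa> + (h + \<kappa>) * r"
        have "(1 + d) powr p \<le> 1 + p * d + C * d\<^sup>2" using r(6) hk(2) by (intro dC(4)) (simp add: d_def)
        moreover have "C * d\<^sup>2 \<le> (p - 1) * (k * h\<^sup>2)"
        proof -
          have "d\<^sup>2 \<le> (\<bar>h\<bar> * (1 + \<rho>))\<^sup>2" using r(6) by (simp add: d_def abs_le_square_iff[symmetric])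
          then have "C * d\<^sup>2 \<le> C * (1 + \<rho>)\<^sup>2 * h\<^sup>2" using mult_left_mono[OF _ dC(3)] by (fastforce simp: power_mult_distrib ac_simps)
          also have "\<dots> \<le> (p - 1) * k * h\<^sup>2" using k(2) by (intro mult_right_mono) auto
          finally show ?thesis by (simp add: mult.assoc)
        qed
        ultimately have 1: "(1 + d) powr p - 1 - \<kappa> - p * (h + \<kappa>) * r \<le> 0"
          by (simp add: d_def \<kappa>_def algebra_simps)
        have "- (h * d) \<le> - \<kappa>" using hd[of d] r(6) by (simp add: d_def \<kappa>_def)
        then have 2: "h + \<kappa> - h * (1 + d) \<le> 0" by (simp add: algebra_simps)
        have "L y * (a * L y powr (p - 1) * ((1 + d) powr p - 1 - \<kappa> - p * (h + \<kappa>) * r) + (h + \<kappa> - h * (1 + d))) \<le> 0"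
          using 1 2 r(5) a by (intro mult_nonneg_nonpos add_nonpos_nonpos) auto
        moreover have "rhs (l + h) (L y * (1 + d)) = ?psi2 \<kappa> y + L y * (a * L y powr (p - 1) * ((1 + d) powr p - 1 - \<kappa> - p * (h + \<kappa>) * r) + (h + \<kappa> - h * (1 + d)))"
          unfolding r(3) using r by (intro perturbed_rhs) (auto simp: d_def)
        moreover have "?psi \<kappa> y = L y * (1 + d)" using r(4) by (simp only: d_def add.assoc)
        ultimately have "rhs (l + h) (?psi \<kappa> y) \<le> ?psi2 \<kappa> y" by (simp only: add_le_same_cancel1)
        then show "?psi \<kappa> y * rhs (l + h) (u y) \<le> ?psi2 \<kappa> y * u y" if "u y \<le> ?psi \<kappa> y"
          by (rule subsolution_ineq[OF pos that])
      next
        show "?psi \<kappa> 0 * u1 0 \<le> ?psi1 \<kappa> 0 * u 0" using W0[of \<kappa>] by simp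
        have "((\<lambda>y. (1 + \<kappa> + (h + \<kappa>) * (D y / L y)) / (u y / L y)) \<longlongrightarrow> (1 + \<kappa>) / 1) (at_left R)"
          by (intro tendsto_divide lim limpsi) auto
        moreover have "\<forall>\<^sub>F y in at_left R. (1 + \<kappa> + (h + \<kappa>) * (D y / L y)) / (u y / L y) = ?psi \<kappa> y / u y"
          using psiL[of \<kappa>] by eventually_elim simp
        ultimately show "((\<lambda>y. ?psi \<kappa> y / u y) \<longlongrightarrow> (1 + \<kappa>) / 1) (at_left R)" by (rule Lim_transform_eventually)
        show "(1 + \<kappa>) / 1 \<le> 1" using \<kappa>(1) by simp
      qed (use x in auto)
      then show ?thesis by (simp add: \<kappa>_def)
    qed
    show ?thesis using upper lower by (simp add: abs_le_iff algebra_simps)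
  qed
  moreover have "0 \<le> k" using k D(4) by simp
  ultimately show ?thesis using h0 twice_deriv_continuous(1)[OF D(1)] by blast
qed

lemma large_family_differentiable:
  assumes L: "\<And>l. large_solution l (L l) (L1 l) (s l)"
  shows "differentiable_curve_C {0..<R} L"
  unfolding differentiable_curve_C_def
proof (intro conjI allI)
  have cont: "continuous_on {0..<R} (L l)" for l by (rule twice_deriv_continuous(1)[OF large_solutionD(5)[OF L]])
  then show "continuous_on {0..<R} (L l)" for l .
  fix l
  obtain D k h0 where D: "continuous_on {0..<R} D" "0 \<le> k" "0 < h0"
    "\<And>h x. \<bar>h\<bar> \<le> h0 \<Longrightarrow> x \<in> {0..<R} \<Longrightarrow> \<bar>L (l + h) x - L l x - h * D x\<bar> \<le> k * h\<^sup>2 * (L l x + D x)"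
    using large_solution_expansion[OF L[of l]] L by metis
  have "uniform_limit K (\<lambda>h x. (L (l + h) x - L l x) / h) D (at 0)" if K: "compact K" "K \<subseteq> {0..<R}" for K
  proof (rule uniform_limitI)
    fix e :: real assume e: "0 < e"
    have "continuous_on K (\<lambda>x. L l x + D x)"
      by (rule continuous_on_subset[OF _ K(2)]) (intro continuous_intros cont D(1))
    then have "bounded ((\<lambda>x. L l x + D x) ` K)" by (intro compact_imp_bounded compact_continuous_image K(1))
    then obtain M where M: "\<forall>x\<in>K. \<bar>L l x + D x\<bar> \<le> M" by (auto simp: bounded_iff)
    define C where "C = k * \<bar>M\<bar> + 1"
    have C: "0 < C" using D(2) by (simp add: C_def add_nonneg_pos)
    define r where "r = min h0 (e / C)"
    have r: "0 < r" using D(3) e C by (simp add: r_def)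
    have "dist ((L (l + h) x - L l x) / h) (D x) < e" if h: "h \<noteq> 0" "\<bar>h\<bar> < r" and x: "x \<in> K" for h x
    proof -
      have "\<bar>(L (l + h) x - L l x) / h - D x\<bar> = \<bar>L (l + h) x - L l x - h * D x\<bar> / \<bar>h\<bar>"
        using h(1) by (simp add: abs_divide[symmetric] diff_divide_distrib)
      also have "\<dots> \<le> k * h\<^sup>2 * (L l x + D x) / \<bar>h\<bar>"
        using D(4)[of h x] h x K(2) by (intro divide_right_mono) (auto simp: r_def)
      also have "\<dots> = k * (L l x + D x) * \<bar>h\<bar>"
        using h(1) by (cases "0 \<le> h") (auto simp: power2_eq_square field_simps)
      also have "\<dots> \<le> k * \<bar>M\<bar> * \<bar>h\<bar>"
        using M x D(2) by (intro mult_right_mono mult_left_mono) force+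
      also have "\<dots> \<le> C * \<bar>h\<bar>" by (intro mult_right_mono) (auto simp: C_def)
      also have "\<dots> < e" using h C by (simp add: r_def pos_less_divide_eq mult.commute)
      finally show ?thesis by (simp add: dist_real_def)
    qed
    then show "\<forall>\<^sub>F h in at 0. \<forall>x\<in>K. dist ((L (l + h) x - L l x) / h) (D x) < e"
      unfolding eventually_at using r by (auto simp: dist_real_def intro!: exI[of _ r])
  qed
  then show "\<exists>D. continuous_on {0..<R} D \<and> (\<forall>K. compact K \<and> K \<subseteq> {0..<R} \<longrightarrow>
      uniform_limit K (\<lambda>h x. (L (l + h) x - L l x) / h) D (at 0))"
    using D(1) by blast
qed

subsection \<open>Limits of the parameter\<close>

text \<open>For large \<open>l\<close> a solution is concave as long as it stays below
  \<open>M'\<close>. If it were at most \<open>N\<close> somewhere, its slope from a minimum point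
  on would be too small to reach \<open>M'\<close> before \<open>R\<close>, so it could not blow
  up.\<close>

lemma large_solution_lower_bound:
  assumes "y0 = 1"
  shows "\<exists>\<Lambda>. \<forall>l u u1 s x. \<Lambda> \<le> l \<longrightarrow> large_solution l u u1 s \<longrightarrow> x \<in> {0..<R} \<longrightarrow> N < u x"
proof -
  define M where "M = max N 1"
  \<comment> \<open>A line of initial height \<open>M\<close> and slope
    \<open>\<bar>y1\<bar> M\<close> climbs to at most \<open>M (1 + \<bar>y1\<bar> R)\<close> within
    length \<open>R\<close>; the \<open>1\<close> makes the level unreachable.\<close>
  define M' where "M' = M * (1 + \<bar>y1\<bar> * R) + 1"
  have M: "0 < M" "N \<le> M" by (auto simp: M_def)
  have "0 \<le> M * (\<bar>y1\<bar> * R)" using M R by simp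
  then have M': "M < M'" by (simp add: M'_def algebra_simps)
  have "N < u x" if l: "a * M' powr (p - 1) \<le> l" and u: "large_solution l u u1 s" and x: "x \<in> {0..<R}" for l u u1 s x
  proof (rule ccontr)
    assume "\<not> N < u x"
    note tw = large_solutionD(5)[OF u] and nonneg = large_solutionD(8)[OF u]
    have du: "(u has_real_derivative u1 z) (at z within {0..<R})"
      "(u1 has_real_derivative rhs l (u z)) (at z within {0..<R})" if "z \<in> {0..<R}" for z
      using tw that by (auto simp: twice_deriv_def)
    have "continuous_on {0..x} u"
      by (rule continuous_on_subset[OF twice_deriv_continuous(1)[OF tw]]) (use x in auto)
    then obtain m where m: "m \<in> {0..x}" "\<And>z. z \<in> {0..x} \<Longrightarrow> u m \<le> u z"
      using continuous_attains_inf[of "{0..x}" u] x by auto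
    have mR: "m \<in> {0..<R}" using m x by auto
    have um: "u m \<le> M" using m(2)[of x] x \<open>\<not> N < u x\<close> M by auto
    \<comment> \<open>Away from \<open>0\<close> a minimum has nonpositive slope; at
      \<open>0\<close> the slope is \<open>y1 * u 0\<close>. Here \<open>y0 = 1\<close> matters: a
      Dirichlet slope at \<open>0\<close> would be uncontrolled.\<close>
    have u1m: "u1 m \<le> \<bar>y1\<bar> * M"
    proof (cases "m = 0")
      case True
      have "u1 m = y1 * u m" using True assms large_solutionD(3,4)[OF u] by simp
      also have "\<dots> \<le> \<bar>y1\<bar> * M" using um nonneg[OF mR] by (intro mult_mono) auto
      finally show ?thesis .
    next
      case False
      have "u1 m \<le> 0"
        by (rule deriv_nonpos_if_min_left[OF du(1)[OF mR], of 0]) (use m mR False in auto)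
      also have "0 \<le> \<bar>y1\<bar> * M" using M by simp
      finally show ?thesis .
    qed
    have "u y \<le> M'" if y: "m \<le> y" "y < R" for y
    proof (rule ccontr)
      assume "\<not> u y \<le> M'"
      have "continuous_on {m..y} (\<lambda>z. M' - u z)"
        by (intro continuous_intros continuous_on_subset[OF twice_deriv_continuous(1)[OF tw]]) (use mR y in auto)
      then have "\<exists>z\<in>{m..y}. (z = y \<or> M' - u z = 0) \<and> (\<forall>w\<in>{m..z}. 0 \<le> M' - u w)"
        using um M' y by (intro first_hit) auto
      then obtain z where z: "z \<in> {m..y}" "z = y \<or> M' - u z = 0" "\<forall>w\<in>{m..z}. 0 \<le> M' - u w" by blast
      have uz: "u z = M'" using z \<open>\<not> u y \<le> M'\<close> by force
      have u1: "u1 w \<le> u1 m" if w: "m \<le> w" "w \<le> z" for w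
      proof (rule deriv_nonpos_imp_ge[where S = "{0..<R}" and f = u1 and f' = "\<lambda>w. rhs l (u w)"])
        fix v assume v: "m < v" "v < w"
        have "0 \<le> u v" using nonneg[of v] v w z y mR by auto
        moreover have "u v powr (p - 1) \<le> M' powr (p - 1)"
          using z(3) v w \<open>0 \<le> u v\<close> p by (intro powr_mono2) auto
        then have "a * u v powr (p - 1) \<le> a * M' powr (p - 1)" using a by (intro mult_left_mono) auto
        then have "a * u v powr (p - 1) - l \<le> 0" using l by linarith
        ultimately show "rhs l (u v) \<le> 0" unfolding rhs_def by (intro mult_nonpos_nonneg) auto
      qed (use w z y mR du in auto)
      have "u z - u1 m * z \<le> u m - u1 m * m"
      proof (rule deriv_nonpos_imp_ge[where S = "{0..<R}" and f = "\<lambda>w. u w - u1 m * w" and f' = "\<lambda>w. u1 w - u1 m * 1"])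
        show "((\<lambda>w. u w - u1 m * w) has_real_derivative u1 w - u1 m * 1) (at w within {0..<R})" if "w \<in> {0..<R}" for w
          by (intro DERIV_diff[OF du(1)[OF that] DERIV_cmult[OF DERIV_ident]])
      qed (use u1 z y mR in auto)
      then have "u z \<le> u m + u1 m * (z - m)" by (simp add: algebra_simps)
      also have "\<dots> \<le> M + \<bar>y1\<bar> * M * R"
      proof (intro add_mono um)
        have "u1 m * (z - m) \<le> \<bar>y1\<bar> * M * (z - m)" using u1m z by (intro mult_right_mono) auto
        also have "\<dots> \<le> \<bar>y1\<bar> * M * R" using z y mR M by (intro mult_left_mono) auto
        finally show "u1 m * (z - m) \<le> \<bar>y1\<bar> * M * R" .
      qed
      finally show False using uz by (simp add: M'_def algebra_simps)
    qed
    then have "\<forall>\<^sub>F y in at_left R. u y \<le> M'" using mR by (auto simp: eventually_at_left_field)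
    moreover have "\<forall>\<^sub>F y in at_left R. M' < u y" using large_solutionD(7)[OF u] by (simp add: filterlim_at_top_dense)
    ultimately have "\<forall>\<^sub>F y in at_left R. False" by eventually_elim auto
    then show False by simp
  qed
  then show ?thesis by blast
qed

text \<open>For \<open>l \<le> 0\<close> all solutions are convex and bounded on
  \<open>{0..r'}\<close> by the one for \<open>l = 0\<close>. With \<open>\<mu> = - l\<close> they
  satisfy \<open>u'' \<ge> \<mu> u\<close>, so a value of fixed size at a point of nonnegative slope
  would grow beyond that bound within the distance \<open>g / 2\<close>.\<close>

lemma large_solution_upper_bound:
  assumes r: "0 \<le> r" "r < R" and \<epsilon>: "0 < \<epsilon>"
  shows "\<exists>\<Lambda>. \<forall>l u u1 s x. l \<le> \<Lambda> \<longrightarrow> large_solution l u u1 s \<longrightarrow> x \<in> {0..r} \<longrightarrow> u x < \<epsilon>"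
proof -
  obtain v v1 t where v: "large_solution 0 v v1 t" using large_solution_exists by blast
  define r' where "r' = (r + R) / 2"
  define g where "g = r' - r"
  have r': "r < r'" "r' < R" "0 < g" "r' = r + g" using r by (auto simp: r'_def g_def field_simps)
  have "continuous_on {0..r'} v"
    by (rule continuous_on_subset[OF twice_deriv_continuous(1)[OF large_solutionD(5)[OF v]]]) (use r r' in auto)
  then obtain N where N: "\<And>x. x \<in> {0..r'} \<Longrightarrow> v x \<le> N"
    using continuous_attains_sup[of "{0..r'}" v] r r' by force
  define b where "b = \<bar>y1\<bar> + 1"
  have b: "0 < b" "- b \<le> y1" by (auto simp: b_def)
  \<comment> \<open>Within \<open>\<delta>\<close> a descent of slope at least \<open>- s b\<close>
    costs at most half of the initial value \<open>s\<close>; the bound \<open>g / 2\<close> keeps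
    \<open>\<delta>\<close> in the range of \<open>incr\<close>.\<close>
  define \<delta> where "\<delta> = min (1 / (2 * b)) (g / 2)"
  have \<delta>: "0 < \<delta>" "\<delta> \<le> 1 / (2 * b)" "\<delta> \<le> g / 2" using b r' by (auto simp: \<delta>_def)
  \<comment> \<open>The first term lets the slope gain \<open>\<mu> (s / 2) \<delta>\<close>
    outweigh an initial slope \<open>- s b\<close>. The second pushes values below
    \<open>\<epsilon>\<close>; its \<open>32\<close> is the \<open>16\<close> of \<open>incr\<close>
    doubled by the loss of half of \<open>s\<close>.\<close>
  define \<mu>0 where "\<mu>0 = max (2 * b / \<delta>) (32 * \<bar>N\<bar> / (g\<^sup>2 * \<epsilon>) + 1)"
  have "u x < \<epsilon>" if l: "l \<le> - \<mu>0" and u: "large_solution l u u1 s" and x: "x \<in> {0..r}" for l u u1 s x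
  proof -
    define \<mu> where "\<mu> = - l"
    have \<mu>: "2 * b / \<delta> \<le> \<mu>" "32 * \<bar>N\<bar> / (g\<^sup>2 * \<epsilon>) < \<mu>" "0 < \<mu>"
    proof -
      have "\<mu>0 \<le> \<mu>" using l by (simp add: \<mu>_def)
      moreover have "0 \<le> 32 * \<bar>N\<bar> / (g\<^sup>2 * \<epsilon>)" using \<epsilon> by simp
      ultimately show "2 * b / \<delta> \<le> \<mu>" "32 * \<bar>N\<bar> / (g\<^sup>2 * \<epsilon>) < \<mu>" "0 < \<mu>" unfolding \<mu>0_def by linarith+
    qed
    note nonneg = large_solutionD(8)[OF u]
    have du: "(u has_real_derivative u1 z) (at z within {0..<R})"
      "(u1 has_real_derivative rhs l (u z)) (at z within {0..<R})" if "z \<in> {0..<R}" for z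
      using large_solutionD(5)[OF u] that by (auto simp: twice_deriv_def)
    have uN: "u z \<le> N" if "z \<in> {0..r'}" for z
      using large_solution_mono[OF u v, of z] N[OF that] that r' \<mu>(3) by (auto simp: \<mu>_def)
    have rhs: "\<mu> * u z \<le> rhs l (u z)" if "z \<in> {0..<R}" for z
      using nonneg[OF that] a by (simp add: rhs_def \<mu>_def algebra_simps)
    have rhs0: "0 \<le> rhs l (u z)" if "z \<in> {0..<R}" for z
      using rhs[OF that] mult_nonneg_nonneg[OF less_imp_le[OF \<mu>(3)] nonneg[OF that]] by simp
    have u1_mono: "u1 y \<le> u1 z" if "0 \<le> y" "y \<le> z" "z < R" for y z
      by (rule deriv_nonneg_imp_le[where S = "{0..<R}" and f = u1 and f' = "\<lambda>w. rhs l (u w)"])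
        (use that du rhs0 in auto)
    have u_lower: "u y + u1 y * (z - y) \<le> u z" if "0 \<le> y" "y \<le> z" "z < R" for y z
    proof -
      have "u y - u1 y * y \<le> u z - u1 y * z"
      proof (rule deriv_nonneg_imp_le[where S = "{0..<R}" and f = "\<lambda>w. u w - u1 y * w" and f' = "\<lambda>w. u1 w - u1 y * 1"])
        show "((\<lambda>w. u w - u1 y * w) has_real_derivative u1 w - u1 y * 1) (at w within {0..<R})" if "w \<in> {0..<R}" for w
          by (intro DERIV_diff[OF du(1)[OF that] DERIV_cmult[OF DERIV_ident]])
        show "0 \<le> u1 w - u1 y * 1" if "y < w" "w < z" for w using u1_mono[of y w] that \<open>0 \<le> y\<close> \<open>z < R\<close> by simp
      qed (use that in auto)
      then show ?thesis by (simp add: algebra_simps)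
    qed
    have u1_lower: "u1 y + \<mu> * c * (z - y) \<le> u1 z"
      if "0 \<le> y" "y \<le> z" "z < R" "\<And>w. y < w \<Longrightarrow> w < z \<Longrightarrow> c \<le> u w" for y z c
    proof -
      have "u1 y - \<mu> * c * y \<le> u1 z - \<mu> * c * z"
      proof (rule deriv_nonneg_imp_le[where S = "{0..<R}" and f = "\<lambda>w. u1 w - \<mu> * c * w" and f' = "\<lambda>w. rhs l (u w) - \<mu> * c * 1"])
        show "((\<lambda>w. u1 w - \<mu> * c * w) has_real_derivative rhs l (u w) - \<mu> * c * 1) (at w within {0..<R})" if "w \<in> {0..<R}" for w
          by (intro DERIV_diff[OF du(2)[OF that] DERIV_cmult[OF DERIV_ident]])
        fix w assume w: "y < w" "w < z"
        have "\<mu> * c \<le> \<mu> * u w" using that(4)[OF w] \<mu>(3) by (intro mult_left_mono) auto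
        also have "\<dots> \<le> rhs l (u w)" using rhs[of w] w that by simp
        finally show "0 \<le> rhs l (u w) - \<mu> * c * 1" by simp
      qed (use that in auto)
      then show ?thesis by (simp add: algebra_simps)
    qed
    \<comment> \<open>Two steps of length \<open>g / 4\<close>: on the first the slope grows to at
      least \<open>\<mu> u g / 4\<close>, on the second the function climbs by that slope and must
      remain below \<open>N\<close>.\<close>
    have incr: "\<mu> * u y * g\<^sup>2 \<le> 16 * N" if y: "0 \<le> y" "y \<le> r' - g / 2" "0 \<le> u1 y" for y
    proof -
      let ?z = "y + g / 4"
      have z: "?z + g / 4 \<le> r'" "y \<le> ?z" "?z \<le> r'" using y r' by (auto simp: field_simps)
      have uy: "0 \<le> u y" using nonneg[of y] y r' by auto
      have "u y \<le> u w" if "y < w" "w < ?z" for w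
      proof -
        have "0 \<le> u1 y * (w - y)" using y(3) that by (intro mult_nonneg_nonneg) auto
        moreover have "u y + u1 y * (w - y) \<le> u w" using that y(1) z r' by (intro u_lower) auto
        ultimately show ?thesis by linarith
      qed
      then have "u1 y + \<mu> * u y * (?z - y) \<le> u1 ?z" using y z r' by (intro u1_lower) auto
      then have "\<mu> * u y * (g / 4) \<le> u1 ?z" using y(3) by simp
      then have "\<mu> * u y * (g / 4) * (g / 4) \<le> u1 ?z * (g / 4)" using r' by (intro mult_right_mono) auto
      also have "\<dots> \<le> u (?z + g / 4)"
        using u_lower[of ?z "?z + g / 4"] nonneg[of ?z] z y r' by simp
      also have "\<dots> \<le> N" using uN[of "?z + g / 4"] z y r' by auto
      finally show ?thesis by (simp add: power2_eq_square field_simps)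
    qed
    have small: "32 * N < \<mu> * \<epsilon> * g\<^sup>2"
    proof -
      have "0 < g\<^sup>2 * \<epsilon>" using r' \<epsilon> by simp
      then have "32 * \<bar>N\<bar> < \<mu> * (g\<^sup>2 * \<epsilon>)" using \<mu>(2) by (simp add: pos_divide_less_eq)
      then show ?thesis by (simp add: ac_simps)
    qed
    have N0: "0 \<le> N" using uN[of x] nonneg[of x] x r' by auto
    have fin: "w < \<epsilon>" if "\<mu> * w * g\<^sup>2 \<le> 32 * N" for w
    proof -
      have "w * (\<mu> * g\<^sup>2) < \<epsilon> * (\<mu> * g\<^sup>2)" using that small by (simp add: ac_simps)
      then show ?thesis using \<mu>(3) r'(3) by (simp add: mult_less_cancel_right)
    qed
    show ?thesis
    proof (cases "0 \<le> u1 x")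
      case True
      then show ?thesis using incr[of x] x r' N0 by (intro fin) auto
    next
      case False
      \<comment> \<open>By convexity \<open>u\<close> has been descending since \<open>0\<close>, so
        it suffices to bound \<open>u 0\<close>. Such a descent requires a Robin condition; it is
        reversed before \<open>\<delta>\<close>, where \<open>incr\<close> applies.\<close>
      have "u1 0 < 0" using u1_mono[of 0 x] False x r by auto
      then have y0: "y0 = 1" using data large_solutionD(2,4)[OF u] by auto
      have s: "u 0 = s" "u1 0 = s * y1" "0 < s" using large_solutionD(2-4)[OF u] y0 by auto
      have "- (s * b) \<le> u1 0" using mult_left_mono[OF b(2), of s] s by simp
      have \<delta>R: "\<delta> \<le> r' - g / 2" "\<delta> < R" using \<delta> r r' by auto
      have half: "s / 2 \<le> u y" if "0 \<le> y" "y \<le> \<delta>" for y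
      proof -
        have "b * y \<le> 1 / 2" using mult_left_mono[of y "1 / (2 * b)" b] that \<delta> b by simp
        then have "s * (b * y) \<le> s * (1 / 2)" using s by (intro mult_left_mono) auto
        moreover have "- (s * b) * y \<le> u1 0 * y" using \<open>- (s * b) \<le> u1 0\<close> that by (intro mult_right_mono) auto
        moreover have "u 0 + u1 0 * (y - 0) \<le> u y" using that \<delta>R by (intro u_lower) auto
        moreover have "- (s * b) * y = - (s * (b * y))" by simp
        ultimately show ?thesis unfolding s(1) by simp
      qed
      have "u1 0 + \<mu> * (s / 2) * (\<delta> - 0) \<le> u1 \<delta>"
        using half \<delta> \<delta>R by (intro u1_lower) auto
      moreover have "s * b \<le> \<mu> * (s / 2) * \<delta>"
      proof -
        have "2 * b \<le> \<mu> * \<delta>" using \<mu>(1) \<delta>(1) by (simp add: pos_divide_le_eq)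
        then have "s / 2 * (2 * b) \<le> s / 2 * (\<mu> * \<delta>)" using s by (intro mult_left_mono) auto
        then show ?thesis by (simp add: ac_simps)
      qed
      ultimately have "0 \<le> u1 \<delta>" using \<open>- (s * b) \<le> u1 0\<close> by simp
      then have "\<mu> * u \<delta> * g\<^sup>2 \<le> 16 * N" using \<delta> \<delta>R by (intro incr) auto
      moreover have "\<mu> * (s / 2) * g\<^sup>2 \<le> \<mu> * u \<delta> * g\<^sup>2"
        using half[of \<delta>] \<delta> \<mu>(3) by (intro mult_right_mono mult_left_mono) auto
      ultimately have "s < \<epsilon>" by (intro fin) simp
      moreover have "u x \<le> u 0"
      proof (rule deriv_nonpos_imp_ge[where S = "{0..<R}" and f = u and f' = u1])
        show "u1 z \<le> 0" if "0 < z" "z < x" for z using u1_mono[of z x] False that x r by auto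
      qed (use x r du in auto)
      ultimately show ?thesis using s by simp
    qed
  qed
  then show ?thesis by blast
qed

lemma large_family_tendsto_0:
  assumes L: "\<And>l. large_solution l (L l) (L1 l) (s l)" and K: "compact K" "K \<subseteq> {0..<R}"
  shows "uniform_limit K L (\<lambda>_. 0) at_bot"
proof (rule uniform_limitI)
  fix e :: real assume e: "0 < e"
  obtain r where r: "0 \<le> r" "r < R" "K \<subseteq> {0..r}"
  proof (cases "K = {}")
    case True
    then show ?thesis using that[of 0] R by auto
  next
    case False
    then obtain m where m: "m \<in> K" "\<And>x. x \<in> K \<Longrightarrow> x \<le> m" using compact_attains_sup[OF K(1)] by blast
    have "K \<subseteq> {0..m}" using m(2) K(2) by auto
    moreover have "0 \<le> m" "m < R" using m(1) K(2) by auto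
    ultimately show ?thesis by (rule_tac that)
  qed
  obtain \<Lambda> where \<Lambda>: "\<And>l x. l \<le> \<Lambda> \<Longrightarrow> x \<in> {0..r} \<Longrightarrow> L l x < e"
    using large_solution_upper_bound[OF r(1,2) e] L by metis
  have "dist (L l x) 0 < e" if "l \<le> \<Lambda>" "x \<in> K" for l x
  proof -
    have "x \<in> {0..r}" "x \<in> {0..<R}" using that r(3) K(2) by auto
    then show ?thesis using \<Lambda>[of l x] large_solutionD(8)[OF L, of x l] that by simp
  qed
  then show "\<forall>\<^sub>F l in at_bot. \<forall>x\<in>K. dist (L l x) 0 < e"
    unfolding eventually_at_bot_linorder by blast
qed

end

section \<open>Assembly of the solution family and its properties\<close>

theorem theorem1p1:
  fixes R p a :: real and B :: boundary_operator
  assumes "R > 0" and "p > 1" and "a > 0"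
  shows "\<exists>L :: real \<Rightarrow> real \<Rightarrow> real.
    (\<forall>l. positive_solution R p a B l (L l) \<and> C2_on {0..<R} (L l) \<and>
         (\<forall>v. positive_solution R p a B l v \<longrightarrow> (\<forall>x\<in>{0..<R}. v x = L l x))) \<and>
    (differentiable_curve_C {0..<R} L \<and>
     (\<forall>x\<in>{0..<R}. if B = Dirichlet \<and> x = 0 then mono (\<lambda>l. L l x)
                   else strict_mono (\<lambda>l. L l x))) \<and>
    (if B = Dirichlet then (\<forall>l. L l 0 = 0)
     else (\<forall>K. compact K \<and> K \<subseteq> {0..<R} \<longrightarrow>
             (\<forall>M. \<forall>\<^sub>F l in at_top. \<forall>x\<in>K. L l x > M))) \<and>
    (\<forall>K. compact K \<and> K \<subseteq> {0..<R} \<longrightarrow> uniform_limit K L (\<lambda>_. 0) at_bot)"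
proof -
  define y0 y1 where "y0 = fst (boundary_data B)" and "y1 = snd (boundary_data B)"
  have bd: "(y0, y1) = boundary_data B" by (simp add: y0_def y1_def)
  have y0: "y0 = (if B = Dirichlet then 0 else 1)" by (simp add: y0_def fst_boundary_data)
  interpret boundary_problem R p a y0 y1
    using assms bd by unfold_locales (cases B; auto)+
  obtain L L1 s where L: "\<And>l. large_solution l (L l) (L1 l) (s l)" using large_solution_exists by metis
  note sol = positive_solution_iff[OF bd]
  have zero: "L l 0 = 0" if "B = Dirichlet" for l using large_solutionD(3)[OF L] y0 that by simp
  have sols: "\<forall>l. positive_solution R p a B l (L l) \<and> C2_on {0..<R} (L l) \<and>
      (\<forall>v. positive_solution R p a B l v \<longrightarrow> (\<forall>x\<in>{0..<R}. v x = L l x))"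
  proof (intro conjI allI impI ballI)
    fix l
    show "positive_solution R p a B l (L l)" using L sol by blast
    have "continuous_on {0..<R} (\<lambda>x. rhs l (L l x))"
      by (intro rhs_continuous twice_deriv_continuous(1)[OF large_solutionD(5)[OF L]] large_solutionD(8)[OF L])
    then show "C2_on {0..<R} (L l)"
      unfolding C2_on_def using large_solutionD(5)[OF L[of l]]
      by (intro exI[of _ "L1 l"] exI[of _ "\<lambda>x. rhs l (L l x)"]) (simp add: twice_deriv_def)
    show "v x = L l x" if v: "positive_solution R p a B l v" and x: "x \<in> {0..<R}" for v x
    proof -
      obtain v1 t where "large_solution l v v1 t" using sol v by blast
      then show ?thesis using L x by (rule large_solution_unique)
    qed
  qed
  have mono: "\<forall>x\<in>{0..<R}. if B = Dirichlet \<and> x = 0 then mono (\<lambda>l. L l x) else strict_mono (\<lambda>l. L l x)"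
  proof
    fix x assume x: "x \<in> {0..<R}"
    show "if B = Dirichlet \<and> x = 0 then mono (\<lambda>l. L l x) else strict_mono (\<lambda>l. L l x)"
    proof (cases "B = Dirichlet \<and> x = 0")
      case True
      \<comment> \<open>Under the Dirichlet condition the values at \<open>0\<close> are constant in
        \<open>l\<close>, so monotonicity cannot be strict there.\<close>
      then show ?thesis by (simp add: zero mono_def)
    next
      case False
      then have "x = 0 \<longrightarrow> y0 = 1" using y0 by auto
      then have "strict_mono (\<lambda>l. L l x)"
        by (intro strict_monoI large_solution_strict_mono[OF L L _ x])
      then show ?thesis using False by (simp only: if_False)
    qed
  qed
  have limits: "if B = Dirichlet then (\<forall>l. L l 0 = 0)
     else (\<forall>K. compact K \<and> K \<subseteq> {0..<R} \<longrightarrow> (\<forall>M. \<forall>\<^sub>F l in at_top. \<forall>x\<in>K. L l x > M))"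
  proof (cases "B = Dirichlet")
    case False
    then have "y0 = 1" using y0 by simp
    have "\<forall>\<^sub>F l in at_top. \<forall>x\<in>K. L l x > M" if "K \<subseteq> {0..<R}" for K M
    proof -
      obtain \<Lambda> where "\<And>l x. \<Lambda> \<le> l \<Longrightarrow> x \<in> {0..<R} \<Longrightarrow> M < L l x"
        using large_solution_lower_bound[OF \<open>y0 = 1\<close>, of M] L by metis
      then show ?thesis using that unfolding eventually_at_top_linorder by blast
    qed
    then show ?thesis using False by simp
  qed (simp add: zero)
  have "\<forall>K. compact K \<and> K \<subseteq> {0..<R} \<longrightarrow> uniform_limit K L (\<lambda>_. 0) at_bot"
    using large_family_tendsto_0[OF L] by blast
  then show ?thesis
    using sols mono limits large_family_differentiable[OF L] by (intro exI[of _ L] conjI)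
qed

end
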